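(* Let $P$ be the Bergman projection on the unit ball $\mathbb{B}_n\subset\mathbb{C}^n$. There is a constant $C>0$ such that whenever $b$ is harmonic on $\mathbb{B}_n$ and belongs to $\mathrm{BMO}$, the commutator $[\bar b,P]$ satisfies $$\|[\bar b,P]f\|_{L^{1,\infty}(\mathbb{B}_n)}\le C\,\|b\|_{\mathrm{BMO}}\,\|f\|_{L\log^+L},\qquad f\in L\log^+L.$$
   Context: $V$ is Lebesgue measure, $|E|=V(E)$, $\langle b\rangle_A=\frac1{|A|}\int_Ab\,dV$. The Bergman projection is $Pf(z)=c_n\int_{\mathbb{B}_n}\frac{f(w)}{(1-\langle z,w\rangle)^{n+1}}\,dV(w)$, $c_n=n!/\pi^n$, and $[\bar b,P]f=\bar b\,Pf-P(\bar bf)$. Carleson tents: $T_z=\{w\in\mathbb{B}_n:|1-\frac{\langle z,w\rangle}{|z|}|<1-|z|\}$ for $z\in\mathbb{B}_n\setminus\{0\}$, and $T_0=\mathbb{B}_n$. $\mathrm{BMO}$ is the space of locally integrable $b$ on $\mathbb{B}_n$ with $\|b\|_{\mathrm{BMO}}=\sup_{z\in\mathbb{B}_n}\frac1{|T_z|}\int_{T_z}|b-\langle b\rangle_{T_z}|\,dV<\infty$. $L\log^+L$ is the Orlicz space of measurable $f$ on $\mathbb{B}_n$ with Luxemburg norm $\|f\|_{L\log^+L}=\inf\{c>0:\int_{\mathbb{B}_n}\varphi(|f|/c)\,dV\le1\}<\infty$, where $\varphi(t)=t\log^+t$, $\log^+t=\max\{0,\log t\}$. $\|g\|_{L^{1,\infty}(\mathbb{B}_n)}=\sup_{\lambda>0}\lambda\,|\{z\in\mathbb{B}_n:|g(z)|>\lambda\}|$.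 *)

theory Defs
  imports "HOL-Analysis.Analysis"
begin

text \<open>
  Functions on the unit ball \<open>ball 0 1\<close> of \<open>complex ^ 'n\<close> are total functions whose values outside
  the ball are ignored. The measure \<open>lebesgue\<close> on \<open>complex ^ 'n\<close> is Lebesgue measure on
  \<open>\<real>\<^sup>2\<^sup>n\<close>, where \<open>n = CARD('n)\<close>, and \<open>norm\<close> is the Euclidean norm.
\<close>

definition hermitian_inner :: "complex ^ 'n \<Rightarrow> complex ^ 'n \<Rightarrow> complex"
  where "hermitian_inner z w = (\<Sum>i\<in>UNIV. z $ i * cnj (w $ i))"

definition harmonic_on :: "'a::euclidean_space set \<Rightarrow> ('a \<Rightarrow> 'b::real_normed_vector) \<Rightarrow> bool"
  where "harmonic_on S u \<longleftrightarrow>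
    (\<exists>(u' :: 'a \<Rightarrow> 'a \<Rightarrow>\<^sub>L 'b) (u'' :: 'a \<Rightarrow> 'a \<Rightarrow>\<^sub>L 'a \<Rightarrow>\<^sub>L 'b).
       (\<forall>x\<in>S. (u has_derivative blinfun_apply (u' x)) (at x)) \<and>
       (\<forall>x\<in>S. (u' has_derivative blinfun_apply (u'' x)) (at x)) \<and>
       continuous_on S u'' \<and>
       (\<forall>x\<in>S. (\<Sum>e\<in>Basis. blinfun_apply (blinfun_apply (u'' x) e) e) = 0))"

definition mean_on :: "(complex ^ 'n) set \<Rightarrow> (complex ^ 'n \<Rightarrow> complex) \<Rightarrow> complex"
  where "mean_on A b = (LINT w|lebesgue_on A. b w) / of_real (measure lebesgue A)"

definition carleson_tent :: "complex ^ 'n \<Rightarrow> (complex ^ 'n) set"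
  where "carleson_tent z =
    (if z = 0 then ball 0 1
     else {w \<in> ball 0 1. cmod (1 - hermitian_inner z w / of_real (norm z)) < 1 - norm z})"

text \<open>
  If \<open>b\<close> is measurable but not integrable on some tent, the integral below is infinite whatever
  value \<open>mean_on\<close> takes, so the norm is infinite.
\<close>

definition bmo_norm :: "(complex ^ 'n \<Rightarrow> complex) \<Rightarrow> ennreal"
  where "bmo_norm b =
    (SUP z\<in>ball 0 1.
       (\<integral>\<^sup>+ w. ennreal (cmod (b w - mean_on (carleson_tent z) b)) \<partial>lebesgue_on (carleson_tent z))
         / emeasure lebesgue (carleson_tent z))"

definition bmo :: "(complex ^ 'n \<Rightarrow> complex) set"
  where "bmo = {b. (\<forall>K. compact K \<and> K \<subseteq> ball 0 1 \<longrightarrow> integrable (lebesgue_on K) b) \<and> bmo_norm b < \<infinity>}"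

definition log_plus :: "real \<Rightarrow> real"
  where "log_plus t = max 0 (ln t)"

definition LlogL_norm :: "(complex ^ 'n \<Rightarrow> complex) \<Rightarrow> ennreal"
  where "LlogL_norm f =
    (INF c\<in>{c::real. 0 < c \<and>
        (\<integral>\<^sup>+ w. ennreal (cmod (f w) / c * log_plus (cmod (f w) / c)) \<partial>lebesgue_on (ball 0 1)) \<le> 1}.
       ennreal c)"

definition LlogL :: "(complex ^ 'n \<Rightarrow> complex) set"
  where "LlogL = {f. f \<in> borel_measurable (lebesgue_on (ball 0 1)) \<and> LlogL_norm f < \<infinity>}"

definition weak_L1_norm :: "(complex ^ 'n \<Rightarrow> complex) \<Rightarrow> ennreal"
  where "weak_L1_norm g =
    (SUP t\<in>{0::real<..}. ennreal t * emeasure lebesgue {z \<in> ball 0 1. t < cmod (g z)})"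

definition bergman_kernel :: "complex ^ 'n \<Rightarrow> complex ^ 'n \<Rightarrow> complex"
  where "bergman_kernel z w =
    of_real (fact CARD('n) / pi ^ CARD('n)) / (1 - hermitian_inner z w) ^ (CARD('n) + 1)"

definition bergman_projection :: "(complex ^ 'n \<Rightarrow> complex) \<Rightarrow> complex ^ 'n \<Rightarrow> complex"
  where "bergman_projection f z = (LINT w|lebesgue_on (ball 0 1). bergman_kernel z w * f w)"

text \<open>
  The Bochner integral is \<open>0\<close> for non-integrable functions; this predicate says that the integral
  defining the projection genuinely exists at every point of the ball.
\<close>

definition bergman_defined :: "(complex ^ 'n \<Rightarrow> complex) \<Rightarrow> bool"
  where "bergman_defined f \<longleftrightarrow>
    (\<forall>z\<in>ball 0 1. integrable (lebesgue_on (ball 0 1)) (\<lambda>w. bergman_kernel z w * f w))"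

definition bergman_commutator ::
    "(complex ^ 'n \<Rightarrow> complex) \<Rightarrow> (complex ^ 'n \<Rightarrow> complex) \<Rightarrow> complex ^ 'n \<Rightarrow> complex"
  where "bergman_commutator a f z =
    a z * bergman_projection f z - bergman_projection (\<lambda>w. a w * f w) z"

end

theory Submission
  imports Defs
begin

text \<open>
  Write \<open>d z w = |1 - \<langle>z, w\<rangle>|\<close>, \<open>P\<^sup>+\<close> for the Bergman projection with the kernel replaced by its modulus, and
  \<open>L w = 1 - ln (1 - |w|)\<close>.

  A harmonic \<open>b\<close> with BMO norm 1 and mean \<open>m\<close> satisfies \<open>|b - m| \<le> C * L\<close>. The mean of \<open>|b - m|\<close> over a tent of
  height \<open>\<rho>\<close> is at most \<open>C * (1 + ln (1 / \<rho>))\<close>, because the means over tents of heights \<open>2\<^sup>-\<^sup>k\<close> differ by bounded amounts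
  from one \<open>k\<close> to the next. Tents are much wider than high, so for harmonic, rather than pluriharmonic, \<open>b\<close> the
  tent of height \<open>1 - |z|\<close> does not control \<open>b z\<close>. A Poisson type averaging over the shell at distance
  \<open>(1 - |z|)\<^sup>2\<close> from the sphere does: tents of that height have Euclidean size \<open>1 - |z|\<close>, on which the Poisson kernel is
  almost constant, and passing from \<open>1 - |z|\<close> to its square only doubles the logarithm.

  Therefore the commutator is dominated by \<open>L * P\<^sup>+ |f| + P\<^sup>+ (L * |f|)\<close> and \<open>b\<close> disappears from the problem. Since \<open>exp (L / 2)\<close>
  is integrable, \<open>L * |f|\<close> is integrable for \<open>f\<close> in \<open>L log\<^sup>+ L\<close>, and the second term is handled by the weak type
  \<open>(1, 1)\<close> estimate for \<open>P\<^sup>+\<close>. For the first term, \<open>|{P\<^sup>+ |f| > t}| \<le> C / (t * ln t)\<close> when \<open>f\<close> is in \<open>L log\<^sup>+ L\<close>. Outside a set of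
  measure \<open>C / t\<close> the factor \<open>L\<close> is at most \<open>2 * ln t\<close>, and the logarithms cancel.
\<close>

subsection \<open>The Hermitian inner product and the Koranyi quasi-metric\<close>

text \<open>A weight of logarithmic size is what \<open>L log L\<close> tolerates: the dual Orlicz
  class consists of exponentially integrable functions, and the pointwise bound by \<open>L\<close>
  takes the place of a John-Nirenberg inequality. The delicate term is the one with \<open>L\<close>
  outside \<open>P\<^sup>+\<close>. Multiplication by an unbounded function does not preserve weak
  \<open>L\<^sup>1\<close>, so a weak type (1, 1) estimate alone cannot suffice there; the missing
  logarithm has to come from the size condition on \<open>f\<close>.

  For the growth of \<open>b\<close> there are no boundary values to start from. All averages are
  therefore solid: a compactly supported test function shaped like a Poisson kernel is paired with a
  smooth subharmonic function that dominates \<open>|b - m|\<close> at the point \<open>z\<close>,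
  and integration by parts is reduced to the translation invariance of Lebesgue measure. The pole of
  the kernel sits outside the closed ball, at distance \<open>1 - |z|\<close> from the sphere, which
  keeps the test function regular. All constants depend on the dimension alone.\<close>

lemma hermitian_inner_add_left: "hermitian_inner (x + y) z = hermitian_inner x z + hermitian_inner y z"
  by (simp add: hermitian_inner_def algebra_simps sum.distrib)

lemma hermitian_inner_diff_left: "hermitian_inner (x - y) z = hermitian_inner x z - hermitian_inner y z"
  by (simp add: hermitian_inner_def algebra_simps sum_subtractf)

lemma hermitian_inner_diff_right: "hermitian_inner z (x - y) = hermitian_inner z x - hermitian_inner z y"
  by (simp add: hermitian_inner_def algebra_simps sum_subtractf)

lemma hermitian_inner_mult_left: "hermitian_inner (c *s x) z = c * hermitian_inner x z"
  by (simp add: hermitian_inner_def algebra_simps sum_distrib_left)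

lemma hermitian_inner_mult_right: "hermitian_inner z (c *s x) = cnj c * hermitian_inner z x"
  by (simp add: hermitian_inner_def algebra_simps sum_distrib_left)

lemma hermitian_inner_scaleR_left: "hermitian_inner (c *\<^sub>R x) z = of_real c * hermitian_inner x z"
  by (simp add: hermitian_inner_def sum_distrib_left scaleR_conv_of_real[where 'a=complex] mult.assoc)

lemma hermitian_inner_scaleR_right: "hermitian_inner z (c *\<^sub>R x) = of_real c * hermitian_inner z x"
  by (simp add: hermitian_inner_def sum_distrib_left scaleR_conv_of_real[where 'a=complex] algebra_simps)

lemma hermitian_inner_commute: "hermitian_inner w z = cnj (hermitian_inner z w)"
  by (simp add: hermitian_inner_def mult.commute)

lemma Re_hermitian_inner: "Re (hermitian_inner z w) = z \<bullet> w"
  by (simp add: hermitian_inner_def inner_vec_def inner_complex_def)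

lemma hermitian_inner_self: "hermitian_inner z z = of_real ((norm z)\<^sup>2)"
proof (rule complex_eqI)
  show "Re (hermitian_inner z z) = Re (of_real ((norm z)\<^sup>2))"
    by (simp add: Re_hermitian_inner power2_norm_eq_inner)
  show "Im (hermitian_inner z z) = Im (of_real ((norm z)\<^sup>2))"
    using hermitian_inner_commute[of z z] by (simp add: complex_eq_iff)
qed

lemma hermitian_inner_axis: "hermitian_inner z (axis i 1) = z $ i"
  by (simp add: hermitian_inner_def axis_def if_distrib[of cnj] if_distrib[of "(*) _"] cong: if_cong)

text \<open>Turns a modulus into a real part. It serves the complex Cauchy-Schwarz inequality, the
  triangle inequality for \<open>hdist\<close> and the reflection onto an axis, and later the
  passage from the complex function \<open>b\<close> to a real harmonic function adapted to one
  point.\<close>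

lemma unimodular_rotation: obtains \<theta> :: complex where "cmod \<theta> = 1" "\<theta> * x = of_real (cmod x)"
proof (cases "x = 0")
  case False
  then show ?thesis
    by (intro that[of "cnj x / of_real (cmod x)"])
       (auto simp: norm_divide field_simps power2_eq_square simp flip: complex_norm_square)
qed (use that[of 1] in auto)

lemma norm_vector_mult: "norm (c *s x) = cmod c * norm (x :: complex ^ 'n)"
  by (simp add: norm_vec_def L2_set_def norm_mult power_mult_distrib
      flip: sum_distrib_left) (simp add: real_sqrt_mult)

lemma cmod_hermitian_inner_le: "cmod (hermitian_inner z w) \<le> norm z * norm (w :: complex ^ 'n)"
proof -
  obtain \<theta> where \<theta>: "cmod \<theta> = 1" "\<theta> * hermitian_inner z w = of_real (cmod (hermitian_inner z w))"
    by (rule unimodular_rotation)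
  have "cmod (hermitian_inner z w) = (\<theta> *s z) \<bullet> w"
    by (simp add: \<theta>(2) hermitian_inner_mult_left flip: Re_hermitian_inner)
  also have "\<dots> \<le> norm (\<theta> *s z) * norm w"
    by (rule norm_cauchy_schwarz)
  finally show ?thesis
    by (simp add: norm_vector_mult \<theta>(1))
qed

lemma continuous_on_hermitian_inner [continuous_intros]:
  assumes "continuous_on S f" "continuous_on S g"
  shows "continuous_on S (\<lambda>x. hermitian_inner (f x) (g x :: complex ^ 'n))"
  unfolding hermitian_inner_def by (intro continuous_intros assms)

text \<open>
  The Koranyi quasi-metric of the sphere, used on the closed ball. Inside the ball it is not a
  quasi-metric: \<open>hdist z z = 1 - (norm z)\<^sup>2\<close>, so \<open>kball z r\<close> below is empty for \<open>r \<le> 1 - norm z\<close>.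
\<close>

definition hdist :: "complex ^ 'n \<Rightarrow> complex ^ 'n \<Rightarrow> real"
  where "hdist z w = cmod (1 - hermitian_inner z w)"

lemma hdist_commute: "hdist z w = hdist w z"
proof -
  have "1 - hermitian_inner z w = cnj (1 - hermitian_inner w z)"
    using hermitian_inner_commute[of z w] by simp
  then show ?thesis
    by (simp add: hdist_def del: complex_cnj_diff)
qed

lemma hdist_nonneg [simp]: "0 \<le> hdist z w"
  by (simp add: hdist_def)

lemma continuous_on_hdist [continuous_intros]:
  assumes "continuous_on S f" "continuous_on S g"
  shows "continuous_on S (\<lambda>x. hdist (f x) (g x :: complex ^ 'n))"
  unfolding hdist_def by (intro continuous_intros assms)

lemma hdist_ge: "norm w \<le> 1 \<Longrightarrow> 1 - norm z \<le> hdist z w"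
proof -
  assume "norm w \<le> 1"
  then have "cmod (hermitian_inner z w) \<le> norm z"
    using cmod_hermitian_inner_le[of z w] mult_left_mono[of "norm w" 1 "norm z"] by auto
  then show ?thesis
    using norm_triangle_ineq2[of 1 "hermitian_inner z w"] by (simp add: hdist_def)
qed

lemma hdist_ge': "norm z \<le> 1 \<Longrightarrow> 1 - norm w \<le> hdist z w"
  using hdist_ge[of z w] by (simp add: hdist_commute)

lemma hdist_pos: "norm z < 1 \<Longrightarrow> norm w \<le> 1 \<Longrightarrow> 0 < hdist z w"
  using hdist_ge[of w z] by linarith

lemma hdist_le: "norm z \<le> 1 \<Longrightarrow> norm w \<le> 1 \<Longrightarrow> hdist z w \<le> 2"
proof -
  assume "norm z \<le> 1" "norm w \<le> 1"
  then have "cmod (hermitian_inner z w) \<le> 1"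
    using cmod_hermitian_inner_le[of z w] mult_mono[of "norm z" 1 "norm w" 1] by auto
  then show ?thesis
    using norm_triangle_ineq4[of 1 "hermitian_inner z w"] by (simp add: hdist_def)
qed

text \<open>The last two terms have a sign in the closed ball, so
  \<open>|z - w|\<^sup>2 \<le> 2 * hdist z w\<close> there: a Koranyi ball of radius
  \<open>h\<^sup>2\<close> has Euclidean size of order \<open>h\<close>. This is how the harmonic
  and the Koranyi geometry are compared.\<close>

lemma norm_diff_hdist:
  "(norm (z - w))\<^sup>2 = 2 * Re (1 - hermitian_inner z w) - (1 - (norm z)\<^sup>2) - (1 - (norm (w :: complex ^ 'n))\<^sup>2)"
  by (simp add: Re_hermitian_inner power2_norm_eq_inner inner_diff_left inner_diff_right
      inner_commute[of w z])

text \<open>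
  The form \<open>hermitian_inner x y - hermitian_inner x u * hermitian_inner u y\<close> is positive
  semidefinite for \<open>norm u \<le> 1\<close>, and it is the defect in the first identity of the proof.
\<close>

lemma hdist_triangle:
  fixes z w u :: "complex ^ 'n"
  assumes "norm z \<le> 1" "norm w \<le> 1" "norm u \<le> 1"
  shows "hdist z w \<le> 2 * (hdist z u + hdist u w)"
proof -
  define Q where "Q x y = hermitian_inner x y - hermitian_inner x u * hermitian_inner u y" for x y
  have Qself: "Q x x = of_real ((norm x)\<^sup>2 - (cmod (hermitian_inner x u))\<^sup>2)" for x
  proof -
    have "hermitian_inner x u * hermitian_inner u x = of_real ((cmod (hermitian_inner x u))\<^sup>2)"
      by (subst hermitian_inner_commute[of u x]) (rule complex_norm_square[symmetric])
    then show ?thesis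
      by (simp add: Q_def hermitian_inner_self)
  qed
  have Qpos: "0 \<le> Re (Q x x)" for x
  proof -
    have "cmod (hermitian_inner x u) \<le> norm x"
      using cmod_hermitian_inner_le[of x u] mult_left_mono[OF assms(3), of "norm x"] by auto
    then show ?thesis
      by (simp add: Qself power_mono)
  qed
  \<comment> \<open>With \<open>a = hermitian_inner x u\<close> the chain is \<open>|x|\<^sup>2 -
    |a|\<^sup>2 \<le> 1 - |a|\<^sup>2 \<le> 2 * (1 - |a|) \<le> 2 * hdist x u\<close>.\<close>
  have Qle: "Re (Q x x) \<le> 2 * hdist x u" if "norm x \<le> 1" for x
  proof -
    define a where "a = hermitian_inner x u"
    have "1 - cmod a \<le> hdist x u"
      using norm_triangle_ineq2[of 1 a] by (simp add: hdist_def a_def)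
    moreover have "cmod a \<le> 1"
      using cmod_hermitian_inner_le[of x u] mult_mono[of "norm x" 1 "norm u" 1] assms(3) that
      by (auto simp: a_def)
    moreover have "(norm x)\<^sup>2 \<le> 1"
      using that by (simp add: abs_square_le_1)
    moreover have "0 \<le> (1 - cmod a)\<^sup>2"
      by simp
    ultimately show ?thesis
      by (simp add: Qself a_def[symmetric] power2_eq_square algebra_simps)
  qed
  obtain \<theta> where \<theta>: "cmod \<theta> = 1" "\<theta> * Q z w = of_real (cmod (Q z w))"
    by (rule unimodular_rotation)
  have \<theta>': "\<theta> * cnj \<theta> = 1"
    using \<theta>(1) complex_norm_square[of \<theta>] by simp
  have Qcomm: "Q w z = cnj (Q z w)"
    by (simp add: Q_def flip: hermitian_inner_commute)
  \<comment> \<open>Cauchy-Schwarz for the semidefinite form, in the additive version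
    \<open>2 * |Q z w| \<le> Q z z + Q w w\<close>.\<close>
  have "Q (\<theta> *s z - w) (\<theta> *s z - w) = (\<theta> * cnj \<theta>) * Q z z + Q w w - \<theta> * Q z w - cnj (\<theta> * Q z w)"
    by (simp add: Q_def hermitian_inner_diff_left hermitian_inner_diff_right
        hermitian_inner_mult_left hermitian_inner_mult_right algebra_simps
        flip: hermitian_inner_commute)
  then have "Re (Q (\<theta> *s z - w) (\<theta> *s z - w)) = Re (Q z z) + Re (Q w w) - 2 * cmod (Q z w)"
    unfolding \<theta>' \<theta>(2) by simp
  then have "2 * cmod (Q z w) \<le> 2 * hdist z u + 2 * hdist w u"
    using Qpos[of "\<theta> *s z - w"] Qle[OF assms(1)] Qle[OF assms(2)] by simp
  moreover have "hdist z w \<le> hdist z u + hdist u w + cmod (Q z w)"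
  proof -
    have eq: "1 - hermitian_inner z w =
        (1 - hermitian_inner z u) + hermitian_inner z u * (1 - hermitian_inner u w) - Q z w"
      by (simp add: Q_def algebra_simps)
    have "cmod (hermitian_inner z u) \<le> 1"
      using cmod_hermitian_inner_le[of z u] mult_mono[of "norm z" 1 "norm u" 1] assms by auto
    then have "cmod (hermitian_inner z u * (1 - hermitian_inner u w)) \<le> hdist u w"
      unfolding norm_mult hdist_def[symmetric] by (intro mult_left_le_one_le) auto
    then show ?thesis
      unfolding hdist_def[of z w] eq
      using norm_triangle_ineq4[of "(1 - hermitian_inner z u) + hermitian_inner z u * (1 - hermitian_inner u w)" "Q z w"]
        norm_triangle_ineq[of "1 - hermitian_inner z u" "hermitian_inner z u * (1 - hermitian_inner u w)"]
      by (simp add: hdist_def)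
  qed
  ultimately show ?thesis
    by (simp add: hdist_commute[of w u])
qed

text \<open>
  Comparison of two translation invariant measures by Fubini's theorem: for \<open>\<nu>\<close> the image
  measure, \<open>\<nu> A * |B| = \<nu> B * |A|\<close> up to reflections, with \<open>B\<close> the unit ball.
\<close>

lemma lborel_distr_orthogonal:
  fixes U :: "'a::euclidean_space \<Rightarrow> 'a"
  assumes U: "orthogonal_transformation U"
  shows "distr lborel borel U = lborel"
proof -
  define V where "V = inv U"
  have V: "orthogonal_transformation V"
    unfolding V_def by (rule orthogonal_transformation_inv[OF U])
  have lin: "linear U" "linear V"
    using U V orthogonal_transformation_linear by auto
  have UV: "U (V x) = x" for x
    unfolding V_def by (rule surj_f_inv_f[OF orthogonal_transformation_surj[OF U]])
  have normU: "norm (U x) = norm x" for x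
    using U by (simp add: orthogonal_transformation)
  have [measurable]: "U \<in> borel_measurable borel"
    using linear_continuous_on[of U UNIV] lin linear_conv_bounded_linear
    by (intro borel_measurable_continuous_onI) blast
  define \<nu> where "\<nu> = distr lborel borel U"
  have sets\<nu> [measurable_cong]: "sets \<nu> = sets borel"
    by (simp add: \<nu>_def)
  have nn: "(\<integral>\<^sup>+y. g y \<partial>\<nu>) = (\<integral>\<^sup>+y. g (U y) \<partial>lborel)" if "g \<in> borel_measurable borel" for g
    unfolding \<nu>_def using that by (subst nn_integral_distr) auto
  have tr: "(\<integral>\<^sup>+y. g (x + y) \<partial>lborel) = (\<integral>\<^sup>+y. g y \<partial>lborel)"
    if [measurable]: "g \<in> borel_measurable borel" for g :: "'a \<Rightarrow> ennreal" and x
    by (subst (2) lborel_distr_plus[of x, symmetric]) (simp add: nn_integral_distr)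
  have tr\<nu>: "(\<integral>\<^sup>+y. g (x + y) \<partial>\<nu>) = (\<integral>\<^sup>+y. g y \<partial>\<nu>)"
    if [measurable]: "g \<in> borel_measurable borel" for g :: "'a \<Rightarrow> ennreal" and x
    using tr[of "\<lambda>y. g (U y)" "V x"] by (simp add: nn linear_add[OF lin(1)] UV)
  define B where "B = ball (0::'a) 1"
  have [measurable]: "B \<in> sets borel"
    by (simp add: B_def)
  have refl: "(\<integral>\<^sup>+x. g (- x) \<partial>lborel) = (\<integral>\<^sup>+x. g x \<partial>lborel)"
    if [measurable]: "g \<in> borel_measurable borel" for g :: "'a \<Rightarrow> ennreal"
    using nn_integral_distr[of uminus lborel borel g] lborel_affine[of "-1" "0 :: 'a"]
    by (simp add: density_1)
  \<comment> \<open>The unit ball is invariant under \<open>U\<close> and has finite positive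
    measure; this fixes the factor between the two measures as 1.\<close>
  have \<nu>B: "emeasure \<nu> B = emeasure lborel B"
  proof -
    have "U -` B = B"
      by (auto simp: B_def normU)
    then show ?thesis
      by (simp add: \<nu>_def emeasure_distr)
  qed
  have "emeasure \<nu> A = emeasure lborel A" if A [measurable]: "A \<in> sets borel" for A
  proof -
    define f :: "'a \<Rightarrow> ennreal" where "f x = indicator A x" for x
    define g :: "'a \<Rightarrow> ennreal" where "g y = indicator B y" for y
    have [measurable]: "f \<in> borel_measurable borel" "g \<in> borel_measurable borel"
      by (auto simp: f_def[abs_def] g_def[abs_def])
    have [measurable]: "(\<lambda>p. fst p + snd p) \<in> borel_measurable (borel \<Otimes>\<^sub>M (borel :: 'a measure))"
      by measurable
    interpret \<nu>: sigma_finite_measure lborel by (rule sigma_finite_lborel)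
    \<comment> \<open>The double integral of \<open>f x * g (x + U y)\<close> is evaluated twice.
      Shifting \<open>y\<close> at fixed \<open>x\<close> gives the measure of \<open>A\<close>
      times \<open>\<nu> B\<close>; shifting \<open>x\<close> at fixed \<open>y\<close>, followed by
      a reflection, gives \<open>\<nu> A\<close> times the measure of \<open>B\<close>.\<close>
    have "(\<integral>\<^sup>+x. f x \<partial>lborel) * (\<integral>\<^sup>+y. g y \<partial>\<nu>) = (\<integral>\<^sup>+x. (\<integral>\<^sup>+y. f x * g y \<partial>\<nu>) \<partial>lborel)"
      by (simp add: nn_integral_cmult nn_integral_multc)
    also have "\<dots> = (\<integral>\<^sup>+x. (\<integral>\<^sup>+y. f x * g (x + y) \<partial>\<nu>) \<partial>lborel)"
      by (rule nn_integral_cong) (simp add: nn_integral_cmult tr\<nu>)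
    also have "\<dots> = (\<integral>\<^sup>+x. (\<integral>\<^sup>+y. f x * g (x + U y) \<partial>lborel) \<partial>lborel)"
      by (rule nn_integral_cong, subst nn) auto
    also have "\<dots> = (\<integral>\<^sup>+y. (\<integral>\<^sup>+x. f x * g (x + U y) \<partial>lborel) \<partial>lborel)"
      by (rule lborel_pair.Fubini') measurable
    also have "\<dots> = (\<integral>\<^sup>+y. (\<integral>\<^sup>+x. f (x - U y) * g x \<partial>lborel) \<partial>lborel)"
    proof (rule nn_integral_cong)
      fix y
      show "(\<integral>\<^sup>+x. f x * g (x + U y) \<partial>lborel) = (\<integral>\<^sup>+x. f (x - U y) * g x \<partial>lborel)"
        using tr[of "\<lambda>x. f x * g (x + U y)" "- U y"] by (simp add: algebra_simps)
    qed
    also have "\<dots> = (\<integral>\<^sup>+x. (\<integral>\<^sup>+y. f (x - U y) * g x \<partial>lborel) \<partial>lborel)"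
      by (rule lborel_pair.Fubini') measurable
    also have "\<dots> = (\<integral>\<^sup>+x. (\<integral>\<^sup>+y. f (U y) \<partial>lborel) * g x \<partial>lborel)"
    proof (rule nn_integral_cong)
      fix x
      have "(\<integral>\<^sup>+y. f (x - U y) * g x \<partial>lborel) = (\<integral>\<^sup>+y. f (x - U y) \<partial>lborel) * g x"
        by (simp add: nn_integral_multc)
      also have "(\<integral>\<^sup>+y. f (x - U y) \<partial>lborel) = (\<integral>\<^sup>+y. f (x + U y) \<partial>lborel)"
        using refl[of "\<lambda>y. f (x - U y)"] by (simp add: linear_neg[OF lin(1)])
      also have "\<dots> = (\<integral>\<^sup>+y. f (U y) \<partial>lborel)"
        using tr\<nu>[of f x] by (simp add: nn)
      finally show "(\<integral>\<^sup>+y. f (x - U y) * g x \<partial>lborel) = (\<integral>\<^sup>+y. f (U y) \<partial>lborel) * g x" .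
    qed
    also have "\<dots> = (\<integral>\<^sup>+y. f y \<partial>\<nu>) * (\<integral>\<^sup>+x. g x \<partial>lborel)"
      by (simp add: nn nn_integral_cmult)
    finally have "emeasure lborel A * emeasure lborel B = emeasure \<nu> A * emeasure lborel B"
      by (simp add: f_def g_def sets\<nu> \<nu>B)
    moreover have "emeasure lborel B \<noteq> 0" "emeasure lborel B \<noteq> \<infinity>"
      using content_ball_pos[of 1 "0::'a"] emeasure_lborel_ball_finite[of "0::'a" 1]
      by (auto simp: B_def measure_def less_top)
    ultimately show ?thesis
      by (simp add: ennreal_mult_cancel_left mult.commute[of _ "emeasure lborel B"])
  qed
  then show ?thesis
    unfolding \<nu>_def by (intro measure_eqI) auto
qed

lemma emeasure_lborel_orthogonal_vimage:
  fixes U :: "'a::euclidean_space \<Rightarrow> 'a"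
  assumes U: "orthogonal_transformation U" and [measurable]: "A \<in> sets borel"
  shows "emeasure lborel (U -` A) = emeasure lborel A"
proof -
  have [measurable]: "U \<in> borel_measurable borel"
    using linear_continuous_on[of U UNIV] orthogonal_transformation_linear[OF U] linear_conv_bounded_linear
    by (intro borel_measurable_continuous_onI) blast
  have "emeasure lborel A = emeasure (distr lborel borel U) A"
    by (simp add: lborel_distr_orthogonal[OF U])
  then show ?thesis
    by (simp add: emeasure_distr)
qed

text \<open>A complex Householder reflection, preceded by multiplication with a phase.\<close>

lemma exists_unitary_to_axis:
  fixes z :: "complex ^ 'n" and i :: 'n
  obtains U where "orthogonal_transformation U"
    "\<And>x y. hermitian_inner (U x) (U y) = hermitian_inner x y"
    "U z = axis i (of_real (norm z))"
proof -
  \<comment> \<open>The complex reflection along \<open>v = \<theta> *s z - a\<close> carries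
    \<open>\<theta> *s z\<close> to \<open>a\<close> only if their Hermitian product is real; the
    phase arranges this. For \<open>v = 0\<close> the map \<open>U\<close> is multiplication by the
    phase.\<close>
  obtain \<theta> where \<theta>: "cmod \<theta> = 1" "\<theta> * z $ i = of_real (cmod (z $ i))"
    by (rule unimodular_rotation)
  have \<theta>': "\<theta> * cnj \<theta> = 1" "cnj \<theta> * \<theta> = 1"
    using \<theta>(1) complex_norm_square[of \<theta>] by (simp_all add: mult.commute)
  define a :: "complex ^ 'n" where "a = of_real (norm z) *s axis i 1"
  define v where "v = \<theta> *s z - a"
  define c where "c = 2 / (norm v)\<^sup>2"
  define U where "U x = \<theta> *s x - (of_real c * hermitian_inner (\<theta> *s x) v) *s v" for x
  have norma: "norm a = norm z"
    by (simp add: a_def norm_vector_mult)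
  have U0: "U x = \<theta> *s x" if "v = 0" for x
    using that by (simp add: U_def vec_eq_iff)
  have herm: "hermitian_inner (U x) (U y) = hermitian_inner x y" for x y
  proof -
    define X Y where "X = \<theta> *s x" and "Y = \<theta> *s y"
    have XY: "hermitian_inner X Y = hermitian_inner x y"
      using \<theta>' by (simp add: X_def Y_def hermitian_inner_mult_left hermitian_inner_mult_right flip: mult.assoc)
    show ?thesis
    proof (cases "v = 0")
      case True
      then show ?thesis
        using XY by (simp add: U0 X_def Y_def)
    next
      case False
      then have c: "of_real c * (of_real c * hermitian_inner v v) = 2 * (of_real c :: complex)"
        by (simp add: c_def hermitian_inner_self)
      have "hermitian_inner (U x) (U y) = hermitian_inner X Y
          - 2 * of_real c * hermitian_inner X v * hermitian_inner v Y
          + (of_real c * (of_real c * hermitian_inner v v)) * hermitian_inner X v * hermitian_inner v Y"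
        unfolding U_def X_def[symmetric] Y_def[symmetric]
        by (simp add: hermitian_inner_diff_left hermitian_inner_diff_right
            hermitian_inner_mult_left hermitian_inner_mult_right algebra_simps
            flip: hermitian_inner_commute)
      then show ?thesis
        unfolding c using XY by simp
    qed
  qed
  have lin: "linear U"
  proof (rule linearI)
    show "U (x + y) = U x + U y" for x y
      by (simp add: U_def hermitian_inner_mult_left hermitian_inner_add_left vec_eq_iff algebra_simps)
    show "U (r *\<^sub>R x) = r *\<^sub>R U x" for r x
      by (simp add: U_def hermitian_inner_mult_left hermitian_inner_scaleR_left vec_eq_iff
          scaleR_conv_of_real[where 'a=complex] algebra_simps)
  qed
  have orth: "orthogonal_transformation U"
    unfolding orthogonal_transformation_def using lin herm
    by (metis Re_hermitian_inner)
  have "U z = a"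
  proof (cases "v = 0")
    case True
    then show ?thesis
      using U0 by (simp add: v_def)
  next
    case False
    have real: "hermitian_inner (\<theta> *s z) a = of_real (norm z * cmod (z $ i))"
      by (simp add: a_def hermitian_inner_mult_left hermitian_inner_mult_right hermitian_inner_axis \<theta>(2) flip: mult.assoc)
    have n\<theta>: "norm (\<theta> *s z) = norm z"
      by (simp add: norm_vector_mult \<theta>(1))
    have "hermitian_inner (\<theta> *s z) v = of_real ((norm z)\<^sup>2 - norm z * cmod (z $ i))"
      by (simp add: v_def hermitian_inner_diff_right real hermitian_inner_self n\<theta>)
    moreover have "(norm v)\<^sup>2 = 2 * ((norm z)\<^sup>2 - norm z * cmod (z $ i))"
    proof -
      have "(norm v)\<^sup>2 = (norm (\<theta> *s z))\<^sup>2 - 2 * Re (hermitian_inner (\<theta> *s z) a) + (norm a)\<^sup>2"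
        by (simp add: v_def Re_hermitian_inner power2_norm_eq_inner inner_diff_left inner_diff_right inner_commute)
      then show ?thesis
        by (simp add: real norma n\<theta>)
    qed
    ultimately have "hermitian_inner (\<theta> *s z) v = of_real ((norm v)\<^sup>2 / 2)"
      by simp
    then have "of_real c * hermitian_inner (\<theta> *s z) v = 1"
      using False by (simp add: c_def mult.commute)
    then show ?thesis
      by (simp add: U_def v_def)
  qed
  also have "a = axis i (of_real (norm z))"
    by (simp add: a_def axis_def vec_eq_iff)
  finally show ?thesis
    using that orth herm by blast
qed

subsection \<open>Volumes of Koranyi balls\<close>

lemma prod_Basis_vec: "(\<Prod>b\<in>Basis. f b) = (\<Prod>j\<in>UNIV. \<Prod>u\<in>Basis. f (axis j u :: 'a::euclidean_space ^ 'n))"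
proof -
  have "(\<Prod>b\<in>Basis. f b) = (\<Prod>j\<in>UNIV. \<Prod>b\<in>(\<lambda>u. axis j u :: 'a ^ 'n) ` Basis. f b)"
    unfolding Basis_vec_def
    by (subst prod.UNION_disjoint[symmetric]) (auto simp: axis_eq_axis image_def intro!: prod.cong)
  also have "\<dots> = (\<Prod>j\<in>UNIV. \<Prod>u\<in>Basis. f (axis j u))"
    by (intro prod.cong refl prod.reindex_cong[where l="\<lambda>u. axis _ u"]) (auto simp: inj_on_def axis_eq_axis)
  finally show ?thesis .
qed

text \<open>The shape of a Koranyi ball near a boundary point on the axis \<open>i\<close>: half
  side of order \<open>r\<close> in that complex direction and of order \<open>sqrt r\<close> in the
  others, hence volume of order \<open>r ^ (n + 1)\<close>.\<close>

definition abox :: "'n::finite \<Rightarrow> complex ^ 'n \<Rightarrow> real \<Rightarrow> real \<Rightarrow> (complex ^ 'n) set"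
  where "abox i c \<alpha> \<beta> =
    (let u = (\<chi> j. if j = i then Complex \<alpha> \<alpha> else Complex \<beta> \<beta>) in cbox (c - u) (c + u))"

lemma mem_abox:
  "v \<in> abox i c \<alpha> \<beta> \<longleftrightarrow> (\<forall>j. \<bar>Re (v $ j) - Re (c $ j)\<bar> \<le> (if j = i then \<alpha> else \<beta>) \<and>
      \<bar>Im (v $ j) - Im (c $ j)\<bar> \<le> (if j = i then \<alpha> else \<beta>))"
  unfolding abox_def Let_def mem_box_cart mem_box
  by (auto simp: mem_box Basis_vec_def Basis_complex_def inner_axis abs_le_iff inner_complex_def
      algebra_simps split: if_splits)

lemma borel_abox [measurable]: "abox i c \<alpha> \<beta> \<in> sets borel"
  by (simp add: abox_def Let_def)

lemma emeasure_abox: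
  fixes i :: "'n::finite"
  assumes "0 \<le> \<alpha>" "0 \<le> \<beta>"
  shows "emeasure lborel (abox i c \<alpha> \<beta>) = ennreal (4 * \<alpha>\<^sup>2 * (4 * \<beta>\<^sup>2) ^ (CARD('n) - 1))"
proof -
  define u :: "complex ^ 'n" where "u = (\<chi> j. if j = i then Complex \<alpha> \<alpha> else Complex \<beta> \<beta>)"
  define f where "f j = (if j = i then 4 * \<alpha>\<^sup>2 else 4 * \<beta>\<^sup>2)" for j
  have u: "0 \<le> u \<bullet> b" if "b \<in> Basis" for b
    using that assms by (auto simp: u_def Basis_vec_def Basis_complex_def inner_axis inner_complex_def)
  have "emeasure lborel (abox i c \<alpha> \<beta>) = ennreal (\<Prod>b\<in>Basis. ((c + u) - (c - u)) \<bullet> b)"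
    unfolding abox_def Let_def u_def[symmetric] using u
    by (intro emeasure_lborel_cbox) (auto simp: inner_diff_left inner_add_left)
  also have "(\<Prod>b\<in>Basis. ((c + u) - (c - u)) \<bullet> b) = (\<Prod>j\<in>UNIV. \<Prod>d\<in>Basis. (2 * u $ j) \<bullet> d)"
    by (subst prod_Basis_vec) (simp add: inner_axis inner_add_left)
  also have "\<dots> = (\<Prod>j\<in>UNIV. f j)"
    by (intro prod.cong refl) (simp add: f_def u_def Basis_complex_def inner_complex_def power2_eq_square)
  also have "\<dots> = f i * (\<Prod>j\<in>UNIV - {i}. f j)"
    by (simp add: prod.remove)
  also have "(\<Prod>j\<in>UNIV - {i}. f j) = (\<Prod>j\<in>UNIV - {i}. 4 * \<beta>\<^sup>2)"
    by (intro prod.cong) (auto simp: f_def)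
  finally show ?thesis
    by (simp add: f_def card_Diff_singleton)
qed

lemma norm_vec_square: "(norm (v :: complex ^ 'n))\<^sup>2 = (\<Sum>j\<in>UNIV. (Re (v $ j))\<^sup>2 + (Im (v $ j))\<^sup>2)"
  by (simp add: norm_vec_def L2_set_def sum_nonneg cmod_power2)

definition kball :: "complex ^ 'n \<Rightarrow> real \<Rightarrow> (complex ^ 'n) set"
  where "kball z r = {w \<in> ball 0 1. hdist z w < r}"

text \<open>
  \<open>kshell w \<rho>\<close> is a Whitney region of height about \<open>\<rho>\<close> below \<open>w\<close>; the interval for
  \<open>1 - (norm v)\<^sup>2\<close> is the one on which \<open>cutoff2 \<rho>\<close> is at least \<open>1 / \<rho>\<close>.
\<close>

definition kshell :: "complex ^ 'n \<Rightarrow> real \<Rightarrow> (complex ^ 'n) set"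
  where "kshell w \<rho> = {v \<in> kball w (6 * \<rho>). 5/4 * \<rho> \<le> 1 - (norm v)\<^sup>2 \<and> 1 - (norm v)\<^sup>2 \<le> 7/4 * \<rho>}"

lemma open_kball [simp, intro]: "open (kball z r)"
proof -
  have "kball z r = ball 0 1 \<inter> {w. hdist z w < r}"
    by (auto simp: kball_def)
  then show ?thesis
    by (auto intro!: open_Int open_Collect_less continuous_intros)
qed

lemma borel_kball [measurable, simp]: "kball z r \<in> sets borel"
  by (simp add: borel_open)

lemma kball_iff: "w \<in> kball z r \<longleftrightarrow> norm w < 1 \<and> hdist z w < r"
  by (simp add: kball_def)

lemma borel_kshell [measurable, simp]: "kshell w \<rho> \<in> sets borel"
proof -
  have "kshell w \<rho> = kball w (6 * \<rho>) \<inter> {v. 5/4 * \<rho> \<le> 1 - (norm v)\<^sup>2} \<inter> {v. 1 - (norm v)\<^sup>2 \<le> 7/4 * \<rho>}"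
    by (auto simp: kshell_def)
  then show ?thesis
    by (auto intro!: sets.Int borel_closed closed_Collect_le continuous_intros)
qed

text \<open>After a unitary map the centre lies on an axis. A nonempty ball forces
  \<open>1 - norm z < r\<close>, so that \<open>|1 - v $ i| < 2 * r\<close>; then
  \<open>norm v < 1\<close> bounds the square of every other coordinate by
  \<open>1 - |v $ i|\<^sup>2 \<le> 4 * r\<close>. A box with half sides \<open>2 * r\<close> and
  \<open>2 * sqrt r\<close> results.\<close>

lemma emeasure_kball_le:
  "\<exists>C>0. \<forall>(z :: complex ^ 'n) r. norm z \<le> 1 \<longrightarrow> 0 < r \<longrightarrow>
     emeasure lborel (kball z r) \<le> ennreal (C * r ^ (CARD('n) + 1))"
proof (intro exI[of _ "16 * 16 ^ (CARD('n) - 1) :: real"] conjI allI impI)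
  fix z :: "complex ^ 'n" and r :: real
  assume z: "norm z \<le> 1" and r: "0 < r"
  define i :: 'n where "i = undefined"
  obtain U where U: "orthogonal_transformation U"
    "\<And>x y. hermitian_inner (U x) (U y) = hermitian_inner x y" "U z = axis i (of_real (norm z))"
    using exists_unitary_to_axis[of z i] by metis
  define a where "a = axis i (complex_of_real (norm z))"
  have hda: "hdist a v = cmod (1 - norm z * v $ i)" for v :: "complex ^ 'n"
  proof -
    have a': "a = norm z *\<^sub>R axis i 1"
      by (auto simp: a_def axis_def vec_eq_iff scaleR_conv_of_real[where 'a=complex])
    show ?thesis
      unfolding hdist_commute[of a] unfolding hdist_def a'
      by (simp add: hermitian_inner_scaleR_right hermitian_inner_axis)
  qed
  have "kball z r = U -` kball a r"
    using U(1) U(2)[of z] unfolding U(3) by (auto simp: kball_def hdist_def a_def orthogonal_transformation)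
  then have "emeasure lborel (kball z r) = emeasure lborel (kball a r)"
    by (simp add: emeasure_lborel_orthogonal_vimage U(1))
  also have "\<dots> \<le> emeasure lborel (abox i (axis i 1) (2 * r) (2 * sqrt r))"
  proof (intro emeasure_mono subsetI)
    fix v assume "v \<in> kball a r"
    then have v: "norm v < 1" "hdist a v < r"
      by (auto simp: kball_iff)
    have na: "norm a = norm z"
      using U(1) unfolding a_def U(3)[symmetric] by (simp add: orthogonal_transformation)
    have rz: "1 - norm z < r"
      using hdist_ge[of v a] v na by linarith
    have "cmod (1 - v $ i) \<le> cmod (1 - norm z * v $ i) + cmod (of_real (1 - norm z) * v $ i)"
      using norm_triangle_ineq4[of "1 - norm z * v $ i" "of_real (1 - norm z) * v $ i"] by (simp add: algebra_simps)
    also have "cmod (of_real (1 - norm z) * v $ i) \<le> (1 - norm z) * 1"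
      using Finite_Cartesian_Product.norm_nth_le[of v i] v z
      unfolding norm_mult norm_of_real by (intro mult_mono) (auto simp: abs_if)
    finally have vi: "cmod (1 - v $ i) < 2 * r"
      using v rz by (simp add: hda)
    have vj: "(cmod (v $ j))\<^sup>2 \<le> 4 * r" if "j \<noteq> i" for j
    proof -
      have "(cmod (v $ j))\<^sup>2 + (cmod (v $ i))\<^sup>2 = (\<Sum>k\<in>{j, i}. (cmod (v $ k))\<^sup>2)"
        using that by simp
      also have "\<dots> \<le> (\<Sum>k\<in>UNIV. (cmod (v $ k))\<^sup>2)"
        by (rule sum_mono2) auto
      also have "\<dots> = (norm v)\<^sup>2"
        by (simp add: norm_vec_square cmod_power2)
      also have "\<dots> \<le> 1"
        using v by (simp add: abs_square_le_1)
      finally have "(cmod (v $ j))\<^sup>2 \<le> 1 - (cmod (v $ i))\<^sup>2" by simp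
      also have "\<dots> \<le> 2 * (1 - cmod (v $ i))"
        using zero_le_power2[of "1 - cmod (v $ i)"] by (simp add: power2_eq_square algebra_simps)
      also have "\<dots> \<le> 2 * (2 * r)"
        using norm_triangle_ineq2[of 1 "v $ i"] vi by simp
      finally show ?thesis by simp
    qed
    have vj': "cmod (v $ j) \<le> 2 * sqrt r" if "j \<noteq> i" for j
      using real_sqrt_le_mono[OF vj[OF that]] by (simp add: real_sqrt_mult)
    show "v \<in> abox i (axis i 1) (2 * r) (2 * sqrt r)"
      unfolding mem_abox
    proof (intro allI)
      fix j
      show "\<bar>Re (v $ j) - Re (axis i 1 $ j)\<bar> \<le> (if j = i then 2 * r else 2 * sqrt r) \<and>
         \<bar>Im (v $ j) - Im (axis i 1 $ j)\<bar> \<le> (if j = i then 2 * r else 2 * sqrt r)"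
      proof (cases "j = i")
        case True
        have "\<bar>Re (v $ i) - 1\<bar> \<le> 2 * r" "\<bar>Im (v $ i)\<bar> \<le> 2 * r"
          using vi abs_Re_le_cmod[of "1 - v $ i"] abs_Im_le_cmod[of "1 - v $ i"]
          unfolding minus_complex.sel one_complex.sel by linarith+
        then show ?thesis
          using True by (simp add: axis_def)
      next
        case False
        then have "\<bar>Re (v $ j)\<bar> \<le> 2 * sqrt r" "\<bar>Im (v $ j)\<bar> \<le> 2 * sqrt r"
          using vj'[OF False] abs_Re_le_cmod[of "v $ j"] abs_Im_le_cmod[of "v $ j"]
          by linarith+
        then show ?thesis
          using False by (simp add: axis_def)
      qed
    qed
  qed simp
  also have "\<dots> = ennreal (4 * (2 * r)\<^sup>2 * (4 * (2 * sqrt r)\<^sup>2) ^ (CARD('n) - 1))"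
    using r by (intro emeasure_abox) auto
  also have "4 * (2 * r)\<^sup>2 * (4 * (2 * sqrt r)\<^sup>2) ^ (CARD('n) - 1)
      = 16 * 16 ^ (CARD('n) - 1) * (r\<^sup>2 * r ^ (CARD('n) - 1))"
    using r by (simp add: power_mult_distrib)
  also have "r\<^sup>2 * r ^ (CARD('n) - 1) = r ^ (CARD('n) + 1)"
    by (simp flip: power_add)
  finally show "emeasure lborel (kball z r) \<le> ennreal (16 * 16 ^ (CARD('n) - 1) * r ^ (CARD('n) + 1))" .
qed simp

lemma emeasure_kshell_ge:
  "\<exists>c>0. \<forall>(w :: complex ^ 'n) \<rho>. norm w \<le> 1 \<longrightarrow> 0 < \<rho> \<longrightarrow> \<rho> \<le> 1/2 \<longrightarrow> 1 - norm w \<le> 4 * \<rho> \<longrightarrow>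
     ennreal (c * \<rho> ^ (CARD('n) + 1)) \<le> emeasure lborel (kshell w \<rho>)"
proof (intro exI[of _ "(1/64) * (1 / (16 * CARD('n))) ^ (CARD('n) - 1) :: real"] conjI allI impI)
  fix z :: "complex ^ 'n" and \<rho> :: real
  assume z: "norm z \<le> 1" and \<rho>: "0 < \<rho>" "\<rho> \<le> 1/2" and z\<rho>: "1 - norm z \<le> 4 * \<rho>"
  define i :: 'n where "i = undefined"
  obtain U where U: "orthogonal_transformation U"
    "\<And>x y. hermitian_inner (U x) (U y) = hermitian_inner x y" "U z = axis i (of_real (norm z))"
    using exists_unitary_to_axis[of z i] by metis
  define a where "a = axis i (complex_of_real (norm z))"
  have hda: "hdist a v = cmod (1 - norm z * v $ i)" for v :: "complex ^ 'n"
  proof -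
    have a': "a = norm z *\<^sub>R axis i 1"
      by (auto simp: a_def axis_def vec_eq_iff scaleR_conv_of_real[where 'a=complex])
    show ?thesis
      unfolding hdist_commute[of a] unfolding hdist_def a'
      by (simp add: hermitian_inner_scaleR_right hermitian_inner_axis)
  qed
  have "kshell z \<rho> = U -` kshell a \<rho>"
    using U(1) U(2)[of z] unfolding U(3)
    by (auto simp: kshell_def kball_def hdist_def a_def orthogonal_transformation)
  then have eq: "emeasure lborel (kshell z \<rho>) = emeasure lborel (kshell a \<rho>)"
    by (simp add: emeasure_lborel_orthogonal_vimage U(1))
  define x0 where "x0 = sqrt (1 - 3/2 * \<rho>)"
  have x0: "0 \<le> x0" "x0 \<le> 1" "x0\<^sup>2 = 1 - 3/2 * \<rho>"
    using \<rho> by (auto simp: x0_def)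
  \<comment> \<open>Chosen so that all coordinates other than \<open>i\<close> together contribute
    at most \<open>\<rho> / 32\<close> to \<open>(norm v)\<^sup>2\<close>.\<close>
  define \<beta> where "\<beta> = sqrt (\<rho> / (64 * CARD('n)))"
  have \<beta>: "\<beta>\<^sup>2 = \<rho> / (64 * CARD('n))" "0 \<le> \<beta>"
    using \<rho> by (auto simp: \<beta>_def)
  have "emeasure lborel (abox i (axis i (of_real x0)) (\<rho> / 16) \<beta>) \<le> emeasure lborel (kshell a \<rho>)"
  proof (intro emeasure_mono subsetI)
    fix v :: "complex ^ 'n" assume v: "v \<in> abox i (axis i (of_real x0)) (\<rho> / 16) \<beta>"
    have vi: "\<bar>Re (v $ i) - x0\<bar> \<le> \<rho> / 16" "\<bar>Im (v $ i)\<bar> \<le> \<rho> / 16"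
      using v[unfolded mem_abox, rule_format, of i] by (auto simp: axis_def)
    have vj: "\<bar>Re (v $ j)\<bar> \<le> \<beta>" "\<bar>Im (v $ j)\<bar> \<le> \<beta>" if "j \<noteq> i" for j
      using v[unfolded mem_abox, rule_format, of j] that by (auto simp: axis_def)
    have rest0: "0 \<le> (\<Sum>j\<in>UNIV - {i}. (Re (v $ j))\<^sup>2 + (Im (v $ j))\<^sup>2)"
      by (intro sum_nonneg) auto
    have "(\<Sum>j\<in>UNIV - {i}. (Re (v $ j))\<^sup>2 + (Im (v $ j))\<^sup>2) \<le> (\<Sum>j\<in>UNIV - {i}. 2 * \<beta>\<^sup>2)"
    proof (rule sum_mono)
      fix j assume "j \<in> UNIV - {i}"
      then have "\<bar>Re (v $ j)\<bar> \<le> \<bar>\<beta>\<bar>" "\<bar>Im (v $ j)\<bar> \<le> \<bar>\<beta>\<bar>"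
        using vj[of j] \<beta>(2) by auto
      then show "(Re (v $ j))\<^sup>2 + (Im (v $ j))\<^sup>2 \<le> 2 * \<beta>\<^sup>2"
        unfolding abs_le_square_iff by linarith
    qed
    also have "\<dots> \<le> CARD('n) * (2 * \<beta>\<^sup>2)"
      by (simp add: card_Diff_singleton of_nat_diff mult_right_mono)
    also have "\<dots> = \<rho> / 32"
      by (simp add: \<beta>)
    finally have rest: "(\<Sum>j\<in>UNIV - {i}. (Re (v $ j))\<^sup>2 + (Im (v $ j))\<^sup>2) \<le> \<rho> / 32" .
    have nv: "(norm v)\<^sup>2 = (Re (v $ i))\<^sup>2 + (Im (v $ i))\<^sup>2 + (\<Sum>j\<in>UNIV - {i}. (Re (v $ j))\<^sup>2 + (Im (v $ j))\<^sup>2)"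
      unfolding norm_vec_square by (simp add: sum.remove[of UNIV i])
    have im: "(Im (v $ i))\<^sup>2 \<le> \<rho> / 16"
    proof -
      have "(Im (v $ i))\<^sup>2 \<le> (\<rho> / 16)\<^sup>2"
        using vi \<rho> by (simp add: abs_le_square_iff[symmetric])
      also have "\<dots> \<le> \<rho> / 16"
        using \<rho> by (simp add: power2_eq_square) 
      finally show ?thesis .
    qed
    have re: "\<bar>(Re (v $ i))\<^sup>2 - x0\<^sup>2\<bar> \<le> \<rho> / 16 * (5 / 2)"
    proof -
      have "(Re (v $ i))\<^sup>2 - x0\<^sup>2 = (Re (v $ i) - x0) * (Re (v $ i) + x0)"
        by (simp add: power2_eq_square algebra_simps)
      also have "\<bar>\<dots>\<bar> \<le> \<rho> / 16 * (5 / 2)"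
      proof -
        have "\<bar>Re (v $ i) + x0\<bar> \<le> 5 / 2"
          using vi x0 \<rho> by linarith
        then show ?thesis
          unfolding abs_mult using vi \<rho> by (intro mult_mono) auto
      qed
      finally show ?thesis .
    qed
    \<comment> \<open>The three errors are at most 5/32, 2/32 and 1/32 of \<open>\<rho>\<close>.
      Their sum \<open>\<rho> / 4\<close> is exactly the half width of the shell around
      \<open>3/2 * \<rho>\<close>.\<close>
    have t: "5/4 * \<rho> \<le> 1 - (norm v)\<^sup>2" "1 - (norm v)\<^sup>2 \<le> 7/4 * \<rho>"
      using re im rest rest0 x0(3) zero_le_power2[of "Im (v $ i)"] \<rho>
      unfolding nv abs_le_iff by linarith+
    have "(norm v)\<^sup>2 < 1\<^sup>2"
      using t \<rho> by simp
    then have "norm v < 1"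
      by (rule power_less_imp_less_base) simp
    moreover have "hdist a v < 6 * \<rho>"
    proof -
      have "1 - x0 \<le> 1 - x0\<^sup>2"
        using x0 mult_left_mono[OF x0(2,1)] by (simp add: power2_eq_square)
      then have "1 - x0 \<le> 3/2 * \<rho>"
        using x0 by simp
      moreover have "cmod (1 - v $ i) \<le> \<bar>1 - Re (v $ i)\<bar> + \<bar>Im (v $ i)\<bar>"
        using cmod_le[of "1 - v $ i"] by simp
      ultimately have "cmod (1 - v $ i) \<le> 3/2 * \<rho> + \<rho> / 8"
        using vi x0 by linarith
      moreover have "cmod (1 - norm z * v $ i) \<le> cmod (of_real (1 - norm z)) + cmod (norm z * (1 - v $ i))"
        using norm_triangle_ineq[of "of_real (1 - norm z)" "norm z * (1 - v $ i)"] by (simp add: algebra_simps)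
      moreover have "cmod (norm z * (1 - v $ i)) \<le> cmod (1 - v $ i)"
        using z by (simp add: norm_mult mult_left_le_one_le)
      moreover have "cmod (of_real (1 - norm z)) = 1 - norm z"
        using z by (simp only: norm_of_real)
      ultimately show ?thesis
        using z\<rho> \<rho> unfolding hda by linarith
    qed
    ultimately show "v \<in> kshell a \<rho>"
      using t by (simp add: kshell_def kball_iff)
  qed simp
  moreover have "emeasure lborel (abox i (axis i (of_real x0)) (\<rho> / 16) \<beta>)
      = ennreal (4 * (\<rho> / 16)\<^sup>2 * (4 * \<beta>\<^sup>2) ^ (CARD('n) - 1))"
    using \<rho> \<beta> by (intro emeasure_abox) auto
  moreover have "4 * (\<rho> / 16)\<^sup>2 * (4 * \<beta>\<^sup>2) ^ (CARD('n) - 1)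
      = (1/64) * (1 / (16 * CARD('n))) ^ (CARD('n) - 1) * (\<rho>\<^sup>2 * \<rho> ^ (CARD('n) - 1))"
    unfolding \<beta> by (simp add: power_divide power_mult_distrib power2_eq_square)
  moreover have "\<rho>\<^sup>2 * \<rho> ^ (CARD('n) - 1) = \<rho> ^ (CARD('n) + 1)"
    by (simp flip: power_add)
  ultimately show "ennreal ((1/64) * (1 / (16 * CARD('n))) ^ (CARD('n) - 1) * \<rho> ^ (CARD('n) + 1))
      \<le> emeasure lborel (kshell z \<rho>)"
    using eq by (simp only:)
qed simp

lemma emeasure_lborel_scaleR_vimage:
  fixes A :: "'a::euclidean_space set"
  assumes "0 < c" "A \<in> sets borel"
  shows "emeasure lborel ((\<lambda>x. x /\<^sub>R c) -` A) = ennreal (c ^ DIM('a)) * emeasure lborel A"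
proof -
  have eq: "(\<lambda>x. x /\<^sub>R c) -` A = (\<lambda>x. c *\<^sub>R x + 0) ` A"
    using assms(1) by (auto simp: image_iff intro!: bexI[of _ "_ /\<^sub>R c"])
  have "(\<lambda>x :: 'a. x /\<^sub>R c) \<in> borel_measurable borel"
    by (intro borel_measurable_continuous_onI continuous_intros)
  from measurable_sets[OF this assms(2)] have "(\<lambda>x. x /\<^sub>R c) -` A \<in> sets borel"
    by simp
  then have "emeasure lborel ((\<lambda>x. x /\<^sub>R c) -` A) = emeasure lebesgue ((\<lambda>x. c *\<^sub>R x + 0) ` A)"
    unfolding eq[symmetric] by simp
  also have "\<dots> = ennreal (\<bar>c\<bar> ^ DIM('a)) * emeasure lebesgue A"
    using emeasure_lebesgue_affine[of c 0 A] by (simp add: ennreal_power)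
  finally show ?thesis
    using assms by simp
qed

text \<open>The dilates of the set by \<open>(1 - s) ^ j\<close> are disjoint and about \<open>r / s\<close> of them stay in \<open>kball z (2 * r)\<close>.\<close>

lemma emeasure_kball_boundary_le_aux:
  fixes z :: "complex ^ 'n"
  assumes C: "0 < C" "\<And>z r. norm (z :: complex ^ 'n) \<le> 1 \<Longrightarrow> 0 < r \<Longrightarrow>
     emeasure lborel (kball z r) \<le> ennreal (C * r ^ (CARD('n) + 1))"
    and z: "norm z \<le> 1" and s: "0 < s" and r: "0 < r" "r \<le> 2"
  shows "emeasure lborel {w \<in> kball z r. 1 - norm w < s} \<le> ennreal (16 * 8 ^ CARD('n) * C * s * r ^ CARD('n))"
proof (cases "r / 4 \<le> s")
  case True
  have "emeasure lborel {w \<in> kball z r. 1 - norm w < s} \<le> emeasure lborel (kball z r)"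
    by (intro emeasure_mono) auto
  also have "\<dots> \<le> ennreal (C * r ^ (CARD('n) + 1))"
    by (rule C) fact+
  also have "\<dots> \<le> ennreal (16 * 8 ^ CARD('n) * C * s * r ^ CARD('n))"
  proof (rule ennreal_leI)
    have "C * r ^ (CARD('n) + 1) = C * r ^ CARD('n) * r" by simp
    also have "\<dots> \<le> C * r ^ CARD('n) * (16 * 8 ^ CARD('n) * s)"
    proof (intro mult_left_mono)
      have "4 * s * 1 \<le> 16 * s * 8 ^ CARD('n)"
        using s by (intro mult_mono) auto
      then show "r \<le> 16 * 8 ^ CARD('n) * s"
        using True by (simp add: mult_ac)
    qed (use C r in auto)
    finally show "C * r ^ (CARD('n) + 1) \<le> 16 * 8 ^ CARD('n) * C * s * r ^ CARD('n)"
      by (simp add: mult_ac)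
  qed
  finally show ?thesis .
next
  case False
  define A where "A = {w \<in> kball z r. 1 - norm w < s}"
  \<comment> \<open>The number of dilates is limited so that their total shrinking stays below
    \<open>r / 4 \<le> 1/2\<close>. Then \<open>hdist\<close> to \<open>z\<close> grows by at most
    \<open>r / 4\<close>, and every dilate keeps at least the fraction \<open>(1/4) ^ n\<close> of
    the volume.\<close>
  define m where "m = nat \<lfloor>r / (4 * s)\<rfloor>"
  define q where "q = 1 - s"
  have s14: "s < 1/2" "s < r / 4" using False r by auto
  then have q: "0 < q" "q < 1" using s by (auto simp: q_def)
  have "1 \<le> r / (4 * s)" using s14 s by (simp add: field_simps)
  then have "1 \<le> \<lfloor>r / (4 * s)\<rfloor>" "real m = of_int \<lfloor>r / (4 * s)\<rfloor>"
    by (auto simp: m_def)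
  then have m: "1 \<le> real m" "r / (4 * s) \<le> 2 * real m" "real m \<le> r / (4 * s)"
    by linarith+
  have A [measurable]: "A \<in> sets borel"
  proof -
    have "A = kball z r \<inter> {w. 1 - norm w < s}"
      by (auto simp: A_def)
    then show ?thesis
      by (auto intro!: borel_open open_Int open_Collect_less continuous_intros)
  qed
  define D where "D j = (\<lambda>x. x /\<^sub>R q ^ j) -` A" for j :: nat
  have D_borel [measurable]: "D j \<in> sets borel" for j
  proof -
    have "(\<lambda>x :: complex ^ 'n. x /\<^sub>R q ^ j) \<in> borel_measurable borel"
      by (intro borel_measurable_continuous_onI continuous_intros)
    from measurable_sets[OF this A] show ?thesis
      by (simp add: D_def)
  qed
  have qj: "1/2 \<le> q ^ j" "1 - q ^ j \<le> r / 4" if "j < m" for j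
  proof -
    have "1 - real j * s \<le> q ^ j"
      using Bernoulli_inequality[of "- s" j] s14 by (simp add: q_def)
    moreover have "real j * s \<le> r / 4"
    proof -
      have "real j \<le> r / (4 * s)"
        using that m(3) by linarith
      then show ?thesis using s by (simp add: field_simps)
    qed
    ultimately have "1 - q ^ j \<le> r / 4"
      by linarith
    then show "1 - q ^ j \<le> r / 4" "1/2 \<le> q ^ j"
      using r by linarith+
  qed
  have D_norm: "q ^ Suc j < norm w \<and> norm w < q ^ j" if "w \<in> D j" for w j
  proof -
    have "norm (w /\<^sub>R q ^ j) < 1" "q < norm (w /\<^sub>R q ^ j)"
      using that by (auto simp: D_def A_def kball_iff q_def)
    then show ?thesis
      using q by (simp add: field_simps)
  qed
  \<comment> \<open>The set \<open>A\<close> lies in the layer \<open>q < norm w < 1\<close>, so its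
    dilates occupy successive spherical layers.\<close>
  have D_disj: "disjoint_family_on D {..<m}"
  proof -
    have "D j \<inter> D k = {}" if "j < k" for j k
    proof -
      have "q ^ k \<le> q ^ Suc j"
        using that q by (intro power_decreasing) auto
      then show ?thesis
        using D_norm by (meson disjoint_iff leD le_less_trans less_imp_le order_less_trans)
    qed
    then show ?thesis
      unfolding disjoint_family_on_def by (metis inf_commute nat_neq_iff)
  qed
  have D_sub: "D j \<subseteq> kball z (2 * r)" if "j < m" for j
  proof
    fix w assume "w \<in> D j"
    define v where "v = w /\<^sub>R q ^ j"
    have w: "w = q ^ j *\<^sub>R v" "norm v < 1" "hdist z v < r"
      using \<open>w \<in> D j\<close> q by (auto simp: v_def D_def A_def kball_iff)
    have "norm w < 1"
      using D_norm[OF \<open>w \<in> D j\<close>] q power_le_one[of q j] by linarith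
    moreover have "hdist z w \<le> hdist z v + (1 - q ^ j)"
    proof -
      have eq: "1 - hermitian_inner z w = (1 - hermitian_inner z v) + of_real (1 - q ^ j) * hermitian_inner z v"
        by (simp add: w(1) hermitian_inner_scaleR_right algebra_simps)
      have "cmod (hermitian_inner z v) \<le> 1"
        using cmod_hermitian_inner_le[of z v] mult_mono[of "norm z" 1 "norm v" 1] w z by auto
      moreover have "0 \<le> 1 - q ^ j"
        using q by (simp add: power_le_one)
      ultimately have "cmod (of_real (1 - q ^ j) * hermitian_inner z v) \<le> 1 - q ^ j"
        unfolding norm_mult norm_of_real by (metis abs_of_nonneg mult_left_le)
      then show ?thesis
        unfolding hdist_def eq
        using norm_triangle_ineq[of "1 - hermitian_inner z v" "of_real (1 - q ^ j) * hermitian_inner z v"]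
        by linarith
    qed
    ultimately show "w \<in> kball z (2 * r)"
      using w qj[OF that] r by (simp add: kball_iff)
  qed
  have le: "ennreal ((1/4) ^ CARD('n)) * emeasure lborel A \<le> emeasure lborel (D j)" if "j < m" for j
  proof -
    have "(1/4) ^ CARD('n) = (1/2 :: real) ^ (2 * CARD('n))"
      by (simp add: power_mult power2_eq_square)
    also have "\<dots> \<le> (q ^ j) ^ DIM(complex ^ 'n)"
      using qj[OF that] by (simp add: power_mono mult.commute)
    finally show ?thesis
      unfolding D_def using q A by (subst emeasure_lborel_scaleR_vimage) (auto intro!: mult_right_mono ennreal_leI)
  qed
  have "ennreal (real m * (1/4) ^ CARD('n)) * emeasure lborel A = (\<Sum>j<m. ennreal ((1/4) ^ CARD('n)) * emeasure lborel A)"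
    by (simp add: ennreal_mult mult.assoc ennreal_of_nat_eq_real_of_nat)
  also have "\<dots> \<le> (\<Sum>j<m. emeasure lborel (D j))"
    using le by (intro sum_mono) auto
  also have "\<dots> = emeasure lborel (\<Union>j<m. D j)"
    using D_disj by (intro sum_emeasure) auto
  also have "\<dots> \<le> emeasure lborel (kball z (2 * r))"
    using D_sub by (intro emeasure_mono) auto
  also have "\<dots> \<le> ennreal (C * (2 * r) ^ (CARD('n) + 1))"
    using z r by (intro C) auto
  finally have *: "ennreal (real m * (1/4) ^ CARD('n)) * emeasure lborel A \<le> ennreal (C * (2 * r) ^ (CARD('n) + 1))" .
  define K where "K = 1 / (real m * (1/4) ^ CARD('n))"
  have K: "0 \<le> K" "K * (real m * (1/4) ^ CARD('n)) = 1"
    using m by (auto simp: K_def)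
  have "emeasure lborel A = ennreal (K * (real m * (1/4) ^ CARD('n))) * emeasure lborel A"
    unfolding K by simp
  also have "\<dots> = ennreal K * (ennreal (real m * (1/4) ^ CARD('n)) * emeasure lborel A)"
    using K m by (subst ennreal_mult) (auto simp: mult.assoc)
  also have "\<dots> \<le> ennreal K * ennreal (C * (2 * r) ^ (CARD('n) + 1))"
    using * by (rule mult_left_mono) simp
  also have "\<dots> = ennreal (K * (C * (2 * r) ^ (CARD('n) + 1)))"
    using K C r by (subst ennreal_mult) auto
  also have "\<dots> \<le> ennreal (16 * 8 ^ CARD('n) * C * s * r ^ CARD('n))"
  proof (rule ennreal_leI)
    have "K * r \<le> 8 * s * 4 ^ CARD('n)"
      using m s by (simp add: K_def field_simps)
    then have "(K * r) * (C * 2 ^ (CARD('n) + 1) * r ^ CARD('n)) \<le> (8 * s * 4 ^ CARD('n)) * (C * 2 ^ (CARD('n) + 1) * r ^ CARD('n))"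
      using C r by (intro mult_right_mono) auto
    moreover have "(8::real) ^ CARD('n) = 4 ^ CARD('n) * 2 ^ CARD('n)"
      by (simp flip: power_mult_distrib)
    ultimately show "K * (C * (2 * r) ^ (CARD('n) + 1)) \<le> 16 * 8 ^ CARD('n) * C * s * r ^ CARD('n)"
      by (simp add: power_mult_distrib mult_ac)
  qed
  finally show ?thesis
    by (simp add: A_def)
qed

text \<open>Radii beyond 2 add nothing, since \<open>hdist z w < 2\<close> for \<open>w\<close> in
  the open ball. The estimate says that the fraction of a Koranyi ball within \<open>s\<close> of
  the sphere is of order \<open>s / r\<close>, as for a product set.\<close>

lemma emeasure_kball_boundary_le:
  "\<exists>C>0. \<forall>(z :: complex ^ 'n) r s. norm z \<le> 1 \<longrightarrow> 0 < s \<longrightarrow> 0 < r \<longrightarrow>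
     emeasure lborel {w \<in> kball z r. 1 - norm w < s} \<le> ennreal (C * s * r ^ CARD('n))"
proof -
  obtain C where C: "0 < C" "\<And>z r. norm (z :: complex ^ 'n) \<le> 1 \<Longrightarrow> 0 < r \<Longrightarrow>
     emeasure lborel (kball z r) \<le> ennreal (C * r ^ (CARD('n) + 1))"
    using emeasure_kball_le by metis
  show ?thesis
  proof (intro exI[of _ "16 * 8 ^ CARD('n) * C"] conjI allI impI)
    fix z :: "complex ^ 'n" and r s :: real
    assume z: "norm z \<le> 1" and s: "0 < s" and r: "0 < r"
    have "kball z r = kball z (min r 2)"
    proof -
      have "hdist z w < 2" if "norm w < 1" for w
      proof -
        have "cmod (hermitian_inner z w) \<le> norm w"
          using cmod_hermitian_inner_le[of z w] mult_right_mono[OF z, of "norm w"] by auto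
        then show ?thesis
          using norm_triangle_ineq4[of 1 "hermitian_inner z w"] that by (simp add: hdist_def)
      qed
      then show ?thesis
        by (auto simp: kball_iff)
    qed
    then have "emeasure lborel {w \<in> kball z r. 1 - norm w < s}
        \<le> ennreal (16 * 8 ^ CARD('n) * C * s * (min r 2) ^ CARD('n))"
      using emeasure_kball_boundary_le_aux[OF C z s, of "min r 2"] r by simp
    also have "\<dots> \<le> ennreal (16 * 8 ^ CARD('n) * C * s * r ^ CARD('n))"
      using C s r by (intro ennreal_leI mult_left_mono power_mono) auto
    finally show "emeasure lborel {w \<in> kball z r. 1 - norm w < s} \<le> ennreal (16 * 8 ^ CARD('n) * C * s * r ^ CARD('n))" .
  qed (use C in auto)
qed

subsection \<open>The positive Bergman operator on square integrable functions\<close>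

lemma exists_dyadic:
  fixes x :: real
  assumes "1 \<le> x"
  obtains j :: nat where "2 ^ j \<le> x" "x < 2 ^ Suc j"
proof -
  obtain n where "x < 2 ^ n"
    using real_arch_pow[of 2 x] by auto
  define m where "m = (LEAST n. x < 2 ^ n)"
  have m: "x < 2 ^ m"
    unfolding m_def by (rule LeastI) fact
  then have "m \<noteq> 0"
    using assms by (intro notI) simp
  then obtain j where j: "m = Suc j"
    by (cases m) auto
  have "\<not> x < 2 ^ j"
    using not_less_Least[of j "\<lambda>n. x < 2 ^ n"] j by (simp add: m_def)
  then show ?thesis
    using that[of j] m j by simp
qed

text \<open>The tool for dyadic decompositions. The sets may overlap, because one suitable index per
  point is enough; nested balls can thus be used in place of annuli.\<close>

lemma nn_integral_le_suminf:
  assumes "\<And>i. A i \<in> sets M" "\<And>i. 0 \<le> a i" "\<And>i. 0 \<le> c i" "summable (\<lambda>i. c i * a i)"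
    and "\<And>i. emeasure M (A i) \<le> ennreal (a i)"
    and le: "\<And>x. x \<in> space M \<Longrightarrow> f x \<noteq> 0 \<Longrightarrow> \<exists>i. x \<in> A i \<and> f x \<le> ennreal (c i)"
  shows "(\<integral>\<^sup>+x. f x \<partial>M) \<le> ennreal (\<Sum>i. c i * a i)"
proof -
  have [measurable]: "A i \<in> sets M" for i by fact
  have "(\<integral>\<^sup>+x. f x \<partial>M) \<le> (\<integral>\<^sup>+x. (\<Sum>i. ennreal (c i) * indicator (A i) x) \<partial>M)"
  proof (rule nn_integral_mono)
    fix x assume x: "x \<in> space M"
    show "f x \<le> (\<Sum>i. ennreal (c i) * indicator (A i) x)"
    proof (cases "f x = 0")
      case False
      then obtain i where i: "x \<in> A i" "f x \<le> ennreal (c i)"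
        using le[OF x] by auto
      define F where "F i = ennreal (c i) * indicator (A i) x" for i
      have "sum F {i} \<le> suminf F"
        by (rule sum_le_suminf) auto
      then show ?thesis
        using i unfolding F_def by simp
    qed simp
  qed
  also have "\<dots> = (\<Sum>i. ennreal (c i) * emeasure M (A i))"
    by (simp add: nn_integral_suminf nn_integral_cmult_indicator)
  also have "\<dots> \<le> (\<Sum>i. ennreal (c i * a i))"
    using assms by (intro suminf_le) (auto simp: ennreal_mult intro!: mult_left_mono)
  also have "\<dots> = ennreal (\<Sum>i. c i * a i)"
    using assms by (intro suminf_ennreal2) auto
  finally show ?thesis .
qed

lemma summable_geometric_sqrt: "summable (\<lambda>i. c * (1 / sqrt 2) ^ i :: real)"
  by (intro summable_mult summable_geometric) simp

text \<open>Every \<open>w\<close> in the ball satisfies \<open>1 - norm w < r\<close>. Where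
  \<open>1 - norm w\<close> is about \<open>r / 2 ^ i\<close>, the weight is about
  \<open>sqrt (2 ^ i / r)\<close> and the volume about \<open>r ^ (n + 1) / 2 ^ i\<close>, so the
  layers contribute a geometric series of ratio \<open>1 / sqrt 2\<close>.\<close>

lemma nn_integral_kball_weight_le:
  "\<exists>C>0. \<forall>(z :: complex ^ 'n) r. norm z \<le> 1 \<longrightarrow> 0 < r \<longrightarrow>
     (\<integral>\<^sup>+w\<in>kball z r. ennreal (1 / sqrt (1 - norm w)) \<partial>lborel) \<le> ennreal (C * (r ^ CARD('n) * sqrt r))"
proof -
  obtain C where C: "0 < C" "\<And>z r s. norm (z :: complex ^ 'n) \<le> 1 \<Longrightarrow> 0 < s \<Longrightarrow> 0 < r \<Longrightarrow>
     emeasure lborel {w \<in> kball z r. 1 - norm w < s} \<le> ennreal (C * s * r ^ CARD('n))"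
    using emeasure_kball_boundary_le by blast
  define S where "S = (\<Sum>i. (1 / sqrt 2) ^ i :: real)"
  have S: "0 \<le> S"
    unfolding S_def using summable_geometric_sqrt[of 1] by (intro suminf_nonneg) auto
  show ?thesis
  proof (intro exI[of _ "2 * sqrt 2 * C * (S + 1)"] conjI allI impI)
    fix z :: "complex ^ 'n" and r :: real
    assume z: "norm z \<le> 1" and r: "0 < r"
    define c where "c i = sqrt (2 * 2 ^ i / r)" for i :: nat
    define a where "a i = C * (2 * r / 2 ^ i) * r ^ CARD('n)" for i :: nat
    have ca: "c i * a i = (2 * sqrt 2 * C * r ^ CARD('n) * sqrt r) * (1 / sqrt 2) ^ i" for i
    proof -
      have "2 ^ i = sqrt 2 ^ i * sqrt 2 ^ i"
        by (simp flip: power_mult_distrib)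
      moreover have "r = sqrt r * sqrt r"
        using r by simp
      ultimately show ?thesis
        using r by (simp add: c_def a_def real_sqrt_mult real_sqrt_divide real_sqrt_power field_simps)
    qed
    have "(\<integral>\<^sup>+w\<in>kball z r. ennreal (1 / sqrt (1 - norm w)) \<partial>lborel) \<le> ennreal (\<Sum>i. c i * a i)"
    proof (rule nn_integral_le_suminf)
      fix i
      have "{w \<in> kball z r. 1 - norm w < 2 * r / 2 ^ i} = kball z r \<inter> {w. 1 - norm w < 2 * r / 2 ^ i}"
        by auto
      then show "{w \<in> kball z r. 1 - norm w < 2 * r / 2 ^ i} \<in> sets lborel"
        by (auto intro!: borel_open open_Int open_Collect_less continuous_intros)
      show "emeasure lborel {w \<in> kball z r. 1 - norm w < 2 * r / 2 ^ i} \<le> ennreal (a i)"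
        unfolding a_def using z r by (intro C) auto
    next
      fix w assume "ennreal (1 / sqrt (1 - norm w)) * indicator (kball z r) w \<noteq> 0"
      then have w: "w \<in> kball z r"
        by (auto simp: indicator_def split: if_splits)
      then have w1: "0 < 1 - norm w" "1 - norm w < r"
        using z hdist_ge'[of z w] by (auto simp: kball_iff)
      then obtain i where i: "2 ^ i \<le> r / (1 - norm w)" "r / (1 - norm w) < 2 ^ Suc i"
        using exists_dyadic[of "r / (1 - norm w)"] by auto
      have "1 / sqrt (1 - norm w) \<le> c i"
      proof -
        have "1 / (1 - norm w) \<le> 2 * 2 ^ i / r"
          using i w1 r by (simp add: field_simps)
        from real_sqrt_le_mono[OF this] show ?thesis
          by (simp add: real_sqrt_divide c_def)
      qed
      moreover have "1 - norm w < 2 * r / 2 ^ i"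
        using i w1 r by (simp add: field_simps)
      ultimately show "\<exists>i. w \<in> {w \<in> kball z r. 1 - norm w < 2 * r / 2 ^ i} \<and>
          ennreal (1 / sqrt (1 - norm w)) * indicator (kball z r) w \<le> ennreal (c i)"
        using w by (intro exI[of _ i]) (simp add: ennreal_leI)
    next
      show "summable (\<lambda>i. c i * a i)"
        unfolding ca by (rule summable_geometric_sqrt)
    qed (use r C in \<open>auto simp: c_def a_def\<close>)
    also have "(\<Sum>i. c i * a i) = (2 * sqrt 2 * C * r ^ CARD('n) * sqrt r) * S"
      unfolding ca S_def using summable_geometric_sqrt[of 1] by (subst suminf_mult) auto
    also have "ennreal \<dots> \<le> ennreal (2 * sqrt 2 * C * (S + 1) * (r ^ CARD('n) * sqrt r))"
      using C r by (intro ennreal_leI) (simp add: algebra_simps)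
    finally show "(\<integral>\<^sup>+w\<in>kball z r. ennreal (1 / sqrt (1 - norm w)) \<partial>lborel)
        \<le> ennreal (2 * sqrt 2 * C * (S + 1) * (r ^ CARD('n) * sqrt r))" .
  qed (use S C in auto)
qed

text \<open>The operator \<open>P\<^sup>+\<close> without the factor \<open>n! / pi ^ n\<close>.
  Values in \<open>ennreal\<close> make it meaningful for every nonnegative density, finite or
  not.\<close>

definition bergman_pos :: "(complex ^ 'n \<Rightarrow> ennreal) \<Rightarrow> complex ^ 'n \<Rightarrow> ennreal"
  where "bergman_pos g z = (\<integral>\<^sup>+w\<in>ball 0 1. g w * ennreal (1 / hdist z w ^ (CARD('n) + 1)) \<partial>lborel)"

lemma measurable_hdist [measurable]:
  "f \<in> borel_measurable M \<Longrightarrow> g \<in> borel_measurable M \<Longrightarrow> (\<lambda>x. hdist (f x) (g x :: complex ^ 'n)) \<in> borel_measurable M"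
  by (rule borel_measurable_continuous_Pair[where H=hdist]) (auto intro!: continuous_intros)

lemma measurable_bergman_pos [measurable]:
  assumes [measurable]: "g \<in> borel_measurable borel"
  shows "bergman_pos g \<in> borel_measurable borel"
proof -
  have [measurable]: "ball (0 :: complex ^ 'n) 1 \<in> sets borel"
    by simp
  show ?thesis
    unfolding bergman_pos_def[abs_def] by measurable
qed

text \<open>The input of Schur's test: the weight is reproduced by the operator up to a constant.
  Since \<open>hdist z w \<ge> d = 1 - norm z\<close>, the dyadic balls start at radius about
  \<open>d\<close>; the one of radius \<open>2 ^ j * d\<close> contributes about
  \<open>(2 ^ j * d) powr (- 1/2)\<close>, so the smallest ball dominates.\<close>

lemma bergman_pos_weight_le:
  "\<exists>C>0. \<forall>z :: complex ^ 'n. norm z < 1 \<longrightarrow>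
     bergman_pos (\<lambda>w. ennreal (1 / sqrt (1 - norm w))) z \<le> ennreal (C * (1 / sqrt (1 - norm z)))"
proof -
  obtain C where C: "0 < C" "\<And>z r. norm (z :: complex ^ 'n) \<le> 1 \<Longrightarrow> 0 < r \<Longrightarrow>
     (\<integral>\<^sup>+w\<in>kball z r. ennreal (1 / sqrt (1 - norm w)) \<partial>lborel) \<le> ennreal (C * (r ^ CARD('n) * sqrt r))"
    using nn_integral_kball_weight_le by blast
  define S where "S = (\<Sum>i. (1 / sqrt 2) ^ i :: real)"
  have S: "0 \<le> S"
    unfolding S_def using summable_geometric_sqrt[of 1] by (intro suminf_nonneg) auto
  define M where "M = density lborel (\<lambda>w :: complex ^ 'n. ennreal (1 / sqrt (1 - norm w)) * indicator (ball 0 1) w)"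
  have [measurable_cong]: "sets M = sets borel"
    by (simp add: M_def)
  have [measurable]: "ball (0 :: complex ^ 'n) 1 \<in> sets borel"
    "(\<lambda>w :: complex ^ 'n. ennreal (1 / sqrt (1 - norm w))) \<in> borel_measurable borel"
    by (simp, measurable)
  show ?thesis
  proof (intro exI[of _ "C * 2 ^ CARD('n) * sqrt 2 * (S + 1)"] conjI allI impI)
    fix z :: "complex ^ 'n"
    assume z: "norm z < 1"
    define d where "d = 1 - norm z"
    have d: "0 < d" using z by (simp add: d_def)
    define c where "c j = 1 / (2 ^ j * d) ^ (CARD('n) + 1)" for j :: nat
    define a where "a j = C * ((2 ^ Suc j * d) ^ CARD('n) * sqrt (2 ^ Suc j * d))" for j :: nat
    have ca: "c j * a j = (C * 2 ^ CARD('n) * sqrt 2 * (1 / sqrt d)) * (1 / sqrt 2) ^ j" for j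
    proof -
      define y where "y = 2 ^ j * d"
      have y: "0 < y" using d by (simp add: y_def)
      have "c j * a j = C * (2 ^ CARD('n) * sqrt 2) * (y ^ CARD('n) / y ^ CARD('n)) * (sqrt y / y)"
        by (simp add: c_def a_def y_def[symmetric] mult.assoc power_mult_distrib real_sqrt_mult)
      also have "\<dots> = C * (2 ^ CARD('n) * sqrt 2) * (1 / sqrt y)"
        using y real_div_sqrt[of y] by (simp add: divide_simps)
      also have "1 / sqrt y = (1 / sqrt d) * (1 / sqrt 2) ^ j"
        by (simp add: y_def real_sqrt_mult real_sqrt_power power_divide)
      finally show ?thesis
        by (simp add: mult_ac)
    qed
    have "bergman_pos (\<lambda>w. ennreal (1 / sqrt (1 - norm w))) z = (\<integral>\<^sup>+w. ennreal (1 / hdist z w ^ (CARD('n) + 1)) \<partial>M)"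
      unfolding M_def bergman_pos_def
      by (subst nn_integral_density) (auto intro!: nn_integral_cong simp: mult_ac)
    also have "\<dots> = (\<integral>\<^sup>+w. ennreal (1 / hdist z w ^ (CARD('n) + 1)) * indicator (ball 0 1) w \<partial>M)"
      unfolding M_def
      by (subst (1 2) nn_integral_density) (auto intro!: nn_integral_cong simp: indicator_def)
    also have "\<dots> \<le> ennreal (\<Sum>j. c j * a j)"
    proof (rule nn_integral_le_suminf[where A="\<lambda>j. kball z (2 ^ Suc j * d)"])
      show "kball z (2 ^ Suc j * d) \<in> sets M" for j
        by simp
      show "emeasure M (kball z (2 ^ Suc j * d)) \<le> ennreal (a j)" for j
      proof -
        have "emeasure M (kball z (2 ^ Suc j * d)) = (\<integral>\<^sup>+w\<in>kball z (2 ^ Suc j * d). ennreal (1 / sqrt (1 - norm w)) \<partial>lborel)"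
          unfolding M_def
          by (subst emeasure_density) (auto intro!: nn_integral_cong simp: indicator_def kball_iff)
        also have "\<dots> \<le> ennreal (a j)"
          unfolding a_def using z d by (intro C) auto
        finally show ?thesis .
      qed
      show "summable (\<lambda>i. c i * a i)"
        unfolding ca by (rule summable_geometric_sqrt)
    next
      fix w assume "ennreal (1 / hdist z w ^ (CARD('n) + 1)) * indicator (ball 0 1) w \<noteq> 0"
      then have w: "norm w < 1"
        by (auto simp: indicator_def split: if_splits)
      then have "1 \<le> hdist z w / d"
        using hdist_ge[of w z] d by (simp add: d_def)
      then obtain j where j: "2 ^ j \<le> hdist z w / d" "hdist z w / d < 2 ^ Suc j"
        using exists_dyadic by blast
      then have j': "2 ^ j * d \<le> hdist z w" "hdist z w < 2 ^ Suc j * d"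
        using d by (simp_all add: field_simps)
      then have "1 / hdist z w ^ (CARD('n) + 1) \<le> c j"
        unfolding c_def using d by (intro divide_left_mono power_mono mult_pos_pos zero_less_power) (auto intro: less_le_trans[OF _ j'(1)])
      then show "\<exists>j. w \<in> kball z (2 ^ Suc j * d) \<and>
          ennreal (1 / hdist z w ^ (CARD('n) + 1)) * indicator (ball 0 1) w \<le> ennreal (c j)"
        using w j' by (intro exI[of _ j]) (simp add: kball_iff ennreal_leI)
    qed (use d C in \<open>auto simp: c_def a_def\<close>)
    also have "(\<Sum>j. c j * a j) = (C * 2 ^ CARD('n) * sqrt 2 * (1 / sqrt d)) * S"
      unfolding ca S_def using summable_geometric_sqrt[of 1] by (subst suminf_mult) auto
    also have "ennreal \<dots> \<le> ennreal (C * 2 ^ CARD('n) * sqrt 2 * (S + 1) * (1 / sqrt (1 - norm z)))"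
      using C d unfolding d_def[symmetric] by (intro ennreal_leI) (simp add: field_simps)
    finally show "bergman_pos (\<lambda>w. ennreal (1 / sqrt (1 - norm w))) z
        \<le> ennreal (C * 2 ^ CARD('n) * sqrt 2 * (S + 1) * (1 / sqrt (1 - norm z)))" .
  qed (use S C in auto)
qed

text \<open>Schur's test. Cauchy-Schwarz is applied to the factors \<open>g * sqrt (k / h)\<close>
  and \<open>sqrt (k * h)\<close>; the second gives \<open>C * h z\<close>. After integration in
  \<open>z\<close> and Fubini the symmetry of \<open>k\<close> lets the same bound act once more,
  and the resulting \<open>h w\<close> cancels the \<open>1 / h w\<close> of the first
  factor.\<close>

lemma bergman_pos_L2:
  "\<exists>C>0. \<forall>g :: complex ^ 'n \<Rightarrow> ennreal. g \<in> borel_measurable borel \<longrightarrow>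
     (\<integral>\<^sup>+z\<in>ball 0 1. (bergman_pos g z)\<^sup>2 \<partial>lborel) \<le> ennreal C * (\<integral>\<^sup>+w\<in>ball 0 1. (g w)\<^sup>2 \<partial>lborel)"
proof -
  define h where "h w = 1 / sqrt (1 - norm w)" for w :: "complex ^ 'n"
  define k where "k z w = 1 / hdist z w ^ (CARD('n) + 1)" for z w :: "complex ^ 'n"
  define B where "B = ball (0 :: complex ^ 'n) 1"
  obtain C where C: "0 < C" "\<And>z :: complex ^ 'n. norm z < 1 \<Longrightarrow>
     bergman_pos (\<lambda>w. ennreal (1 / sqrt (1 - norm w))) z \<le> ennreal (C * (1 / sqrt (1 - norm z)))"
    using bergman_pos_weight_le by blast
  have hk: "(\<integral>\<^sup>+w\<in>B. ennreal (h w) * ennreal (k z w) \<partial>lborel) \<le> ennreal (C * h z)" if "z \<in> B" for z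
    using C(2)[of z] that by (simp add: bergman_pos_def h_def k_def B_def)
  have [measurable]: "B \<in> sets borel" by (simp add: B_def)
  have [measurable]: "h \<in> borel_measurable borel" unfolding h_def[abs_def] by measurable
  have [measurable]: "(\<lambda>x. k (f x) (g x)) \<in> borel_measurable M"
    if [measurable]: "f \<in> borel_measurable M" "g \<in> borel_measurable M" for f g and M :: "'z measure"
    unfolding k_def by measurable
  have k_comm: "k z w = k w z" for z w
    by (simp add: k_def hdist_commute)
  have k0: "0 \<le> k z w" for z w
    by (simp add: k_def)
  have h0: "0 < h w" if "w \<in> B" for w
    using that by (simp add: h_def B_def)
  show ?thesis
  proof (intro exI[of _ "C * C"] conjI allI impI)
    fix g :: "complex ^ 'n \<Rightarrow> ennreal" assume [measurable]: "g \<in> borel_measurable borel"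
    define G where "G w = (g w)\<^sup>2 * ennreal (1 / h w) * indicator B w" for w
    have [measurable]: "G \<in> borel_measurable borel" unfolding G_def[abs_def] by measurable
    have pw: "(bergman_pos g z)\<^sup>2 \<le> ennreal (C * h z) * (\<integral>\<^sup>+w. G w * ennreal (k z w) \<partial>lborel)" if z: "z \<in> B" for z
    proof -
      define a where "a w = g w * ennreal (sqrt (k z w / h w)) * indicator B w" for w
      define b where "b w = ennreal (sqrt (k z w * h w)) * indicator B w" for w
      have [measurable]: "a \<in> borel_measurable borel" "b \<in> borel_measurable borel"
        unfolding a_def[abs_def] b_def[abs_def] by measurable
      have "a w * b w = g w * ennreal (k z w) * indicator B w" for w
      proof (cases "w \<in> B")
        case True
        have "sqrt (k z w / h w) * sqrt (k z w * h w) = k z w"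
          using h0[OF True] k0[of z w] by (simp flip: real_sqrt_mult)
        then show ?thesis
          using True k0 h0 by (simp add: a_def b_def mult.assoc less_imp_le flip: ennreal_mult)
      qed (simp add: a_def)
      then have "bergman_pos g z = (\<integral>\<^sup>+w. a w * b w \<partial>lborel)"
        by (simp add: bergman_pos_def k_def B_def)
      then have "(bergman_pos g z)\<^sup>2 \<le> (\<integral>\<^sup>+w. (a w)\<^sup>2 \<partial>lborel) * (\<integral>\<^sup>+w. (b w)\<^sup>2 \<partial>lborel)"
        by (simp add: Cauchy_Schwarz_nn_integral)
      also have "(\<integral>\<^sup>+w. (a w)\<^sup>2 \<partial>lborel) = (\<integral>\<^sup>+w. G w * ennreal (k z w) \<partial>lborel)"
      proof (rule nn_integral_cong)
        fix w
        show "(a w)\<^sup>2 = G w * ennreal (k z w)"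
        proof (cases "w \<in> B")
          case True
          have "(ennreal (sqrt (k z w / h w)))\<^sup>2 = ennreal (1 / h w) * ennreal (k z w)"
            using h0[OF True] k0[of z w] by (simp add: ennreal_power flip: ennreal_mult)
          then show ?thesis
            using True by (simp add: a_def G_def power_mult_distrib mult_ac)
        qed (simp add: a_def G_def)
      qed
      also have "(\<integral>\<^sup>+w. (b w)\<^sup>2 \<partial>lborel) = (\<integral>\<^sup>+w\<in>B. ennreal (h w) * ennreal (k z w) \<partial>lborel)"
      proof (rule nn_integral_cong)
        fix w
        show "(b w)\<^sup>2 = ennreal (h w) * ennreal (k z w) * indicator B w"
        proof (cases "w \<in> B")
          case True
          then show ?thesis
            using h0[OF True] k0[of z w] by (simp add: b_def ennreal_power mult.commute flip: ennreal_mult)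
        qed (simp add: b_def)
      qed
      also have "(\<integral>\<^sup>+w. G w * ennreal (k z w) \<partial>lborel) * \<dots> \<le> (\<integral>\<^sup>+w. G w * ennreal (k z w) \<partial>lborel) * ennreal (C * h z)"
        by (intro mult_left_mono hk z) auto
      finally show ?thesis
        by (simp add: mult.commute)
    qed
    have "(\<integral>\<^sup>+z\<in>B. (bergman_pos g z)\<^sup>2 \<partial>lborel)
        \<le> (\<integral>\<^sup>+z. (\<integral>\<^sup>+w. ennreal (C * h z) * (G w * ennreal (k z w)) * indicator B z \<partial>lborel) \<partial>lborel)"
    proof (rule nn_integral_mono)
      fix z
      show "(bergman_pos g z)\<^sup>2 * indicator B z
          \<le> (\<integral>\<^sup>+w. ennreal (C * h z) * (G w * ennreal (k z w)) * indicator B z \<partial>lborel)"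
        using pw[of z] by (cases "z \<in> B") (simp_all add: nn_integral_cmult)
    qed
    also have "\<dots> = (\<integral>\<^sup>+w. (\<integral>\<^sup>+z. ennreal (C * h z) * (G w * ennreal (k z w)) * indicator B z \<partial>lborel) \<partial>lborel)"
      by (rule lborel_pair.Fubini') measurable
    also have "\<dots> = (\<integral>\<^sup>+w. G w * ennreal C * (\<integral>\<^sup>+z\<in>B. ennreal (h z) * ennreal (k w z) \<partial>lborel) \<partial>lborel)"
    proof (rule nn_integral_cong)
      fix w
      have "(\<integral>\<^sup>+z. ennreal (C * h z) * (G w * ennreal (k z w)) * indicator B z \<partial>lborel)
          = (\<integral>\<^sup>+z. (G w * ennreal C) * (ennreal (h z) * ennreal (k w z) * indicator B z) \<partial>lborel)"
      proof (rule nn_integral_cong)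
        fix z
        show "ennreal (C * h z) * (G w * ennreal (k z w)) * indicator B z
            = (G w * ennreal C) * (ennreal (h z) * ennreal (k w z) * indicator B z)"
          using C h0[of z] by (cases "z \<in> B") (auto simp: ennreal_mult k_comm[of z w] less_imp_le mult_ac)
      qed
      then show "(\<integral>\<^sup>+z. ennreal (C * h z) * (G w * ennreal (k z w)) * indicator B z \<partial>lborel)
          = G w * ennreal C * (\<integral>\<^sup>+z\<in>B. ennreal (h z) * ennreal (k w z) \<partial>lborel)"
        by (simp add: nn_integral_cmult)
    qed
    also have "\<dots> \<le> (\<integral>\<^sup>+w. ennreal (C * C) * ((g w)\<^sup>2 * indicator B w) \<partial>lborel)"
    proof (rule nn_integral_mono)
      fix w
      show "G w * ennreal C * (\<integral>\<^sup>+z\<in>B. ennreal (h z) * ennreal (k w z) \<partial>lborel)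
          \<le> ennreal (C * C) * ((g w)\<^sup>2 * indicator B w)"
      proof (cases "w \<in> B")
        case True
        have "G w * ennreal C * (\<integral>\<^sup>+z\<in>B. ennreal (h z) * ennreal (k w z) \<partial>lborel)
            \<le> G w * ennreal C * ennreal (C * h w)"
          by (intro mult_left_mono hk True) auto
        also have "\<dots> = (g w)\<^sup>2 * (ennreal (1 / h w) * (ennreal C * ennreal (C * h w)))"
          using True by (simp add: G_def mult_ac)
        also have "ennreal (1 / h w) * (ennreal C * ennreal (C * h w)) = ennreal (C * C)"
          using h0[OF True] C by (simp flip: ennreal_mult)
        finally show ?thesis
          using True by (simp add: mult_ac)
      qed (simp add: G_def)
    qed
    also have "\<dots> = ennreal (C * C) * (\<integral>\<^sup>+w\<in>B. (g w)\<^sup>2 \<partial>lborel)"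
      by (simp add: nn_integral_cmult)
    finally show "(\<integral>\<^sup>+z\<in>ball 0 1. (bergman_pos g z)\<^sup>2 \<partial>lborel)
        \<le> ennreal (C * C) * (\<integral>\<^sup>+w\<in>ball 0 1. (g w)\<^sup>2 \<partial>lborel)"
      by (simp add: B_def)
  qed (use C in auto)
qed

subsection \<open>The weak type estimate for the positive Bergman operator\<close>

text \<open>Greedy choice of a largest radius, followed by removal of everything that meets the
  chosen set. The geometry of the enlargement is left to the user of the lemma. The alternative
  \<open>i = j\<close> is for empty sets, which do not meet even themselves.\<close>

lemma finite_vitali_selection:
  fixes T :: "'i \<Rightarrow> 'a set" and r :: "'i \<Rightarrow> real"
  assumes "finite J"
  obtains S where "S \<subseteq> J" "disjoint_family_on T S"
    "\<And>j. j \<in> J \<Longrightarrow> \<exists>i\<in>S. (T i \<inter> T j \<noteq> {} \<or> i = j) \<and> r j \<le> r i"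
proof -
  have "\<exists>S\<subseteq>J. disjoint_family_on T S \<and> (\<forall>j\<in>J. \<exists>i\<in>S. (T i \<inter> T j \<noteq> {} \<or> i = j) \<and> r j \<le> r i)"
    using assms
  proof (induction J rule: finite_psubset_induct)
    case (psubset J)
    show ?case
    proof (cases "J = {}")
      case False
      have "Max (r ` J) \<in> r ` J"
        using psubset.hyps False by (intro Max_in) auto
      then obtain m where "m \<in> J" "r m = Max (r ` J)"
        by auto
      then have m: "m \<in> J" "\<And>j. j \<in> J \<Longrightarrow> r j \<le> r m"
        using psubset.hyps by auto
      define J' where "J' = {j \<in> J. j \<noteq> m \<and> T m \<inter> T j = {}}"
      have "J' \<subset> J"
        using m by (auto simp: J'_def)
      from psubset.IH[OF this] obtain S where S: "S \<subseteq> J'" "disjoint_family_on T S"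
        "\<forall>j\<in>J'. \<exists>i\<in>S. (T i \<inter> T j \<noteq> {} \<or> i = j) \<and> r j \<le> r i"
        by blast
      have "disjoint_family_on T (insert m S)"
        using S by (subst disjoint_family_on_insert) (auto simp: J'_def)
      moreover have "\<exists>i\<in>insert m S. (T i \<inter> T j \<noteq> {} \<or> i = j) \<and> r j \<le> r i" if "j \<in> J" for j
        using that S(3) m(2)[OF that] by (cases "j \<in> J'") (auto simp: J'_def)
      moreover have "insert m S \<subseteq> J"
        using S m by (auto simp: J'_def)
      ultimately show ?thesis by blast
    qed (auto simp: disjoint_family_on_def)
  qed
  then show ?thesis
    using that by blast
qed

text \<open>Two applications of the quasi-triangle inequality:
  \<open>2 * (s + 2 * s) = 6 * s\<close> and then \<open>2 * (r + 6 * r) = 14 * r\<close>. The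
  doubled radius on the left appears because a point of the ball belongs to
  \<open>kball z (2 * r)\<close> but not always to \<open>kball z r\<close>.\<close>

lemma kball_14_cover:
  fixes z :: "complex ^ 'n"
  assumes "norm z \<le> 1" "norm u \<le> 1" "kball z r \<inter> kball u s \<noteq> {}" "s \<le> r"
  shows "kball u (2 * s) \<subseteq> kball z (14 * r)"
proof
  fix x assume x: "x \<in> kball u (2 * s)"
  obtain y where y: "norm y < 1" "hdist z y < r" "hdist u y < s"
    using assms(3) by (auto simp: kball_iff)
  have "hdist y x \<le> 2 * (hdist y u + hdist u x)" "hdist z x \<le> 2 * (hdist z y + hdist y x)"
    using x y(1) by (intro hdist_triangle assms; simp add: kball_iff)+
  then have "hdist z x < 14 * r"
    using x y assms(4) hdist_commute[of y u] by (auto simp: kball_iff)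
  then show "x \<in> kball z (14 * r)"
    using x by (simp add: kball_iff)
qed

text \<open>The weak type (1, 1) estimate for the maximal function over Koranyi balls, by Vitali's
  covering argument. The superlevel set is enclosed in a union \<open>G\<close> of open balls, a
  Borel set that can be discarded later.\<close>

lemma maximal_function_cover:
  "\<exists>C>0. \<forall>(g :: complex ^ 'n \<Rightarrow> ennreal) t. g \<in> borel_measurable borel \<longrightarrow> 0 < t \<longrightarrow>
     (\<exists>G\<in>sets borel. {z \<in> ball 0 1. \<exists>r>0. ennreal (t * r ^ (CARD('n) + 1)) < (\<integral>\<^sup>+w\<in>kball z r. g w \<partial>lborel)} \<subseteq> G \<and>
        emeasure lborel G \<le> ennreal (C / t) * (\<integral>\<^sup>+w\<in>ball 0 1. g w \<partial>lborel))"
proof -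
  obtain C where C0: "0 < C" and C1: "\<forall>(z :: complex ^ 'n) r. norm z \<le> 1 \<longrightarrow> 0 < r \<longrightarrow>
     emeasure lborel (kball z r) \<le> ennreal (C * r ^ (CARD('n) + 1))"
    using emeasure_kball_le by blast
  show ?thesis
  proof (intro exI[of _ "C * 14 ^ (CARD('n) + 1)"] conjI allI impI)
    fix g :: "complex ^ 'n \<Rightarrow> ennreal" and t :: real
    assume [measurable]: "g \<in> borel_measurable borel" and t: "0 < t"
    define \<nu> where "\<nu> = density lborel g"
    have \<nu>: "emeasure \<nu> A = (\<integral>\<^sup>+w\<in>A. g w \<partial>lborel)" if "A \<in> sets borel" for A
      using that unfolding \<nu>_def by (subst emeasure_density) auto
    have [measurable_cong]: "sets \<nu> = sets borel"
      by (simp add: \<nu>_def)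
    define Z where "Z = {z \<in> ball (0 :: complex ^ 'n) 1. \<exists>r>0. ennreal (t * r ^ (CARD('n) + 1)) < (\<integral>\<^sup>+w\<in>kball z r. g w \<partial>lborel)}"
    define R where "R z = (SOME r. 0 < r \<and> ennreal (t * r ^ (CARD('n) + 1)) < (\<integral>\<^sup>+w\<in>kball z r. g w \<partial>lborel))" for z
    have R: "0 < R z" "ennreal (t * R z ^ (CARD('n) + 1)) < (\<integral>\<^sup>+w\<in>kball z (R z). g w \<partial>lborel)" if "z \<in> Z" for z
    proof -
      have "\<exists>r. 0 < r \<and> ennreal (t * r ^ (CARD('n) + 1)) < (\<integral>\<^sup>+w\<in>kball z r. g w \<partial>lborel)"
        using that by (auto simp: Z_def)
      from someI_ex[OF this] show "0 < R z" "ennreal (t * R z ^ (CARD('n) + 1)) < (\<integral>\<^sup>+w\<in>kball z (R z). g w \<partial>lborel)"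
        unfolding R_def by auto
    qed
    have nZ: "norm z \<le> 1" if "z \<in> Z" for z
      using that by (auto simp: Z_def)
    \<comment> \<open>A ball carrying mass is nonempty, so \<open>1 - norm z < R z\<close>; and
      \<open>hdist z z = 1 - (norm z)\<^sup>2\<close> is at most twice the left side.\<close>
    have in_own: "z \<in> kball z (2 * R z)" if "z \<in> Z" for z
    proof -
      have "kball z (R z) \<noteq> {}"
        using R(2)[OF that] by (intro notI) simp
      then obtain y where "norm y < 1" "hdist z y < R z"
        by (auto simp: kball_iff)
      then have "1 - norm z < R z"
        using hdist_ge[of y z] by simp
      moreover have "hdist z z \<le> 2 * (1 - norm z)"
      proof -
        have nz: "norm z < 1" using that by (simp add: Z_def)
        have "hdist z z = \<bar>1 - (norm z)\<^sup>2\<bar>"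
          unfolding hdist_def hermitian_inner_self by (metis norm_of_real of_real_1 of_real_diff)
        also have "\<dots> = 1 - (norm z)\<^sup>2"
          using nz by (simp add: abs_square_le_1)
        also have "\<dots> \<le> 2 * (1 - norm z)"
          using zero_le_power2[of "1 - norm z"] by (simp add: power2_eq_square algebra_simps)
        finally show ?thesis .
      qed
      ultimately show ?thesis
        using that by (simp add: kball_iff Z_def)
    qed
    have finite_bound: "emeasure lborel (\<Union>z\<in>J. kball z (2 * R z))
        \<le> ennreal (C * 14 ^ (CARD('n) + 1) / t) * (\<integral>\<^sup>+w\<in>ball 0 1. g w \<partial>lborel)" if J: "finite J" "J \<subseteq> Z" for J
    proof -
      obtain S where S: "S \<subseteq> J" "disjoint_family_on (\<lambda>z. kball z (R z)) S"
        "\<And>j. j \<in> J \<Longrightarrow> \<exists>i\<in>S. (kball i (R i) \<inter> kball j (R j) \<noteq> {} \<or> i = j) \<and> R j \<le> R i"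
        using finite_vitali_selection[OF J(1), of "\<lambda>z. kball z (R z)" R] by blast
      have finS: "finite S"
        using S(1) J(1) finite_subset by blast
      have "(\<Union>z\<in>J. kball z (2 * R z)) \<subseteq> (\<Union>z\<in>S. kball z (14 * R z))"
      proof (intro UN_least)
        fix j assume j: "j \<in> J"
        then obtain i where i: "i \<in> S" "kball i (R i) \<inter> kball j (R j) \<noteq> {} \<or> i = j" "R j \<le> R i"
          using S(3) by blast
        have iZ: "i \<in> Z" "j \<in> Z"
          using i j S(1) J(2) by auto
        have "kball j (2 * R j) \<subseteq> kball i (14 * R i)"
          using i(2)
        proof
          assume "i = j"
          then show ?thesis
            using R(1)[OF iZ(1)] by (auto simp: kball_iff)
        next
          assume "kball i (R i) \<inter> kball j (R j) \<noteq> {}"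
          then show ?thesis
            using kball_14_cover nZ iZ i(3) by blast
        qed
        then show "kball j (2 * R j) \<subseteq> (\<Union>z\<in>S. kball z (14 * R z))"
          using i(1) by blast
      qed
      then have "emeasure lborel (\<Union>z\<in>J. kball z (2 * R z)) \<le> emeasure lborel (\<Union>z\<in>S. kball z (14 * R z))"
        using finS by (intro emeasure_mono) auto
      also have "\<dots> \<le> (\<Sum>z\<in>S. emeasure lborel (kball z (14 * R z)))"
        using finS by (intro emeasure_subadditive_finite) auto
      also have "\<dots> \<le> (\<Sum>z\<in>S. ennreal (C * 14 ^ (CARD('n) + 1) / t) * emeasure \<nu> (kball z (R z)))"
      proof (rule sum_mono)
        fix z assume "z \<in> S"
        then have z: "z \<in> Z" using S J by auto
        have "emeasure lborel (kball z (14 * R z)) \<le> ennreal (C * (14 * R z) ^ (CARD('n) + 1))"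
          using R(1)[OF z] by (intro C1[rule_format] nZ z) simp
        also have "C * (14 * R z) ^ (CARD('n) + 1) = (C * 14 ^ (CARD('n) + 1) / t) * (t * R z ^ (CARD('n) + 1))"
          using t by (simp only: power_mult_distrib) simp
        also have "ennreal \<dots> = ennreal (C * 14 ^ (CARD('n) + 1) / t) * ennreal (t * R z ^ (CARD('n) + 1))"
          using C0 t R(1)[OF z] by (intro ennreal_mult) auto
        also have "\<dots> \<le> ennreal (C * 14 ^ (CARD('n) + 1) / t) * emeasure \<nu> (kball z (R z))"
          using R(2)[OF z] by (intro mult_left_mono) (auto simp: \<nu>)
        finally show "emeasure lborel (kball z (14 * R z)) \<le> ennreal (C * 14 ^ (CARD('n) + 1) / t) * emeasure \<nu> (kball z (R z))" .
      qed
      also have "\<dots> = ennreal (C * 14 ^ (CARD('n) + 1) / t) * emeasure \<nu> (\<Union>z\<in>S. kball z (R z))"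
        using S(2) finS by (simp only: sum_distrib_left[symmetric]) (subst sum_emeasure, auto)
      also have "\<dots> \<le> ennreal (C * 14 ^ (CARD('n) + 1) / t) * emeasure \<nu> (ball 0 1)"
        by (intro mult_left_mono emeasure_mono) (auto simp: kball_iff)
      finally show ?thesis
        by (simp add: \<nu>)
    qed
    define G where "G = (\<Union>z\<in>Z. kball z (2 * R z))"
    have "Z \<subseteq> G"
      using in_own by (auto simp: G_def)
    moreover have "G \<in> sets borel"
      unfolding G_def by (intro borel_open open_UN) auto
    moreover have "emeasure lborel G \<le> ennreal (C * 14 ^ (CARD('n) + 1) / t) * (\<integral>\<^sup>+w\<in>ball 0 1. g w \<partial>lborel)"
    proof -
      have "\<And>S. S \<in> (\<lambda>z. kball z (2 * R z)) ` Z \<Longrightarrow> open S"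
        by auto
      \<comment> \<open>The bound for finite subfamilies is uniform. Lindelof's theorem leaves
        countably many balls, and these are exhausted by finite unions.\<close>
      from Lindelof[OF this] obtain F where F: "F \<subseteq> (\<lambda>z. kball z (2 * R z)) ` Z" "countable F" "\<Union>F = G"
        unfolding G_def by blast
      then obtain Y where Y: "countable Y" "Y \<subseteq> Z" "F = (\<lambda>z. kball z (2 * R z)) ` Y"
        using countable_subset_image[of F "\<lambda>z. kball z (2 * R z)" Z] by auto
      show ?thesis
      proof (cases "Y = {}")
        case True
        then show ?thesis
          using F Y by auto
      next
        case False
        define e where "e = from_nat_into Y"
        have e: "range e = Y"
          unfolding e_def using False Y(1) by (rule range_from_nat_into)
        define D where "D n = (\<Union>z\<in>e ` {..<n}. kball z (2 * R z))" for n
        have "G = (\<Union>n. D n)"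
          unfolding F(3)[symmetric] Y(3) e[symmetric] D_def by (auto intro: lessI)
        moreover have "emeasure lborel (\<Union>n. D n) = (SUP n. emeasure lborel (D n))"
        proof (rule SUP_emeasure_incseq[symmetric])
          show "range D \<subseteq> sets lborel"
            by (auto simp: D_def)
          show "incseq D"
            unfolding D_def by (intro incseq_SucI UN_mono) auto
        qed
        moreover have "emeasure lborel (D n) \<le> ennreal (C * 14 ^ (CARD('n) + 1) / t) * (\<integral>\<^sup>+w\<in>ball 0 1. g w \<partial>lborel)" for n
          unfolding D_def using e Y(2) by (intro finite_bound) auto
        ultimately show ?thesis
          by (simp add: SUP_least)
      qed
    qed
    ultimately show "\<exists>G\<in>sets borel. {z \<in> ball 0 1. \<exists>r>0. ennreal (t * r ^ (CARD('n) + 1)) < (\<integral>\<^sup>+w\<in>kball z r. g w \<partial>lborel)} \<subseteq> G \<and>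
        emeasure lborel G \<le> ennreal (C * 14 ^ (CARD('n) + 1) / t) * (\<integral>\<^sup>+w\<in>ball 0 1. g w \<partial>lborel)"
      unfolding Z_def[symmetric] by blast
  qed (use C0 in auto)
qed

lemma ennreal_mult3:
  "0 \<le> x \<Longrightarrow> 0 \<le> y \<Longrightarrow> 0 \<le> z \<Longrightarrow> ennreal x * (ennreal y * (ennreal z * I)) = ennreal (x * y * z) * I"
  by (simp add: ennreal_mult mult.assoc)

lemma bergman_pos_weak_L2:
  "\<exists>C>0. \<forall>(g :: complex ^ 'n \<Rightarrow> ennreal) t. g \<in> borel_measurable borel \<longrightarrow> 0 < t \<longrightarrow>
     emeasure lborel {z \<in> ball 0 1. ennreal t < bergman_pos g z} \<le> ennreal (C / t\<^sup>2) * (\<integral>\<^sup>+w\<in>ball 0 1. (g w)\<^sup>2 \<partial>lborel)"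
proof -
  obtain C where C0: "0 < C" and C1: "\<forall>g :: complex ^ 'n \<Rightarrow> ennreal. g \<in> borel_measurable borel \<longrightarrow>
     (\<integral>\<^sup>+z\<in>ball 0 1. (bergman_pos g z)\<^sup>2 \<partial>lborel) \<le> ennreal C * (\<integral>\<^sup>+w\<in>ball 0 1. (g w)\<^sup>2 \<partial>lborel)"
    using bergman_pos_L2 by blast
  show ?thesis
  proof (intro exI[of _ C] conjI allI impI)
    fix g :: "complex ^ 'n \<Rightarrow> ennreal" and t :: real
    assume g [measurable]: "g \<in> borel_measurable borel" and t: "0 < t"
    have [measurable]: "ball (0 :: complex ^ 'n) 1 \<in> sets borel" by simp
    have "emeasure lborel {z \<in> ball 0 1. ennreal t < bergman_pos g z}
        \<le> emeasure lborel {z \<in> ball 0 1. 1 \<le> ennreal (1 / t\<^sup>2) * (bergman_pos g z)\<^sup>2}"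
    proof (rule emeasure_mono)
      show "{z \<in> ball 0 1. ennreal t < bergman_pos g z} \<subseteq> {z \<in> ball 0 1. 1 \<le> ennreal (1 / t\<^sup>2) * (bergman_pos g z)\<^sup>2}"
      proof safe
        fix z assume "ennreal t < bergman_pos g z"
        then have "ennreal (1 / t\<^sup>2) * (ennreal t)\<^sup>2 \<le> ennreal (1 / t\<^sup>2) * (bergman_pos g z)\<^sup>2"
          by (intro mult_left_mono power_mono) auto
        moreover have "ennreal (1 / t\<^sup>2) * (ennreal t)\<^sup>2 = 1"
          using t by (simp add: ennreal_power flip: ennreal_mult)
        ultimately show "1 \<le> ennreal (1 / t\<^sup>2) * (bergman_pos g z)\<^sup>2" by simp
      qed
      show "{z \<in> ball 0 1. 1 \<le> ennreal (1 / t\<^sup>2) * (bergman_pos g z)\<^sup>2} \<in> sets lborel"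
        by measurable
    qed
    also have "\<dots> \<le> ennreal (1 / t\<^sup>2) * (\<integral>\<^sup>+z\<in>ball 0 1. (bergman_pos g z)\<^sup>2 \<partial>lborel)"
      by (intro nn_integral_Markov_inequality) auto
    also have "\<dots> \<le> ennreal (1 / t\<^sup>2) * (ennreal C * (\<integral>\<^sup>+w\<in>ball 0 1. (g w)\<^sup>2 \<partial>lborel))"
      using C1 g by (intro mult_left_mono) auto
    also have "\<dots> = ennreal (C / t\<^sup>2) * (\<integral>\<^sup>+w\<in>ball 0 1. (g w)\<^sup>2 \<partial>lborel)"
      using C0 by (simp add: mult.assoc[symmetric] flip: ennreal_mult)
    finally show "emeasure lborel {z \<in> ball 0 1. ennreal t < bergman_pos g z}
        \<le> ennreal (C / t\<^sup>2) * (\<integral>\<^sup>+w\<in>ball 0 1. (g w)\<^sup>2 \<partial>lborel)" .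
  qed (rule C0)
qed

text \<open>
  Away from the set where the maximal function of \<open>g\<close> exceeds \<open>t\<close>, the density \<open>g\<close> may be spread
  over Whitney regions without decreasing \<open>bergman_pos g\<close> by more than a factor. The spread density
  is bounded by a multiple of \<open>t\<close>, so the \<open>L\<^sup>2\<close> estimate applies; no cancellation is needed.
\<close>

lemma bergman_pos_weak_L1:
  "\<exists>C>0. \<forall>(g :: complex ^ 'n \<Rightarrow> ennreal) t. g \<in> borel_measurable borel \<longrightarrow> 0 < t \<longrightarrow>
     emeasure lborel {z \<in> ball 0 1. ennreal t < bergman_pos g z} \<le> ennreal (C / t) * (\<integral>\<^sup>+w\<in>ball 0 1. g w \<partial>lborel)"
proof -
  define N where "N = CARD('n) + 1"
  define B where "B = ball (0 :: complex ^ 'n) 1"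
  have [measurable]: "B \<in> sets borel" by (simp add: B_def)
  obtain C1 where C1: "0 < C1" and C1': "\<forall>(z :: complex ^ 'n) r. norm z \<le> 1 \<longrightarrow> 0 < r \<longrightarrow>
     emeasure lborel (kball z r) \<le> ennreal (C1 * r ^ N)"
    unfolding N_def using emeasure_kball_le by blast
  obtain C2 where C2: "0 < C2" and C2': "\<forall>(w :: complex ^ 'n) \<rho>. norm w \<le> 1 \<longrightarrow> 0 < \<rho> \<longrightarrow> \<rho> \<le> 1/2 \<longrightarrow> 1 - norm w \<le> 4 * \<rho> \<longrightarrow>
     ennreal (C2 * \<rho> ^ N) \<le> emeasure lborel (kshell w \<rho>)"
    unfolding N_def using emeasure_kshell_ge by blast
  obtain C3 where C3: "0 < C3" and C3': "\<forall>(g :: complex ^ 'n \<Rightarrow> ennreal) t. g \<in> borel_measurable borel \<longrightarrow> 0 < t \<longrightarrow>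
     (\<exists>G\<in>sets borel. {z \<in> B. \<exists>r>0. ennreal (t * r ^ N) < (\<integral>\<^sup>+w\<in>kball z r. g w \<partial>lborel)} \<subseteq> G \<and>
        emeasure lborel G \<le> ennreal (C3 / t) * (\<integral>\<^sup>+w\<in>B. g w \<partial>lborel))"
    unfolding N_def B_def using maximal_function_cover by blast
  obtain C4 where C4: "0 < C4" and C4': "\<forall>(g :: complex ^ 'n \<Rightarrow> ennreal) t. g \<in> borel_measurable borel \<longrightarrow> 0 < t \<longrightarrow>
     emeasure lborel {z \<in> B. ennreal t < bergman_pos g z} \<le> ennreal (C4 / t\<^sup>2) * (\<integral>\<^sup>+w\<in>B. (g w)\<^sup>2 \<partial>lborel)"
    unfolding B_def using bergman_pos_weak_L2 by blast
  define C5 :: real where "C5 = (385 / 4) ^ N"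
  define C6 where "C6 = 5 ^ N / C2"
  define C7 where "C7 = C4 * C6\<^sup>2 * C5 * (C1 * 6 ^ N)"
  have pos: "0 < C5" "0 < C6" "0 < C7"
    using C1 C2 C4 by (auto simp: C5_def C6_def C7_def)
  show ?thesis
  proof (intro exI[of _ "C3 + C7"] conjI allI impI)
    fix g :: "complex ^ 'n \<Rightarrow> ennreal" and t :: real
    assume g [measurable]: "g \<in> borel_measurable borel" and t: "0 < t"
    define Bad where "Bad = {z \<in> B. \<exists>r>0. ennreal (t * r ^ N) < (\<integral>\<^sup>+w\<in>kball z r. g w \<partial>lborel)}"
    define Good where "Good = B - Bad"
    define I where "I = (\<integral>\<^sup>+w\<in>B. g w \<partial>lborel)"
    obtain G where G [measurable]: "G \<in> sets borel" and BG: "Bad \<subseteq> G" and Gm: "emeasure lborel G \<le> ennreal (C3 / t) * I"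
      using C3'[rule_format, OF g t] unfolding Bad_def[symmetric] I_def[symmetric] by blast
    have good: "(\<integral>\<^sup>+w\<in>kball z r. g w \<partial>lborel) \<le> ennreal (t * r ^ N)" if "z \<in> Good" "0 < r" for z r
    proof (rule ccontr)
      assume "\<not> ?thesis"
      then have "z \<in> Bad"
        using that by (auto simp: Good_def Bad_def not_le)
      then show False
        using that by (simp add: Good_def)
    qed
    have split: "ennreal (C3 / t) * I + ennreal (C7 / t) * I = ennreal ((C3 + C7) / t) * I"
      using C3 pos t by (simp add: add_divide_distrib distrib_right)
    have "emeasure lborel {z \<in> B. ennreal t < bergman_pos g z} \<le> ennreal (C3 / t) * I + ennreal (C7 / t) * I"
    proof (cases "Good = {}")
      case True
      then have "emeasure lborel {z \<in> B. ennreal t < bergman_pos g z} \<le> emeasure lborel G"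
        using BG by (intro emeasure_mono) (auto simp: Good_def)
      then show ?thesis
        using Gm by (meson le_iff_add order_trans)
    next
      case False
      \<comment> \<open>The quasi-distance from \<open>w\<close> to the good set. It never drops
        below \<open>1 - norm w\<close>, so it is positive even at good points.\<close>
      define \<rho> where "\<rho> w = (INF z\<in>Good. hdist z w)" for w
      have bdd: "bdd_below ((\<lambda>z. hdist z w) ` Good)" for w
        by (intro bdd_belowI[of _ 0]) auto
      have \<rho>_le: "\<rho> w \<le> hdist z w" if "z \<in> Good" for z w
        unfolding \<rho>_def using that bdd by (intro cINF_lower) auto
      have \<rho>_ge: "1 - norm w \<le> \<rho> w" if "w \<in> B" for w
        unfolding \<rho>_def using False that
        by (intro cINF_greatest) (auto simp: Good_def B_def intro!: hdist_ge')
      have \<rho>_less: "\<rho> w < s \<longleftrightarrow> (\<exists>z\<in>Good. hdist z w < s)" for w s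
        unfolding \<rho>_def using False bdd by (subst cINF_less_iff) auto
      have \<rho>2: "\<rho> w \<le> 2" if "w \<in> B" for w
      proof -
        obtain z where "z \<in> Good" using False by auto
        then show ?thesis
          using \<rho>_le[of z w] hdist_le[of z w] that by (auto simp: Good_def B_def)
      qed
      have [measurable]: "\<rho> \<in> borel_measurable borel"
        unfolding borel_measurable_iff_less
      proof (intro allI)
        fix s
        have "{w \<in> space borel. \<rho> w < s} = (\<Union>z\<in>Good. {w. hdist z w < s})"
          using \<rho>_less by auto
        then show "{w \<in> space borel. \<rho> w < s} \<in> sets borel"
          by (auto intro!: borel_open open_UN open_Collect_less continuous_intros)
      qed
      \<comment> \<open>The quarter matches \<open>emeasure_kshell_ge\<close>:
        \<open>1 - norm w \<le> \<rho> w = 4 * \<sigma> w\<close>, and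
        \<open>\<rho> w \<le> 2\<close> gives \<open>\<sigma> w \<le> 1/2\<close>.\<close>
      define \<sigma> where "\<sigma> w = \<rho> w / 4" for w
      have [measurable]: "\<sigma> \<in> borel_measurable borel"
        unfolding \<sigma>_def[abs_def] by measurable
      have \<sigma>: "0 < \<sigma> w" "\<sigma> w \<le> 1/2" "1 - norm w \<le> 4 * \<sigma> w" if "w \<in> B" for w
        using \<rho>_ge[OF that] \<rho>2[OF that] that by (auto simp: \<sigma>_def B_def)
      define \<kappa> :: "complex ^ 'n \<Rightarrow> complex ^ 'n \<Rightarrow> ennreal" where "\<kappa> w v = indicator (kshell w (\<sigma> w)) v" for w v
      have [measurable]: "(\<lambda>x. \<kappa> (p x) (q x)) \<in> borel_measurable M"
        if [measurable]: "p \<in> borel_measurable M" "q \<in> borel_measurable M" for p q and M :: "'z measure"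
        unfolding \<kappa>_def indicator_def kshell_def kball_iff mem_Collect_eq by measurable
      \<comment> \<open>The mass \<open>g w\<close> is to be distributed over
        \<open>kshell w (\<sigma> w)\<close>, whose volume is comparable to
        \<open>\<sigma> w ^ N\<close>; \<open>h\<close> is the density that results.\<close>
      define a where "a w = g w * ennreal (1 / \<sigma> w ^ N) * indicator B w" for w
      have [measurable]: "a \<in> borel_measurable borel"
        unfolding a_def[abs_def] by measurable
      define h where "h v = (\<integral>\<^sup>+w. a w * \<kappa> w v \<partial>lborel)" for v
      have h [measurable]: "h \<in> borel_measurable borel"
        unfolding h_def[abs_def] by measurable
      have kshell_B: "kshell w r \<subseteq> B" for w r
        by (auto simp: kshell_def kball_iff B_def)
      have h_int: "(\<integral>\<^sup>+v\<in>B. h v \<partial>lborel) \<le> ennreal (C1 * 6 ^ N) * I"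
      proof -
        have "(\<integral>\<^sup>+v\<in>B. h v \<partial>lborel) \<le> (\<integral>\<^sup>+v. h v \<partial>lborel)"
          by (intro nn_integral_mono) (auto simp: indicator_def)
        also have "\<dots> = (\<integral>\<^sup>+w. (\<integral>\<^sup>+v. a w * \<kappa> w v \<partial>lborel) \<partial>lborel)"
          unfolding h_def by (rule lborel_pair.Fubini') measurable
        also have "\<dots> = (\<integral>\<^sup>+w. a w * emeasure lborel (kshell w (\<sigma> w)) \<partial>lborel)"
          unfolding \<kappa>_def by (intro nn_integral_cong nn_integral_cmult_indicator) simp
        also have "\<dots> \<le> (\<integral>\<^sup>+w. ennreal (C1 * 6 ^ N) * (g w * indicator B w) \<partial>lborel)"
        proof (rule nn_integral_mono)
          fix w
          show "a w * emeasure lborel (kshell w (\<sigma> w)) \<le> ennreal (C1 * 6 ^ N) * (g w * indicator B w)"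
          proof (cases "w \<in> B")
            case True
            have "emeasure lborel (kshell w (\<sigma> w)) \<le> emeasure lborel (kball w (6 * \<sigma> w))"
              by (intro emeasure_mono) (auto simp: kshell_def)
            also have "\<dots> \<le> ennreal (C1 * (6 * \<sigma> w) ^ N)"
              using \<sigma>(1)[OF True] True by (intro C1'[rule_format]) (simp_all add: B_def)
            finally have "a w * emeasure lborel (kshell w (\<sigma> w)) \<le> a w * ennreal (C1 * (6 * \<sigma> w) ^ N)"
              by (rule mult_left_mono) simp
            also have "\<dots> = g w * (ennreal (1 / \<sigma> w ^ N) * ennreal (C1 * (6 * \<sigma> w) ^ N))"
              using True by (simp add: a_def mult_ac)
            also have "ennreal (1 / \<sigma> w ^ N) * ennreal (C1 * (6 * \<sigma> w) ^ N) = ennreal (C1 * 6 ^ N)"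
              using \<sigma>(1)[OF True] C1 by (subst ennreal_mult[symmetric]) (auto simp: power_mult_distrib)
            finally show ?thesis
              using True by (simp add: mult.commute)
          qed (simp add: a_def)
        qed
        also have "\<dots> = ennreal (C1 * 6 ^ N) * I"
          unfolding I_def by (rule nn_integral_cmult) measurable
        finally show ?thesis .
      qed
      have h_le: "h v \<le> ennreal (C5 * t)" if v: "v \<in> B" for v
      proof (cases "\<exists>w\<in>B. v \<in> kshell w (\<sigma> w)")
        case False
        then have zero: "a w * \<kappa> w v = 0" for w
          by (auto simp: a_def \<kappa>_def indicator_def)
        have "h v = (\<integral>\<^sup>+w. 0 \<partial>(lborel :: (complex ^ 'n) measure))"
          unfolding h_def by (intro nn_integral_cong zero)
        then show ?thesis
          by simp
      next
        case True
        then obtain w0 where w0: "w0 \<in> B" "v \<in> kshell w0 (\<sigma> w0)" by blast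
        \<comment> \<open>All points \<open>w\<close> whose shell contains \<open>v\<close> have
          \<open>\<sigma> w\<close> between \<open>4/7 * \<tau>\<close> and
          \<open>4/5 * \<tau>\<close>. Via a good point nearly closest to one of them, they all lie
          within \<open>2 * (2 * (32/5 + 24/5) + 24/5) * \<tau> < 55 * \<tau>\<close> of that good
          point, where the maximal bound for \<open>g\<close> is available. The base of
          \<open>C5\<close> is \<open>55 / (4/7) = 385/4\<close>.\<close>
        define \<tau> where "\<tau> = 1 - (norm v)\<^sup>2"
        have \<tau>: "0 < \<tau>"
          using v by (simp add: \<tau>_def B_def abs_square_less_1)
        have near: "4/7 * \<tau> \<le> \<sigma> w" "\<sigma> w \<le> 4/5 * \<tau>" "hdist w v < 24/5 * \<tau>" if "v \<in> kshell w (\<sigma> w)" for w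
          using that by (auto simp: kshell_def kball_iff \<tau>_def)
        have "\<rho> w0 < 2 * \<rho> w0"
          using \<sigma>[OF w0(1)] by (simp add: \<sigma>_def)
        then obtain z0 where z0: "z0 \<in> Good" "hdist z0 w0 < 2 * \<rho> w0"
          using \<rho>_less by blast
        have in_kball: "w \<in> kball z0 (55 * \<tau>)" if w: "w \<in> B" "v \<in> kshell w (\<sigma> w)" for w
        proof -
          have "hdist z0 v \<le> 2 * (hdist z0 w0 + hdist w0 v)" "hdist z0 w \<le> 2 * (hdist z0 v + hdist v w)"
            using z0(1) w0(1) w(1) v by (intro hdist_triangle; simp add: Good_def B_def)+
          moreover have "hdist z0 w0 < 32/5 * \<tau>"
            using z0(2) near(2)[OF w0(2)] by (simp add: \<sigma>_def)
          ultimately have "hdist z0 w < 55 * \<tau>"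
            using near(3)[OF w0(2)] near(3)[OF w(2)] hdist_commute[of v w] \<tau> by simp
          then show ?thesis
            using w(1) by (simp add: kball_iff B_def)
        qed
        have "h v \<le> (\<integral>\<^sup>+w. ennreal (1 / (4/7 * \<tau>) ^ N) * (g w * indicator (kball z0 (55 * \<tau>)) w) \<partial>lborel)"
          unfolding h_def
        proof (rule nn_integral_mono)
          fix w
          show "a w * \<kappa> w v \<le> ennreal (1 / (4/7 * \<tau>) ^ N) * (g w * indicator (kball z0 (55 * \<tau>)) w)"
          proof (cases "w \<in> B \<and> v \<in> kshell w (\<sigma> w)")
            case True
            have "1 / \<sigma> w ^ N \<le> 1 / (4/7 * \<tau>) ^ N"
              using \<tau> near(1)[of w] True by (intro divide_left_mono power_mono mult_pos_pos zero_less_power) auto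
            then have "g w * ennreal (1 / \<sigma> w ^ N) \<le> g w * ennreal (1 / (4/7 * \<tau>) ^ N)"
              by (intro mult_left_mono ennreal_leI) auto
            then show ?thesis
              using True in_kball[of w] by (simp add: a_def \<kappa>_def mult.commute)
          qed (auto simp: a_def \<kappa>_def indicator_def)
        qed
        also have "\<dots> = ennreal (1 / (4/7 * \<tau>) ^ N) * (\<integral>\<^sup>+w\<in>kball z0 (55 * \<tau>). g w \<partial>lborel)"
          by (rule nn_integral_cmult) measurable
        also have "\<dots> \<le> ennreal (1 / (4/7 * \<tau>) ^ N) * ennreal (t * (55 * \<tau>) ^ N)"
          using \<tau> by (intro mult_left_mono good[OF z0(1)]) auto
        also have "\<dots> = ennreal (1 / (4/7 * \<tau>) ^ N * (t * (55 * \<tau>) ^ N))"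
          using \<tau> t by (intro ennreal_mult[symmetric]) auto
        also have "1 / (4/7 * \<tau>) ^ N * (t * (55 * \<tau>) ^ N) = C5 * t"
        proof -
          have "1 / (4/7 * \<tau>) ^ N * (t * (55 * \<tau>) ^ N) = t * ((55 * \<tau>) / (4/7 * \<tau>)) ^ N"
            by (simp only: power_divide) simp
          also have "(55 * \<tau>) / (4/7 * \<tau>) = 385 / 4"
            using \<tau> by simp
          finally show ?thesis by (simp add: C5_def)
        qed
        finally show ?thesis .
      qed
      \<comment> \<open>Seen from a good \<open>z\<close> the spreading is harmless:
        \<open>6 * \<sigma> w \<le> 3/2 * hdist z w\<close>, so every \<open>v\<close> in the shell
        of \<open>w\<close> has \<open>hdist z v \<le> 2 * (1 + 3/2) * hdist z w\<close>. The kernel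
        thus loses at most \<open>5 ^ N\<close>, and \<open>C2\<close> accounts for the volume of
        the shell.\<close>
      have good_le: "bergman_pos g z \<le> ennreal C6 * bergman_pos h z" if z: "z \<in> Good" for z
      proof -
        define k where "k v = ennreal (1 / hdist z v ^ N)" for v
        have [measurable]: "k \<in> borel_measurable borel"
          unfolding k_def[abs_def] by measurable
        have "ennreal C6 * bergman_pos h z = (\<integral>\<^sup>+v. ennreal C6 * (h v * k v * indicator B v) \<partial>lborel)"
          unfolding bergman_pos_def k_def N_def B_def[symmetric] by (rule nn_integral_cmult[symmetric]) measurable
        also have "\<dots> = (\<integral>\<^sup>+v. (\<integral>\<^sup>+w. ennreal C6 * (a w * \<kappa> w v * k v * indicator B v) \<partial>lborel) \<partial>lborel)"
          unfolding h_def by (simp add: nn_integral_cmult nn_integral_multc)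
        also have "\<dots> = (\<integral>\<^sup>+w. (\<integral>\<^sup>+v. ennreal C6 * (a w * \<kappa> w v * k v * indicator B v) \<partial>lborel) \<partial>lborel)"
          by (rule lborel_pair.Fubini') measurable
        also have "\<dots> = (\<integral>\<^sup>+w. ennreal C6 * a w * (\<integral>\<^sup>+v\<in>kshell w (\<sigma> w). k v \<partial>lborel) \<partial>lborel)"
        proof (rule nn_integral_cong)
          fix w
          have "(\<integral>\<^sup>+v. ennreal C6 * (a w * \<kappa> w v * k v * indicator B v) \<partial>lborel)
              = (\<integral>\<^sup>+v. ennreal C6 * a w * (k v * indicator (kshell w (\<sigma> w)) v) \<partial>lborel)"
            using kshell_B[of w "\<sigma> w"]
            by (intro nn_integral_cong) (auto simp: \<kappa>_def indicator_def mult_ac)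
          then show "(\<integral>\<^sup>+v. ennreal C6 * (a w * \<kappa> w v * k v * indicator B v) \<partial>lborel)
              = ennreal C6 * a w * (\<integral>\<^sup>+v\<in>kshell w (\<sigma> w). k v \<partial>lborel)"
            by (simp add: nn_integral_cmult)
        qed
        also have "\<dots> \<ge> (\<integral>\<^sup>+w. g w * k w * indicator B w \<partial>lborel)"
        proof (rule nn_integral_mono)
          fix w
          show "g w * k w * indicator B w \<le> ennreal C6 * a w * (\<integral>\<^sup>+v\<in>kshell w (\<sigma> w). k v \<partial>lborel)"
          proof (cases "w \<in> B")
            case True
            define d where "d = hdist z w"
            have d: "0 < d" "\<rho> w \<le> d"
              using \<rho>_le[OF z, of w] \<sigma>(1)[OF True] by (auto simp: d_def \<sigma>_def)
            have k_ge: "ennreal (1 / (5 * d) ^ N) \<le> k v" if "v \<in> kshell w (\<sigma> w)" for v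
            proof -
              have vB: "v \<in> B" using that kshell_B by blast
              have "hdist z v \<le> 2 * (hdist z w + hdist w v)"
                using z True vB by (intro hdist_triangle) (auto simp: Good_def B_def)
              moreover have "hdist w v < 6 * \<sigma> w"
                using that by (simp add: kshell_def kball_iff)
              ultimately have "hdist z v \<le> 5 * d"
                using d by (simp add: \<sigma>_def d_def)
              moreover have "0 < hdist z v"
                using z vB by (intro hdist_pos) (auto simp: Good_def B_def)
              ultimately show ?thesis
                unfolding k_def using d by (intro ennreal_leI divide_left_mono power_mono mult_pos_pos zero_less_power) auto
            qed
            have "ennreal (1 / (5 * d) ^ N) * ennreal (C2 * \<sigma> w ^ N) \<le> ennreal (1 / (5 * d) ^ N) * emeasure lborel (kshell w (\<sigma> w))"
              using \<sigma>[OF True] True by (intro mult_left_mono C2'[rule_format]) (auto simp: B_def)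
            also have "\<dots> = (\<integral>\<^sup>+v\<in>kshell w (\<sigma> w). ennreal (1 / (5 * d) ^ N) \<partial>lborel)"
              by (simp add: nn_integral_cmult_indicator)
            also have "\<dots> \<le> (\<integral>\<^sup>+v\<in>kshell w (\<sigma> w). k v \<partial>lborel)"
              using k_ge by (intro nn_integral_mono) (auto simp: indicator_def)
            finally have le: "ennreal (1 / (5 * d) ^ N) * ennreal (C2 * \<sigma> w ^ N) \<le> (\<integral>\<^sup>+v\<in>kshell w (\<sigma> w). k v \<partial>lborel)" .
            have "1 / d ^ N = C6 * (1 / \<sigma> w ^ N) * (1 / (5 * d) ^ N * (C2 * \<sigma> w ^ N))"
              using C2 d \<sigma>(1)[OF True] by (simp add: C6_def power_mult_distrib field_simps)
            then have "k w = ennreal C6 * ennreal (1 / \<sigma> w ^ N) * (ennreal (1 / (5 * d) ^ N) * ennreal (C2 * \<sigma> w ^ N))"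
              unfolding k_def d_def[symmetric] using pos C2 d \<sigma>(1)[OF True] by (simp flip: ennreal_mult)
            then have "g w * k w * indicator B w = ennreal C6 * a w * (ennreal (1 / (5 * d) ^ N) * ennreal (C2 * \<sigma> w ^ N))"
              using True by (simp add: a_def mult_ac)
            also have "\<dots> \<le> ennreal C6 * a w * (\<integral>\<^sup>+v\<in>kshell w (\<sigma> w). k v \<partial>lborel)"
              using le by (rule mult_left_mono) simp
            finally show ?thesis .
          qed simp
        qed
        finally show ?thesis
          by (simp add: bergman_pos_def k_def N_def B_def)
      qed
      have "emeasure lborel {z \<in> B. ennreal (t / C6) < bergman_pos h z} \<le> ennreal (C7 / t) * I"
      proof -
        have "(\<integral>\<^sup>+w\<in>B. (h w)\<^sup>2 \<partial>lborel) \<le> (\<integral>\<^sup>+w. ennreal (C5 * t) * (h w * indicator B w) \<partial>lborel)"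
        proof (rule nn_integral_mono)
          fix w
          show "(h w)\<^sup>2 * indicator B w \<le> ennreal (C5 * t) * (h w * indicator B w)"
            using h_le[of w] by (cases "w \<in> B") (auto simp: power2_eq_square intro!: mult_right_mono)
        qed
        also have "\<dots> = ennreal (C5 * t) * (\<integral>\<^sup>+v\<in>B. h v \<partial>lborel)"
          by (rule nn_integral_cmult) measurable
        also have "\<dots> \<le> ennreal (C5 * t) * (ennreal (C1 * 6 ^ N) * I)"
          using h_int by (rule mult_left_mono) simp
        finally have h2: "(\<integral>\<^sup>+w\<in>B. (h w)\<^sup>2 \<partial>lborel) \<le> ennreal (C5 * t) * (ennreal (C1 * 6 ^ N) * I)" .
        have "emeasure lborel {z \<in> B. ennreal (t / C6) < bergman_pos h z}
            \<le> ennreal (C4 / (t / C6)\<^sup>2) * (\<integral>\<^sup>+w\<in>B. (h w)\<^sup>2 \<partial>lborel)"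
          using t pos by (intro C4'[rule_format] h) simp
        also have "\<dots> \<le> ennreal (C4 / (t / C6)\<^sup>2) * (ennreal (C5 * t) * (ennreal (C1 * 6 ^ N) * I))"
          using h2 by (rule mult_left_mono) simp
        also have "\<dots> = ennreal (C4 / (t / C6)\<^sup>2 * (C5 * t) * (C1 * 6 ^ N)) * I"
          using C4 C1 t pos by (intro ennreal_mult3) auto
        also have "C4 / (t / C6)\<^sup>2 * (C5 * t) * (C1 * 6 ^ N) = C7 / t"
          using t pos by (simp add: C7_def power2_eq_square field_simps)
        finally show ?thesis .
      qed
      moreover have "{z \<in> B. ennreal t < bergman_pos g z} \<subseteq> G \<union> {z \<in> B. ennreal (t / C6) < bergman_pos h z}"
      proof safe
        fix z assume z: "z \<in> B" "ennreal t < bergman_pos g z" "z \<notin> G"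
        then have "z \<in> Good" using BG by (auto simp: Good_def)
        then have lt: "ennreal t < ennreal C6 * bergman_pos h z"
          using good_le z(2) by (meson less_le_trans)
        show "ennreal (t / C6) < bergman_pos h z"
        proof (rule ccontr)
          assume "\<not> ennreal (t / C6) < bergman_pos h z"
          then have "ennreal C6 * bergman_pos h z \<le> ennreal C6 * ennreal (t / C6)"
            by (intro mult_left_mono) auto
          also have "\<dots> = ennreal t"
            using pos t by (simp flip: ennreal_mult)
          finally show False
            using lt by simp
        qed
      qed
      then have "emeasure lborel {z \<in> B. ennreal t < bergman_pos g z}
          \<le> emeasure lborel (G \<union> {z \<in> B. ennreal (t / C6) < bergman_pos h z})"
        by (rule emeasure_mono) measurable
      moreover have "emeasure lborel (G \<union> {z \<in> B. ennreal (t / C6) < bergman_pos h z})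
          \<le> emeasure lborel G + emeasure lborel {z \<in> B. ennreal (t / C6) < bergman_pos h z}"
        by (rule emeasure_subadditive) measurable
      ultimately show ?thesis
        using Gm by (meson add_mono order_trans)
    qed
    then show "emeasure lborel {z \<in> ball 0 1. ennreal t < bergman_pos g z}
        \<le> ennreal ((C3 + C7) / t) * (\<integral>\<^sup>+w\<in>ball 0 1. g w \<partial>lborel)"
      unfolding split by (simp add: B_def I_def)
  qed (use C3 pos in auto)
qed

subsection \<open>The logarithmic weight\<close>

definition log_weight :: "complex ^ 'n \<Rightarrow> real"
  where "log_weight w = 1 - ln (1 - norm w)"

lemma log_weight_ge_1: "norm w < 1 \<Longrightarrow> 1 \<le> log_weight w"
  by (simp add: log_weight_def)

lemma measurable_log_weight [measurable]: "log_weight \<in> borel_measurable borel"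
  unfolding log_weight_def[abs_def] by measurable

text \<open>Makes the estimates for Koranyi balls available on the whole unit ball; from the centre
  \<open>hdist\<close> is constantly 1.\<close>

lemma kball_0_2: "kball 0 2 = ball (0 :: complex ^ 'n) 1"
  by (auto simp: kball_iff hdist_def hermitian_inner_def)

text \<open>Young's inequality: \<open>exp (s - 1)\<close> is the Legendre conjugate of
  \<open>t * ln t\<close>, and replacing \<open>ln\<close> by \<open>log_plus\<close> only enlarges
  the right side.\<close>

lemma young_log:
  fixes s t :: real
  assumes "0 \<le> t"
  shows "s * t \<le> t * log_plus t + exp (s - 1)"
proof (cases "t = 0")
  case False
  then have t: "0 < t" using assms by simp
  have "s - ln t \<le> exp (s - 1 - ln t)"
    using exp_ge_add_one_self[of "s - 1 - ln t"] by simp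
  then have "t * (s - ln t) \<le> t * exp (s - 1 - ln t)"
    using t by simp
  also have "\<dots> = exp (s - 1)"
    using t by (simp add: exp_diff)
  finally have "s * t \<le> t * ln t + exp (s - 1)"
    by (simp add: algebra_simps)
  moreover have "t * ln t \<le> t * log_plus t"
    using t by (intro mult_left_mono) (auto simp: log_plus_def)
  ultimately show ?thesis by linarith
qed simp

lemma measurable_log_plus [measurable]: "log_plus \<in> borel_measurable borel"
  unfolding log_plus_def[abs_def] by measurable

text \<open>Young's inequality with \<open>s = log_weight w / 2\<close>. The half is there because
  \<open>exp (log_weight w)\<close> is \<open>exp 1 / (1 - norm w)\<close>, which just fails to be
  integrable, while its square root is controlled by \<open>nn_integral_kball_weight_le\<close>. As
  \<open>log_weight \<ge> 1\<close>, the lemma also bounds the integral of \<open>F\<close>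
  itself.\<close>

lemma nn_integral_log_weight_le:
  "\<exists>C>0. \<forall>F :: complex ^ 'n \<Rightarrow> real. F \<in> borel_measurable borel \<longrightarrow> (\<forall>w. 0 \<le> F w) \<longrightarrow>
     (\<integral>\<^sup>+w\<in>ball 0 1. ennreal (F w * log_plus (F w)) \<partial>lborel) \<le> 1 \<longrightarrow>
     (\<integral>\<^sup>+w\<in>ball 0 1. ennreal (log_weight w * F w) \<partial>lborel) \<le> ennreal C"
proof -
  define B where "B = ball (0 :: complex ^ 'n) 1"
  have [measurable]: "B \<in> sets borel" by (simp add: B_def)
  obtain C where C0: "0 < C" and C1: "\<forall>(z :: complex ^ 'n) r. norm z \<le> 1 \<longrightarrow> 0 < r \<longrightarrow>
     (\<integral>\<^sup>+w\<in>kball z r. ennreal (1 / sqrt (1 - norm w)) \<partial>lborel) \<le> ennreal (C * (r ^ CARD('n) * sqrt r))"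
    using nn_integral_kball_weight_le by blast
  define D where "D = C * (2 ^ CARD('n) * sqrt 2)"
  have D: "0 < D" "(\<integral>\<^sup>+w\<in>B. ennreal (1 / sqrt (1 - norm w)) \<partial>lborel) \<le> ennreal D"
    using C1[rule_format, of 0 2] C0 by (auto simp: D_def kball_0_2 B_def)
  show ?thesis
  proof (intro exI[of _ "2 * (1 + D)"] conjI allI impI)
    fix F :: "complex ^ 'n \<Rightarrow> real"
    assume F [measurable]: "F \<in> borel_measurable borel" and F0: "\<forall>w. 0 \<le> F w"
      and F1: "(\<integral>\<^sup>+w\<in>ball 0 1. ennreal (F w * log_plus (F w)) \<partial>lborel) \<le> 1"
    have pw: "log_weight w * F w \<le> 2 * (F w * log_plus (F w)) + 2 * (1 / sqrt (1 - norm w))" if "w \<in> B" for w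
    proof -
      define x where "x = 1 - norm w"
      have x: "0 < x" using that by (simp add: x_def B_def)
      have "exp (log_weight w / 2 - 1) = exp (- (1/2)) * (1 / sqrt x)"
      proof -
        have "log_weight w / 2 - 1 = - (1/2) - ln (sqrt x)"
          using x by (simp add: log_weight_def x_def[symmetric] ln_sqrt field_simps)
        then have "exp (log_weight w / 2 - 1) = exp (- (1/2)) / exp (ln (sqrt x))"
          by (simp only: exp_diff)
        then show ?thesis
          using x by simp
      qed
      also have "\<dots> \<le> 1 * (1 / sqrt x)"
        using x by (intro mult_right_mono) auto
      finally have "exp (log_weight w / 2 - 1) \<le> 1 / sqrt x" by simp
      moreover have "log_weight w / 2 * F w \<le> F w * log_plus (F w) + exp (log_weight w / 2 - 1)"
        using F0 by (intro young_log) auto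
      ultimately show ?thesis
        by (simp add: x_def)
    qed
    have "(\<integral>\<^sup>+w\<in>B. ennreal (log_weight w * F w) \<partial>lborel)
        \<le> (\<integral>\<^sup>+w. 2 * (ennreal (F w * log_plus (F w)) * indicator B w) + 2 * (ennreal (1 / sqrt (1 - norm w)) * indicator B w) \<partial>lborel)"
    proof (rule nn_integral_mono)
      fix w
      show "ennreal (log_weight w * F w) * indicator B w
          \<le> 2 * (ennreal (F w * log_plus (F w)) * indicator B w) + 2 * (ennreal (1 / sqrt (1 - norm w)) * indicator B w)"
      proof (cases "w \<in> B")
        case True
        have "ennreal (log_weight w * F w) \<le> ennreal (2 * (F w * log_plus (F w)) + 2 * (1 / sqrt (1 - norm w)))"
          using pw[OF True] by (rule ennreal_leI)
        also have "\<dots> = ennreal (2 * (F w * log_plus (F w))) + ennreal (2 * (1 / sqrt (1 - norm w)))"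
          using F0 True by (intro ennreal_plus) (auto simp: log_plus_def B_def)
        also have "\<dots> = 2 * ennreal (F w * log_plus (F w)) + 2 * ennreal (1 / sqrt (1 - norm w))"
          using F0 True by (subst (1 2) ennreal_mult) (auto simp: log_plus_def B_def)
        finally show ?thesis using True by simp
      qed simp
    qed
    also have "\<dots> = 2 * (\<integral>\<^sup>+w\<in>B. ennreal (F w * log_plus (F w)) \<partial>lborel) + 2 * (\<integral>\<^sup>+w\<in>B. ennreal (1 / sqrt (1 - norm w)) \<partial>lborel)"
      by (subst nn_integral_add) (auto simp: nn_integral_cmult)
    also have "\<dots> \<le> 2 * 1 + 2 * ennreal D"
      using F1 D by (intro add_mono mult_left_mono) (auto simp: B_def)
    also have "\<dots> = ennreal (2 * (1 + D))"
      using D by (simp add: ennreal_mult distrib_left)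
    finally show "(\<integral>\<^sup>+w\<in>ball 0 1. ennreal (log_weight w * F w) \<partial>lborel) \<le> ennreal (2 * (1 + D))"
      by (simp add: B_def)
  qed (use D in auto)
qed

lemma bergman_pos_add:
  assumes [measurable]: "g \<in> borel_measurable borel" "h \<in> borel_measurable borel"
  shows "bergman_pos (\<lambda>w. g w + h w) z = bergman_pos g z + bergman_pos h (z :: complex ^ 'n)"
proof -
  have [measurable]: "ball (0 :: complex ^ 'n) 1 \<in> sets borel"
    by simp
  show ?thesis
    unfolding bergman_pos_def
    by (subst nn_integral_add[symmetric]) (auto intro!: nn_integral_cong simp: distrib_right)
qed

lemma emeasure_sum_greater:
  assumes [measurable]: "B \<in> sets lborel" "u \<in> borel_measurable borel" "v \<in> borel_measurable borel"
    and "0 \<le> t"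
  shows "emeasure lborel {z \<in> B. ennreal t < u z + v z}
    \<le> emeasure lborel {z \<in> B. ennreal (t / 2) < u z} + emeasure lborel {z \<in> B. ennreal (t / 2) < v z}"
proof -
  have "{z \<in> B. ennreal t < u z + v z} \<subseteq> {z \<in> B. ennreal (t / 2) < u z} \<union> {z \<in> B. ennreal (t / 2) < v z}"
  proof safe
    fix z assume z: "ennreal t < u z + v z" "\<not> ennreal (t / 2) < v z"
    show "ennreal (t / 2) < u z"
    proof (rule ccontr)
      assume "\<not> ennreal (t / 2) < u z"
      then have "u z + v z \<le> ennreal (t / 2) + ennreal (t / 2)"
        using z by (intro add_mono) auto
      also have "\<dots> = ennreal t"
        using assms(4) by (simp flip: ennreal_plus)
      finally show False
        using z by simp
    qed
  qed
  then have "emeasure lborel {z \<in> B. ennreal t < u z + v z}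
      \<le> emeasure lborel ({z \<in> B. ennreal (t / 2) < u z} \<union> {z \<in> B. ennreal (t / 2) < v z})"
    by (rule emeasure_mono) measurable
  also have "\<dots> \<le> emeasure lborel {z \<in> B. ennreal (t / 2) < u z} + emeasure lborel {z \<in> B. ennreal (t / 2) < v z}"
    by (rule emeasure_subadditive) measurable
  finally show ?thesis .
qed

text \<open>Splitting \<open>F\<close> at height \<open>sqrt t\<close> gains a logarithm over the weak type estimate.\<close>

lemma bergman_pos_LlogL:
  "\<exists>C>0. \<forall>(F :: complex ^ 'n \<Rightarrow> real) t. F \<in> borel_measurable borel \<longrightarrow> (\<forall>w. 0 \<le> F w) \<longrightarrow>
     (\<integral>\<^sup>+w\<in>ball 0 1. ennreal (F w * log_plus (F w)) \<partial>lborel) \<le> 1 \<longrightarrow> 1 < t \<longrightarrow>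
     emeasure lborel {z \<in> ball 0 1. ennreal t < bergman_pos (\<lambda>w. ennreal (F w)) z} \<le> ennreal (C / (t * ln t))"
proof -
  define B where "B = ball (0 :: complex ^ 'n) 1"
  have [measurable]: "B \<in> sets borel" by (simp add: B_def)
  obtain C where C0: "0 < C" and C1: "\<forall>F :: complex ^ 'n \<Rightarrow> real. F \<in> borel_measurable borel \<longrightarrow> (\<forall>w. 0 \<le> F w) \<longrightarrow>
     (\<integral>\<^sup>+w\<in>ball 0 1. ennreal (F w * log_plus (F w)) \<partial>lborel) \<le> 1 \<longrightarrow>
     (\<integral>\<^sup>+w\<in>ball 0 1. ennreal (log_weight w * F w) \<partial>lborel) \<le> ennreal C"
    using nn_integral_log_weight_le by blast
  obtain C2 where C2: "0 < C2" and C2': "\<forall>(g :: complex ^ 'n \<Rightarrow> ennreal) t. g \<in> borel_measurable borel \<longrightarrow> 0 < t \<longrightarrow>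
     emeasure lborel {z \<in> B. ennreal t < bergman_pos g z} \<le> ennreal (C2 / t\<^sup>2) * (\<integral>\<^sup>+w\<in>B. (g w)\<^sup>2 \<partial>lborel)"
    unfolding B_def using bergman_pos_weak_L2 by blast
  obtain C3 where C3: "0 < C3" and C3': "\<forall>(g :: complex ^ 'n \<Rightarrow> ennreal) t. g \<in> borel_measurable borel \<longrightarrow> 0 < t \<longrightarrow>
     emeasure lborel {z \<in> B. ennreal t < bergman_pos g z} \<le> ennreal (C3 / t) * (\<integral>\<^sup>+w\<in>B. g w \<partial>lborel)"
    unfolding B_def using bergman_pos_weak_L1 by blast
  show ?thesis
  proof (intro exI[of _ "8 * C2 * C + 4 * C3"] conjI allI impI)
    fix F :: "complex ^ 'n \<Rightarrow> real" and t :: real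
    assume F [measurable]: "F \<in> borel_measurable borel" and F0: "\<forall>w. 0 \<le> F w"
      and F1: "(\<integral>\<^sup>+w\<in>ball 0 1. ennreal (F w * log_plus (F w)) \<partial>lborel) \<le> 1" and t: "1 < t"
    define s where "s = sqrt t"
    have s: "1 < s" "t = s * s" "ln t = 2 * ln s" "0 < ln s"
      using t by (auto simp: s_def ln_sqrt)
    define g1 where "g1 w = (if F w \<le> s then ennreal (F w) else 0)" for w
    define g2 where "g2 w = (if F w \<le> s then 0 else ennreal (F w))" for w
    have g [measurable]: "g1 \<in> borel_measurable borel" "g2 \<in> borel_measurable borel"
      unfolding g1_def[abs_def] g2_def[abs_def] by measurable
    have sum: "ennreal (F w) = g1 w + g2 w" for w
      by (simp add: g1_def g2_def)
    \<comment> \<open>One factor \<open>F\<close> is at most \<open>s\<close>. The other is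
      integrable, but \<open>F * log_plus F\<close> does not see values below 1; the bound for
      \<open>log_weight * F\<close> is used for it instead.\<close>
    have g1_int: "(\<integral>\<^sup>+w\<in>B. (g1 w)\<^sup>2 \<partial>lborel) \<le> ennreal (s * C)"
    proof -
      have "(\<integral>\<^sup>+w\<in>B. (g1 w)\<^sup>2 \<partial>lborel) \<le> (\<integral>\<^sup>+w. ennreal s * (ennreal (log_weight w * F w) * indicator B w) \<partial>lborel)"
      proof (rule nn_integral_mono)
        fix w
        show "(g1 w)\<^sup>2 * indicator B w \<le> ennreal s * (ennreal (log_weight w * F w) * indicator B w)"
        proof (cases "w \<in> B \<and> F w \<le> s")
          case True
          have "F w * F w \<le> s * (1 * F w)"
            using True F0 by (simp add: mult_right_mono)
          also have "\<dots> \<le> s * (log_weight w * F w)"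
            using True F0 s by (intro mult_left_mono mult_right_mono log_weight_ge_1) (auto simp: B_def)
          finally have "ennreal (F w * F w) \<le> ennreal s * ennreal (log_weight w * F w)"
            using s True F0 log_weight_ge_1[of w] by (subst ennreal_mult[symmetric]) (auto simp: B_def ennreal_leI)
          then show ?thesis
            using True F0 by (simp add: g1_def power2_eq_square flip: ennreal_mult)
        qed (auto simp: g1_def)
      qed
      also have "\<dots> = ennreal s * (\<integral>\<^sup>+w\<in>B. ennreal (log_weight w * F w) \<partial>lborel)"
        by (rule nn_integral_cmult) measurable
      also have "\<dots> \<le> ennreal s * ennreal C"
        unfolding B_def by (intro mult_left_mono C1[rule_format] F F0[rule_format] F1) auto
      also have "\<dots> = ennreal (s * C)"
        using s C0 by (simp add: ennreal_mult)
      finally show ?thesis .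
    qed
    \<comment> \<open>Where \<open>F > s\<close> the quotient \<open>log_plus (F w) / ln s\<close>
      is at least 1: this is the gained logarithm.\<close>
    have g2_int: "(\<integral>\<^sup>+w\<in>B. g2 w \<partial>lborel) \<le> ennreal (1 / ln s)"
    proof -
      have "(\<integral>\<^sup>+w\<in>B. g2 w \<partial>lborel) \<le> (\<integral>\<^sup>+w. ennreal (1 / ln s) * (ennreal (F w * log_plus (F w)) * indicator B w) \<partial>lborel)"
      proof (rule nn_integral_mono)
        fix w
        show "g2 w * indicator B w \<le> ennreal (1 / ln s) * (ennreal (F w * log_plus (F w)) * indicator B w)"
        proof (cases "F w \<le> s")
          case False
          then have "ln s \<le> log_plus (F w)"
            using s by (auto simp: log_plus_def)
          then have "F w * ln s \<le> F w * log_plus (F w)"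
            using F0 by (intro mult_left_mono) auto
          then have "F w \<le> 1 / ln s * (F w * log_plus (F w))"
            using s by (simp add: field_simps)
          then have "ennreal (F w) \<le> ennreal (1 / ln s) * ennreal (F w * log_plus (F w))"
            using s F0 by (subst ennreal_mult[symmetric]) (auto simp: log_plus_def intro!: ennreal_leI)
          then show ?thesis
            using False by (simp add: g2_def indicator_def)
        qed (simp add: g2_def)
      qed
      also have "\<dots> = ennreal (1 / ln s) * (\<integral>\<^sup>+w\<in>B. ennreal (F w * log_plus (F w)) \<partial>lborel)"
        by (rule nn_integral_cmult) measurable
      also have "\<dots> \<le> ennreal (1 / ln s) * 1"
        using F1 unfolding B_def by (rule mult_left_mono) simp
      finally show ?thesis by simp
    qed
    have "emeasure lborel {z \<in> B. ennreal t < bergman_pos (\<lambda>w. ennreal (F w)) z}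
        = emeasure lborel {z \<in> B. ennreal t < bergman_pos g1 z + bergman_pos g2 z}"
      by (simp add: sum bergman_pos_add)
    also have "\<dots> \<le> emeasure lborel {z \<in> B. ennreal (t / 2) < bergman_pos g1 z} + emeasure lborel {z \<in> B. ennreal (t / 2) < bergman_pos g2 z}"
      using t by (intro emeasure_sum_greater) auto
    also have "\<dots> \<le> ennreal (C2 / (t / 2)\<^sup>2) * (\<integral>\<^sup>+w\<in>B. (g1 w)\<^sup>2 \<partial>lborel) + ennreal (C3 / (t / 2)) * (\<integral>\<^sup>+w\<in>B. g2 w \<partial>lborel)"
      using t by (intro add_mono C2'[rule_format] C3'[rule_format] g) auto
    also have "\<dots> \<le> ennreal (C2 / (t / 2)\<^sup>2) * ennreal (s * C) + ennreal (C3 / (t / 2)) * ennreal (1 / ln s)"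
      by (intro add_mono mult_left_mono g1_int g2_int) auto
    also have "\<dots> = ennreal (C2 / (t / 2)\<^sup>2 * (s * C)) + ennreal (C3 / (t / 2) * (1 / ln s))"
      using s t C0 C2 C3 by (simp add: ennreal_mult[symmetric])
    also have "\<dots> = ennreal (C2 / (t / 2)\<^sup>2 * (s * C) + C3 / (t / 2) * (1 / ln s))"
      using s t C0 C2 C3 by (intro ennreal_plus[symmetric]) auto
    also have "\<dots> \<le> ennreal ((8 * C2 * C + 4 * C3) / (t * ln t))"
    proof (rule ennreal_leI)
      have "C2 / (t / 2)\<^sup>2 * (s * C) = (4 * C2 * C) / (t * s)"
        using s by (simp add: power2_eq_square field_simps)
      also have "\<dots> \<le> (4 * C2 * C) / (t * (ln t / 2))"
      proof (intro divide_left_mono mult_left_mono)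
        have "ln s \<le> s"
          using ln_le_minus_one[of s] s by simp
        then show "ln t / 2 \<le> s"
          using s by simp
      qed (use s t C0 C2 in auto)
      finally have "C2 / (t / 2)\<^sup>2 * (s * C) \<le> 8 * C2 * C / (t * ln t)"
        by simp
      moreover have "C3 / (t / 2) * (1 / ln s) = 4 * C3 / (t * ln t)"
        using s by (simp add: field_simps)
      ultimately show "C2 / (t / 2)\<^sup>2 * (s * C) + C3 / (t / 2) * (1 / ln s) \<le> (8 * C2 * C + 4 * C3) / (t * ln t)"
        by (simp add: add_divide_distrib)
    qed
    finally show "emeasure lborel {z \<in> ball 0 1. ennreal t < bergman_pos (\<lambda>w. ennreal (F w)) z}
        \<le> ennreal ((8 * C2 * C + 4 * C3) / (t * ln t))"
      by (simp add: B_def)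
  qed (use C0 C2 C3 in \<open>auto intro!: add_pos_pos\<close>)
qed

lemma log_weight_bergman_pos_LlogL:
  "\<exists>C>0. \<forall>(F :: complex ^ 'n \<Rightarrow> real) t. F \<in> borel_measurable borel \<longrightarrow> (\<forall>w. 0 \<le> F w) \<longrightarrow>
     (\<integral>\<^sup>+w\<in>ball 0 1. ennreal (F w * log_plus (F w)) \<partial>lborel) \<le> 1 \<longrightarrow> 0 < t \<longrightarrow>
     emeasure lborel {z \<in> ball 0 1. ennreal t < ennreal (log_weight z) * bergman_pos (\<lambda>w. ennreal (F w)) z} \<le> ennreal (C / t)"
proof -
  define B where "B = ball (0 :: complex ^ 'n) 1"
  have [measurable]: "B \<in> sets borel" by (simp add: B_def)
  obtain C1 where C1: "0 < C1" and C1': "\<forall>(F :: complex ^ 'n \<Rightarrow> real) t. F \<in> borel_measurable borel \<longrightarrow> (\<forall>w. 0 \<le> F w) \<longrightarrow>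
     (\<integral>\<^sup>+w\<in>B. ennreal (F w * log_plus (F w)) \<partial>lborel) \<le> 1 \<longrightarrow> 1 < t \<longrightarrow>
     emeasure lborel {z \<in> B. ennreal t < bergman_pos (\<lambda>w. ennreal (F w)) z} \<le> ennreal (C1 / (t * ln t))"
    unfolding B_def using bergman_pos_LlogL by blast
  obtain C2 where C2: "0 < C2" and C2': "\<forall>(z :: complex ^ 'n) r s. norm z \<le> 1 \<longrightarrow> 0 < s \<longrightarrow> 0 < r \<longrightarrow>
     emeasure lborel {w \<in> kball z r. 1 - norm w < s} \<le> ennreal (C2 * s * r ^ CARD('n))"
    using emeasure_kball_boundary_le by blast
  have bd: "emeasure lborel {w \<in> B. 1 - norm w < s} \<le> ennreal (C2 * 2 ^ CARD('n) * s)" if "0 < s" for s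
    using C2'[rule_format, of 0 s 2] that by (simp add: kball_0_2 B_def mult_ac)
  define C3 where "C3 = measure lborel B"
  have C3: "emeasure lborel B = ennreal C3" "0 \<le> C3"
    unfolding C3_def B_def using emeasure_lborel_ball_finite[of "0 :: complex ^ 'n" 1]
    by (auto simp: emeasure_eq_ennreal_measure)
  show ?thesis
  proof (intro exI[of _ "64 * C3 + C2 * 2 ^ CARD('n) + 8 * C1"] conjI allI impI)
    fix F :: "complex ^ 'n \<Rightarrow> real" and t :: real
    assume F [measurable]: "F \<in> borel_measurable borel" and F0: "\<forall>w. 0 \<le> F w"
      and F1: "(\<integral>\<^sup>+w\<in>ball 0 1. ennreal (F w * log_plus (F w)) \<partial>lborel) \<le> 1" and t: "0 < t"
    define P where "P = bergman_pos (\<lambda>w. ennreal (F w))"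
    have [measurable]: "P \<in> borel_measurable borel" by (simp add: P_def)
    have "emeasure lborel {z \<in> B. ennreal t < ennreal (log_weight z) * P z}
        \<le> ennreal ((64 * C3 + C2 * 2 ^ CARD('n) + 8 * C1) / t)"
    proof (cases "t \<le> 64")
      case True
      have "emeasure lborel {z \<in> B. ennreal t < ennreal (log_weight z) * P z} \<le> emeasure lborel B"
        by (rule emeasure_mono) auto
      also have "\<dots> \<le> ennreal ((64 * C3 + C2 * 2 ^ CARD('n) + 8 * C1) / t)"
        unfolding C3(1)
      proof (rule ennreal_leI)
        have "C3 * t \<le> C3 * 64"
          using True C3 by (intro mult_left_mono) auto
        also have "\<dots> \<le> 64 * C3 + C2 * 2 ^ CARD('n) + 8 * C1"
          using C1 C2 by simp
        finally show "C3 \<le> (64 * C3 + C2 * 2 ^ CARD('n) + 8 * C1) / t"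
          using t by (simp add: field_simps)
      qed
      finally show ?thesis .
    next
      case False
      \<comment> \<open>An auxiliary quantity for \<open>\<mu> \<ge> t powr (1/4)\<close>, which
        makes \<open>ln \<mu>\<close> at least a quarter of \<open>ln t\<close>. The threshold 64
        gives \<open>q\<^sup>2 = sqrt t > 8\<close> and hence \<open>8 * ln q \<le> q ^ 3\<close>.
        For \<open>t \<le> 64\<close> the finite volume of the ball was enough.\<close>
      define q where "q = t powr (1/4)"
      have q: "t = q ^ 4" "ln t = 4 * ln q"
        using t False by (auto simp: q_def powr_powr ln_powr simp flip: powr_realpow)
      have q1: "2 < q"
      proof (rule ccontr)
        assume "\<not> 2 < q"
        then have "q ^ 4 \<le> 2 ^ 4"
          by (intro power_mono) (auto simp: q_def)
        then show False
          using q False by simp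
      qed
      have lnq: "0 < ln q" "ln q \<le> q" "1 \<le> ln t"
      proof -
        show "0 < ln q" using q1 by simp
        show "ln q \<le> q" using ln_le_minus_one[of q] q1 by simp
        have "exp 1 \<le> t"
          using exp_le False by linarith
        then show "1 \<le> ln t"
          using t by (simp add: ln_ge_iff)
      qed
      \<comment> \<open>Off the layer \<open>1 - norm w < 1 / t\<close> the weight is at most
        \<open>1 + ln t \<le> 2 * ln t\<close>, so there \<open>P\<close> itself has to exceed this
        level.\<close>
      define \<mu> where "\<mu> = t / (2 * ln t)"
      have \<mu>: "q \<le> \<mu>"
      proof -
        have "8 * ln q \<le> 8 * q" using lnq by simp
        also have "8 * q \<le> q ^ 2 * q"
        proof (rule mult_right_mono)
          have "q ^ 2 * q ^ 2 > 8 * 8"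
            using False unfolding q(1) by (simp flip: power_add)
          then have "8 ^ 2 < (q ^ 2) ^ 2" by (simp add: power2_eq_square)
          then show "8 \<le> q ^ 2"
            by (meson less_imp_le power_less_imp_less_base zero_le_power2)
        qed (use q1 in simp)
        finally have "q * (8 * ln q) \<le> q * (q ^ 2 * q)"
          using q1 by (intro mult_left_mono) auto
        moreover have "q * (8 * ln q) = q * (2 * ln t)"
          using q(2) by simp
        moreover have "q * (q ^ 2 * q) = t"
          unfolding q(1) by (simp add: power2_eq_square power4_eq_xxxx mult_ac)
        ultimately have "q * (2 * ln t) \<le> t"
          by simp
        then show ?thesis
          using lnq by (simp add: \<mu>_def field_simps)
      qed
      then have \<mu>1: "1 < \<mu>" using q1 by simp
      have sub: "{z \<in> B. ennreal t < ennreal (log_weight z) * P z}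
          \<subseteq> {w \<in> B. 1 - norm w < 1 / t} \<union> {z \<in> B. ennreal \<mu> < P z}"
      proof safe
        fix z assume z: "z \<in> B" "ennreal t < ennreal (log_weight z) * P z" "\<not> ennreal \<mu> < P z"
        show "1 - norm z < 1 / t"
        proof (rule ccontr)
          assume "\<not> 1 - norm z < 1 / t"
          then have "1 / t \<le> 1 - norm z" by simp
          then have "ln (1 / t) \<le> ln (1 - norm z)"
            using t z by (subst ln_le_cancel_iff) (auto simp: B_def)
          then have "log_weight z \<le> 2 * ln t"
            using t lnq by (simp add: log_weight_def ln_div)
          then have "ennreal (log_weight z) * P z \<le> ennreal (2 * ln t) * ennreal \<mu>"
            using z(3) by (intro mult_mono ennreal_leI) auto
          also have "\<dots> = ennreal t"
            using lnq False \<mu>1 by (subst ennreal_mult[symmetric]) (auto simp: \<mu>_def)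
          finally show False
            using z(2) by simp
        qed
      qed
      have m: "{w \<in> B. 1 - norm w < 1 / t} \<in> sets lborel"
        by measurable
      have "emeasure lborel {z \<in> B. ennreal t < ennreal (log_weight z) * P z}
          \<le> emeasure lborel ({w \<in> B. 1 - norm w < 1 / t} \<union> {z \<in> B. ennreal \<mu> < P z})"
        using sub by (rule emeasure_mono) measurable
      also have "\<dots> \<le> emeasure lborel {w \<in> B. 1 - norm w < 1 / t} + emeasure lborel {z \<in> B. ennreal \<mu> < P z}"
        by (rule emeasure_subadditive) measurable
      also have "\<dots> \<le> ennreal (C2 * 2 ^ CARD('n) * (1 / t)) + ennreal (C1 / (\<mu> * ln \<mu>))"
        unfolding P_def using t \<mu>1
        by (intro add_mono bd C1'[rule_format] F F0[rule_format] F1[folded B_def]) auto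
      also have "\<dots> = ennreal (C2 * 2 ^ CARD('n) * (1 / t) + C1 / (\<mu> * ln \<mu>))"
        using C1 C2 t \<mu>1 by (intro ennreal_plus[symmetric]) auto
      also have "\<dots> \<le> ennreal ((64 * C3 + C2 * 2 ^ CARD('n) + 8 * C1) / t)"
      proof (rule ennreal_leI)
        \<comment> \<open>Here the logarithms cancel:
          \<open>\<mu> * ln \<mu> \<ge> t / (2 * ln t) * (ln t / 4) = t / 8\<close>.\<close>
        have "ln q \<le> ln \<mu>"
          using \<mu> q1 by (subst ln_le_cancel_iff) auto
        then have "t / (2 * ln t) * (ln t / 4) \<le> \<mu> * ln \<mu>"
          unfolding \<mu>_def[symmetric] using \<mu>1 q by (intro mult_left_mono) auto
        then have "t / 8 \<le> \<mu> * ln \<mu>"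
          using lnq by simp
        then have "C1 / (\<mu> * ln \<mu>) \<le> C1 / (t / 8)"
          using C1 t \<mu>1 by (intro divide_left_mono) auto
        moreover have "0 \<le> 64 * C3 / t"
          using C3 t by simp
        ultimately show "C2 * 2 ^ CARD('n) * (1 / t) + C1 / (\<mu> * ln \<mu>) \<le> (64 * C3 + C2 * 2 ^ CARD('n) + 8 * C1) / t"
          by (simp add: add_divide_distrib mult.commute)
      qed
      finally show ?thesis .
    qed
    then show "emeasure lborel {z \<in> ball 0 1. ennreal t < ennreal (log_weight z) * bergman_pos (\<lambda>w. ennreal (F w)) z}
        \<le> ennreal ((64 * C3 + C2 * 2 ^ CARD('n) + 8 * C1) / t)"
      by (simp add: B_def P_def)
  qed (use C1 C2 C3 in \<open>simp add: add_nonneg_pos\<close>)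
qed

lemma log_weight_commutator_LlogL:
  "\<exists>C>0. \<forall>(F :: complex ^ 'n \<Rightarrow> real) t. F \<in> borel_measurable borel \<longrightarrow> (\<forall>w. 0 \<le> F w) \<longrightarrow>
     (\<integral>\<^sup>+w\<in>ball 0 1. ennreal (F w * log_plus (F w)) \<partial>lborel) \<le> 1 \<longrightarrow> 0 < t \<longrightarrow>
     emeasure lborel {z \<in> ball 0 1. ennreal t < ennreal (log_weight z) * bergman_pos (\<lambda>w. ennreal (F w)) z
        + bergman_pos (\<lambda>w. ennreal (log_weight w * F w)) z} \<le> ennreal (C / t)"
proof -
  define B where "B = ball (0 :: complex ^ 'n) 1"
  have [measurable]: "B \<in> sets borel" by (simp add: B_def)
  obtain C1 where C1: "0 < C1" and C1': "\<forall>(F :: complex ^ 'n \<Rightarrow> real) t. F \<in> borel_measurable borel \<longrightarrow> (\<forall>w. 0 \<le> F w) \<longrightarrow>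
     (\<integral>\<^sup>+w\<in>B. ennreal (F w * log_plus (F w)) \<partial>lborel) \<le> 1 \<longrightarrow> 0 < t \<longrightarrow>
     emeasure lborel {z \<in> B. ennreal t < ennreal (log_weight z) * bergman_pos (\<lambda>w. ennreal (F w)) z} \<le> ennreal (C1 / t)"
    unfolding B_def using log_weight_bergman_pos_LlogL by blast
  obtain C2 where C2: "0 < C2" and C2': "\<forall>F :: complex ^ 'n \<Rightarrow> real. F \<in> borel_measurable borel \<longrightarrow> (\<forall>w. 0 \<le> F w) \<longrightarrow>
     (\<integral>\<^sup>+w\<in>B. ennreal (F w * log_plus (F w)) \<partial>lborel) \<le> 1 \<longrightarrow>
     (\<integral>\<^sup>+w\<in>B. ennreal (log_weight w * F w) \<partial>lborel) \<le> ennreal C2"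
    unfolding B_def using nn_integral_log_weight_le by blast
  obtain C3 where C3: "0 < C3" and C3': "\<forall>(g :: complex ^ 'n \<Rightarrow> ennreal) t. g \<in> borel_measurable borel \<longrightarrow> 0 < t \<longrightarrow>
     emeasure lborel {z \<in> B. ennreal t < bergman_pos g z} \<le> ennreal (C3 / t) * (\<integral>\<^sup>+w\<in>B. g w \<partial>lborel)"
    unfolding B_def using bergman_pos_weak_L1 by blast
  show ?thesis
    unfolding B_def[symmetric]
  proof (intro exI[of _ "2 * C1 + 2 * C3 * C2"] conjI allI impI)
    fix F :: "complex ^ 'n \<Rightarrow> real" and t :: real
    assume F [measurable]: "F \<in> borel_measurable borel" and F0: "\<forall>w. 0 \<le> F w"
      and F1: "(\<integral>\<^sup>+w\<in>B. ennreal (F w * log_plus (F w)) \<partial>lborel) \<le> 1" and t: "0 < t"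
    have m: "(\<lambda>w. ennreal (log_weight w * F w)) \<in> borel_measurable borel"
      by measurable
    have "emeasure lborel {z \<in> B. ennreal t < ennreal (log_weight z) * bergman_pos (\<lambda>w. ennreal (F w)) z
        + bergman_pos (\<lambda>w. ennreal (log_weight w * F w)) z}
      \<le> emeasure lborel {z \<in> B. ennreal (t / 2) < ennreal (log_weight z) * bergman_pos (\<lambda>w. ennreal (F w)) z}
        + emeasure lborel {z \<in> B. ennreal (t / 2) < bergman_pos (\<lambda>w. ennreal (log_weight w * F w)) z}"
      using t by (intro emeasure_sum_greater) auto
    also have "\<dots> \<le> ennreal (C1 / (t / 2)) + ennreal (C3 / (t / 2)) * (\<integral>\<^sup>+w\<in>B. ennreal (log_weight w * F w) \<partial>lborel)"
      using t by (intro add_mono C1'[rule_format] C3'[rule_format] F F0[rule_format] F1 m) auto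
    also have "\<dots> \<le> ennreal (C1 / (t / 2)) + ennreal (C3 / (t / 2)) * ennreal C2"
      by (intro add_mono order_refl mult_left_mono C2'[rule_format] F F0[rule_format] F1) auto
    also have "\<dots> = ennreal (C1 / (t / 2) + C3 / (t / 2) * C2)"
      using t C1 C2 C3 by (subst ennreal_mult[symmetric], simp, simp, subst ennreal_plus[symmetric]) auto
    also have "C1 / (t / 2) + C3 / (t / 2) * C2 = (2 * C1 + 2 * C3 * C2) / t"
      using t by (simp add: field_simps)
    finally show "emeasure lborel {z \<in> B. ennreal t < ennreal (log_weight z) * bergman_pos (\<lambda>w. ennreal (F w)) z
        + bergman_pos (\<lambda>w. ennreal (log_weight w * F w)) z} \<le> ennreal ((2 * C1 + 2 * C3 * C2) / t)" .
  qed (use C1 C2 C3 in \<open>auto intro!: add_pos_pos\<close>)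
qed

subsection \<open>Green identity and the mean value inequality\<close>

lemma integrable_compact_support:
  fixes F :: "'a::euclidean_space \<Rightarrow> real"
  assumes "compact K" "continuous_on K F" "\<And>x. x \<notin> K \<Longrightarrow> F x = 0"
  shows "integrable lborel F"
proof -
  have "(\<lambda>x. indicator K x *\<^sub>R F x) = F"
    using assms(3) by (auto simp: indicator_def fun_eq_iff)
  then show ?thesis
    using borel_integrable_compact[OF assms(1,2)] by simp
qed

text \<open>Difference quotients have integral zero by translation invariance.\<close>

lemma integral_directional_derivative_eq_0:
  fixes F D :: "'a::euclidean_space \<Rightarrow> real"
  assumes K: "compact K" and F0: "\<And>x. x \<notin> K \<Longrightarrow> F x = 0" and D0: "\<And>x. x \<notin> K \<Longrightarrow> D x = 0"
    and contF: "continuous_on UNIV F" and contD: "continuous_on UNIV D"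
    and deriv: "\<And>x. ((\<lambda>t. F (x + t *\<^sub>R e)) has_real_derivative D x) (at 0)"
  shows "integral\<^sup>L lborel D = 0"
proof -
  have intF: "integrable lborel F"
    using K contF F0 by (intro integrable_compact_support[of K]) (auto intro: continuous_on_subset)
  have [measurable]: "F \<in> borel_measurable borel" "D \<in> borel_measurable borel"
    using contF contD by (auto intro: borel_measurable_continuous_onI)
  obtain M where M: "0 < M" "\<And>x. \<bar>D x\<bar> \<le> M"
  proof -
    have "bounded (D ` K)"
      using K contD by (intro compact_imp_bounded compact_continuous_image) (auto intro: continuous_on_subset)
    then obtain M where "0 < M" "\<And>x. x \<in> K \<Longrightarrow> \<bar>D x\<bar> \<le> M"
      unfolding bounded_pos by auto
    then show ?thesis
      using that[of M] D0 by (metis abs_zero less_imp_le)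
  qed
  obtain R where R: "0 < R" "\<And>x. x \<in> K \<Longrightarrow> norm x \<le> R"
    using compact_imp_bounded[OF K] unfolding bounded_pos by auto
  have deriv': "((\<lambda>t. F (x + t *\<^sub>R e)) has_real_derivative D (x + s *\<^sub>R e)) (at s)" for x s
    using deriv[of "x + s *\<^sub>R e"] DERIV_shift[of "\<lambda>t. F (x + t *\<^sub>R e)" "D (x + s *\<^sub>R e)" 0 s]
    by (simp add: algebra_simps)
  define s where "s n = inverse (real (Suc n))" for n
  have s: "0 < s n" "s n \<le> 1" for n
    by (auto simp: s_def inverse_le_1_iff)
  define q where "q n x = (F (s n *\<^sub>R e + x) - F x) / s n" for n x
  \<comment> \<open>The mean value theorem bounds the quotients by \<open>M\<close>. The steps are
    at most 1, so outside the larger ball both sample points miss \<open>K\<close>.\<close>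
  have q_le: "\<bar>q n x\<bar> \<le> M * indicator (cball 0 (R + norm e)) x" for n x
  proof (cases "x \<in> cball 0 (R + norm e)")
    case True
    obtain c where "F (x + s n *\<^sub>R e) - F (x + 0 *\<^sub>R e) = (s n - 0) * D (x + c *\<^sub>R e)"
      using MVT2[OF s(1)[of n], of "\<lambda>t. F (x + t *\<^sub>R e)" "\<lambda>t. D (x + t *\<^sub>R e)"] deriv' by blast
    then have "q n x = D (x + c *\<^sub>R e)"
      using s[of n] by (simp add: q_def add.commute)
    then show ?thesis
      using M(2) True by simp
  next
    case False
    then have "R + norm e < norm x" by simp
    moreover have "norm (s n *\<^sub>R e) \<le> norm e"
      using s[of n] by (simp add: mult_left_le_one_le)
    moreover have "norm x \<le> norm (s n *\<^sub>R e + x) + norm (s n *\<^sub>R e)"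
      using norm_triangle_ineq4[of "s n *\<^sub>R e + x" "s n *\<^sub>R e"] by simp
    ultimately have "R < norm (s n *\<^sub>R e + x)" "R < norm x"
      using norm_ge_zero[of e] by linarith+
    then have "s n *\<^sub>R e + x \<notin> K" "x \<notin> K"
      using R(2) by force+
    then show ?thesis
      using F0 M(1) by (simp add: q_def)
  qed
  have "(\<lambda>n. integral\<^sup>L lborel (q n)) \<longlonglongrightarrow> integral\<^sup>L lborel D"
  proof (rule integral_dominated_convergence[where w="\<lambda>x. M * indicator (cball 0 (R + norm e)) x"])
    show "integrable lborel (\<lambda>x :: 'a. M * indicator (cball 0 (R + norm e)) x :: real)"
      using emeasure_lborel_cball_finite[of "0::'a" "R + norm e"] by (intro integrable_mult_right integrable_real_indicator) auto
    show "AE x in lborel. (\<lambda>n. q n x) \<longlonglongrightarrow> D x"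
    proof (rule AE_I2)
      fix x
      have "((\<lambda>h. (F (x + (0 + h) *\<^sub>R e) - F (x + 0 *\<^sub>R e)) / h) \<longlongrightarrow> D x) (at 0)"
        using deriv[of x] unfolding DERIV_def .
      moreover have "filterlim s (at 0) sequentially"
        unfolding s_def[abs_def] by (intro filterlim_atI LIMSEQ_inverse_real_of_nat) (simp add: eventually_sequentially)
      ultimately have "((\<lambda>n. (F (x + (0 + s n) *\<^sub>R e) - F (x + 0 *\<^sub>R e)) / s n) \<longlongrightarrow> D x) sequentially"
        by (rule filterlim_compose)
      then show "(\<lambda>n. q n x) \<longlonglongrightarrow> D x"
        by (simp add: q_def add.commute)
    qed
    show "AE x in lborel. norm (q n x) \<le> M * indicator (cball 0 (R + norm e)) x" for n
      using q_le by auto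
  qed (auto simp: q_def[abs_def])
  moreover have "integral\<^sup>L lborel (q n) = 0" for n
  proof -
    have *: "integral\<^sup>L lborel F = (\<integral>x. F (s n *\<^sub>R e + x) \<partial>lborel)"
      by (subst lborel_distr_plus[of "s n *\<^sub>R e", symmetric]) (simp add: integral_distr)
    have "integrable (distr lborel borel ((+) (s n *\<^sub>R e))) F"
      using intF by (simp add: lborel_distr_plus)
    then have "integrable lborel (\<lambda>x. F (s n *\<^sub>R e + x))"
      by (subst (asm) integrable_distr_eq) auto
    then show ?thesis
      using intF * by (simp add: q_def[abs_def])
  qed
  ultimately have "(\<lambda>n :: nat. 0 :: real) \<longlonglongrightarrow> integral\<^sup>L lborel D"
    by simp
  then show ?thesis
    by (simp add: LIMSEQ_const_iff)
qed

text \<open>Only the unmixed derivatives along the coordinate directions, which is all that a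
  Laplacian sees. Each is a derivative of one real variable along a line, so the one-dimensional
  product and chain rules apply directly.\<close>

definition dir_C2_on :: "'a::euclidean_space set \<Rightarrow> ('a \<Rightarrow> real) \<Rightarrow> ('a \<Rightarrow> 'a \<Rightarrow> real) \<Rightarrow> ('a \<Rightarrow> 'a \<Rightarrow> real) \<Rightarrow> bool"
  where "dir_C2_on S g g1 g2 \<longleftrightarrow> continuous_on S g \<and>
    (\<forall>e\<in>Basis. continuous_on S (g1 e) \<and> continuous_on S (g2 e) \<and>
      (\<forall>x\<in>S. ((\<lambda>t. g (x + t *\<^sub>R e)) has_real_derivative g1 e x) (at 0) \<and>
             ((\<lambda>t. g1 e (x + t *\<^sub>R e)) has_real_derivative g2 e x) (at 0)))"

lemma dir_C2_onD:
  assumes "dir_C2_on S g g1 g2"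
  shows "continuous_on S g"
    "\<And>e. e \<in> Basis \<Longrightarrow> continuous_on S (g1 e)" "\<And>e. e \<in> Basis \<Longrightarrow> continuous_on S (g2 e)"
    "\<And>e x. e \<in> Basis \<Longrightarrow> x \<in> S \<Longrightarrow> ((\<lambda>t. g (x + t *\<^sub>R e)) has_real_derivative g1 e x) (at 0)"
    "\<And>e x. e \<in> Basis \<Longrightarrow> x \<in> S \<Longrightarrow> ((\<lambda>t. g1 e (x + t *\<^sub>R e)) has_real_derivative g2 e x) (at 0)"
  using assms by (auto simp: dir_C2_on_def)

text \<open>The open sets \<open>S\<close> and the complement of \<open>K\<close> cover the space;
  near each point the extension is either the given function or 0. The next lemma rests on the same
  observation.\<close>

lemma continuous_on_extend_0:
  fixes F :: "'a::topological_space \<Rightarrow> real"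
  assumes "open S" "closed K" "K \<subseteq> S" "continuous_on S F" "\<And>x. x \<in> S \<Longrightarrow> x \<notin> K \<Longrightarrow> F x = 0"
  shows "continuous_on UNIV (\<lambda>x. if x \<in> S then F x else 0)"
proof -
  have "continuous_on (S \<union> - K) (\<lambda>x. if x \<in> S then F x else 0)"
  proof (rule continuous_on_open_Un)
    show "continuous_on S (\<lambda>x. if x \<in> S then F x else 0)"
      using assms(4) by (simp cong: continuous_on_cong)
    have "continuous_on (- K) (\<lambda>x. 0 :: real)" by simp
    then show "continuous_on (- K) (\<lambda>x. if x \<in> S then F x else 0)"
      by (rule continuous_on_eq) (auto simp: assms(5))
  qed (use assms in auto)
  moreover have "S \<union> - K = UNIV"
    using assms(3) by auto
  ultimately show ?thesis by simp
qed

lemma has_derivative_extend_0: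
  fixes F :: "'a::real_normed_vector \<Rightarrow> real"
  assumes "open S" "closed K" "K \<subseteq> S" "\<And>y. y \<in> S \<Longrightarrow> y \<notin> K \<Longrightarrow> F y = 0"
    and deriv: "\<And>x. x \<in> S \<Longrightarrow> ((\<lambda>t. F (x + t *\<^sub>R e)) has_real_derivative D x) (at 0)"
    and D0: "\<And>y. y \<in> S \<Longrightarrow> y \<notin> K \<Longrightarrow> D y = 0"
  shows "((\<lambda>t. if x + t *\<^sub>R e \<in> S then F (x + t *\<^sub>R e) else 0) has_real_derivative (if x \<in> S then D x else 0)) (at 0)"
proof (cases "x \<in> S")
  case True
  have "open ((\<lambda>t. x + t *\<^sub>R e) -` S)"
    by (intro open_vimage assms(1) continuous_intros)
  from has_field_derivative_transform_within_open[OF deriv[OF True] this]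
  show ?thesis
    using True by simp
next
  case False
  then have x: "x \<notin> K" using assms(3) by auto
  have op: "open ((\<lambda>t. x + t *\<^sub>R e) -` (- K))"
    by (intro open_vimage continuous_intros) (use assms(2) in auto)
  have "((\<lambda>t. 0 :: real) has_real_derivative 0) (at 0)"
    by simp
  from has_field_derivative_transform_within_open[OF this op]
  show ?thesis
    using False x assms(4) by simp
qed

text \<open>In each direction \<open>e\<close> the function
  \<open>g * \<psi>1 e - \<psi> * g1 e\<close> has derivative
  \<open>g * \<psi>2 e - \<psi> * g2 e\<close>, as the products of first derivatives cancel. It is
  supported in \<open>K\<close>, so the integral of its derivative is 0. Summation over
  \<open>e\<close> produces the Laplacians.\<close>

lemma green_identity:
  fixes g \<psi> :: "'a::euclidean_space \<Rightarrow> real"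
  assumes S: "open S" and K: "compact K" "K \<subseteq> S"
    and g: "dir_C2_on S g g1 g2" and \<psi>: "dir_C2_on S \<psi> \<psi>1 \<psi>2"
    and \<psi>0: "\<And>x. x \<in> S \<Longrightarrow> x \<notin> K \<Longrightarrow> \<psi> x = 0"
      "\<And>x e. x \<in> S \<Longrightarrow> x \<notin> K \<Longrightarrow> \<psi>1 e x = 0" "\<And>x e. x \<in> S \<Longrightarrow> x \<notin> K \<Longrightarrow> \<psi>2 e x = 0"
  shows "(\<integral>x. (if x \<in> S then g x * (\<Sum>e\<in>Basis. \<psi>2 e x) else 0) \<partial>lborel)
    = (\<integral>x. (if x \<in> S then \<psi> x * (\<Sum>e\<in>Basis. g2 e x) else 0) \<partial>lborel)"
proof -
  note g' = dir_C2_onD[OF g] and \<psi>' = dir_C2_onD[OF \<psi>]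
  have clK: "closed K" using K compact_imp_closed by auto
  have int: "integrable lborel (\<lambda>x. if x \<in> S then F x else 0)"
    if "continuous_on S F" "\<And>x. x \<in> S \<Longrightarrow> x \<notin> K \<Longrightarrow> F x = 0" for F :: "'a \<Rightarrow> real"
    using continuous_on_extend_0[OF S clK K(2) that] K that(2)
    by (intro integrable_compact_support[of K]) (auto intro: continuous_on_subset)
  have eq: "(\<integral>x. (if x \<in> S then g x * \<psi>2 e x else 0) \<partial>lborel)
      = (\<integral>x. (if x \<in> S then \<psi> x * g2 e x else 0) \<partial>lborel)" if e: "e \<in> Basis" for e
  proof -
    define F where "F x = g x * \<psi>1 e x - \<psi> x * g1 e x" for x
    define D where "D x = g x * \<psi>2 e x - \<psi> x * g2 e x" for x
    have F0: "F x = 0" and D0: "D x = 0" if "x \<in> S" "x \<notin> K" for x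
      using \<psi>0 that by (simp_all add: F_def D_def)
    have contF: "continuous_on S F" and contD: "continuous_on S D"
      unfolding F_def[abs_def] D_def[abs_def] by (intro continuous_intros g' \<psi>' e)+
    have "integral\<^sup>L lborel (\<lambda>x. if x \<in> S then D x else 0) = 0"
    proof (rule integral_directional_derivative_eq_0[where F="\<lambda>x. if x \<in> S then F x else 0" and e=e])
      show "compact K" by fact
      show "(if x \<in> S then F x else 0) = 0" "(if x \<in> S then D x else 0) = 0" if "x \<notin> K" for x
        using that F0 D0 by auto
      show "continuous_on UNIV (\<lambda>x. if x \<in> S then F x else 0)"
        by (rule continuous_on_extend_0[OF S clK K(2) contF F0])
      show "continuous_on UNIV (\<lambda>x. if x \<in> S then D x else 0)"
        by (rule continuous_on_extend_0[OF S clK K(2) contD D0])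
      show "((\<lambda>t. if x + t *\<^sub>R e \<in> S then F (x + t *\<^sub>R e) else 0) has_real_derivative (if x \<in> S then D x else 0)) (at 0)" for x
      proof (rule has_derivative_extend_0[OF S clK K(2)])
        fix x assume x: "x \<in> S"
        have "((\<lambda>t. g (x + t *\<^sub>R e) * \<psi>1 e (x + t *\<^sub>R e) - \<psi> (x + t *\<^sub>R e) * g1 e (x + t *\<^sub>R e))
            has_real_derivative ((g1 e x * \<psi>1 e (x + 0 *\<^sub>R e) + \<psi>2 e x * g (x + 0 *\<^sub>R e))
              - (\<psi>1 e x * g1 e (x + 0 *\<^sub>R e) + g2 e x * \<psi> (x + 0 *\<^sub>R e)))) (at 0)"
          by (intro DERIV_diff DERIV_mult g'(4,5) \<psi>'(4,5) e x)
        then show "((\<lambda>t. F (x + t *\<^sub>R e)) has_real_derivative D x) (at 0)"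
          by (simp add: F_def D_def algebra_simps)
      qed (use F0 D0 in auto)
    qed
    moreover have "(\<lambda>x. if x \<in> S then D x else 0)
        = (\<lambda>x. (if x \<in> S then g x * \<psi>2 e x else 0) - (if x \<in> S then \<psi> x * g2 e x else 0))"
      by (auto simp: D_def)
    moreover have "integrable lborel (\<lambda>x. if x \<in> S then g x * \<psi>2 e x else 0)"
      "integrable lborel (\<lambda>x. if x \<in> S then \<psi> x * g2 e x else 0)"
      by (rule int; use \<psi>0 in \<open>auto intro!: continuous_intros g' \<psi>' e\<close>)+
    ultimately show ?thesis by simp
  qed
  have "(\<integral>x. (if x \<in> S then g x * (\<Sum>e\<in>Basis. \<psi>2 e x) else 0) \<partial>lborel)
      = (\<integral>x. (\<Sum>e\<in>Basis. if x \<in> S then g x * \<psi>2 e x else 0) \<partial>lborel)"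
    by (intro Bochner_Integration.integral_cong) (auto simp: sum_distrib_left)
  also have "\<dots> = (\<Sum>e\<in>Basis. \<integral>x. (if x \<in> S then g x * \<psi>2 e x else 0) \<partial>lborel)"
    by (intro Bochner_Integration.integral_sum int) (use \<psi>0 in \<open>auto intro!: continuous_intros g' \<psi>'\<close>)
  also have "\<dots> = (\<Sum>e\<in>Basis. \<integral>x. (if x \<in> S then \<psi> x * g2 e x else 0) \<partial>lborel)"
    by (intro sum.cong refl eq)
  also have "\<dots> = (\<integral>x. (\<Sum>e\<in>Basis. if x \<in> S then \<psi> x * g2 e x else 0) \<partial>lborel)"
    by (intro Bochner_Integration.integral_sum[symmetric] int) (use \<psi>0 in \<open>auto intro!: continuous_intros g' \<psi>'\<close>)
  also have "\<dots> = (\<integral>x. (if x \<in> S then \<psi> x * (\<Sum>e\<in>Basis. g2 e x) else 0) \<partial>lborel)"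
    by (intro Bochner_Integration.integral_cong) (auto simp: sum_distrib_left)
  finally show ?thesis .
qed

text \<open>Only the point 0 needs an argument; with exponent at least 2 the difference quotient
  there is bounded by a positive power of \<open>\<bar>h\<bar>\<close>.\<close>

lemma has_real_derivative_max_0_power:
  fixes x :: real
  shows "((\<lambda>x. max 0 x ^ Suc (Suc n)) has_real_derivative real (Suc (Suc n)) * max 0 x ^ Suc n) (at x)"
proof -
  consider "x < 0" | "0 < x" | "x = 0" by linarith
  then show ?thesis
  proof cases
    case 1
    have "((\<lambda>x. 0 :: real) has_real_derivative 0) (at x)"
      by simp
    then have "((\<lambda>x. max 0 x ^ Suc (Suc n)) has_real_derivative 0) (at x)"
      by (rule has_field_derivative_transform_within_open[of _ _ _ "{..<0}"]) (use 1 in auto)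
    then show ?thesis
      using 1 by simp
  next
    case 2
    have "((\<lambda>x. x ^ Suc (Suc n)) has_real_derivative real (Suc (Suc n)) * x ^ Suc n) (at x)"
      using DERIV_pow[of "Suc (Suc n)" x] by simp
    then have "((\<lambda>x. max 0 x ^ Suc (Suc n)) has_real_derivative real (Suc (Suc n)) * x ^ Suc n) (at x)"
      by (rule has_field_derivative_transform_within_open[of _ _ _ "{0<..}"]) (use 2 in auto)
    then show ?thesis
      using 2 by simp
  next
    case 3
    have "((\<lambda>h. max 0 h ^ Suc (Suc n) / h) \<longlongrightarrow> 0) (at (0::real))"
    proof (rule Lim_null_comparison)
      show "\<forall>\<^sub>F h :: real in at 0. norm (max 0 h ^ Suc (Suc n) / h) \<le> \<bar>h\<bar> ^ Suc n"
      proof (intro always_eventually allI)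
        fix h :: real
        show "norm (max 0 h ^ Suc (Suc n) / h) \<le> \<bar>h\<bar> ^ Suc n"
          by (cases "0 \<le> h") (auto simp: max_def abs_mult mult_nonpos_nonneg)
      qed
      show "((\<lambda>h::real. \<bar>h\<bar> ^ Suc n) \<longlongrightarrow> 0) (at 0)"
        by (auto intro!: tendsto_eq_intros)
    qed
    then show ?thesis
      using 3 by (simp add: DERIV_def)
  qed
qed

lemma has_real_derivative_norm_square:
  fixes x e :: "'a::euclidean_space"
  shows "((\<lambda>t. (norm (x + t *\<^sub>R e - p))\<^sup>2) has_real_derivative 2 * ((x - p) \<bullet> e)) (at 0)"
proof -
  have "(norm (x + t *\<^sub>R e - p))\<^sup>2 = (norm (x - p))\<^sup>2 + 2 * t * ((x - p) \<bullet> e) + t\<^sup>2 * (e \<bullet> e)" for t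
    unfolding power2_norm_eq_inner
    by (simp add: inner_add_left inner_add_right inner_diff_left inner_diff_right
        inner_commute power2_eq_square algebra_simps)
  then show ?thesis
    by (auto intro!: derivative_eq_intros)
qed

section \<open>Solid mean values of subharmonic functions\<close>

definition hat :: "'a::euclidean_space \<Rightarrow> real"
  where "hat v = max 0 (1 - (norm v)\<^sup>2)"

lemma hat_eq_0: "v \<notin> cball 0 1 \<Longrightarrow> hat v = 0"
  by (auto simp: hat_def max_def abs_square_le_1[symmetric] abs_le_square_iff[symmetric] not_le
      dest!: power_strict_mono[of 1 _ 2])

lemma hat_nonneg: "0 \<le> hat v" and hat_le_1: "hat v \<le> 1"
  by (auto simp: hat_def)

lemma continuous_on_hat [continuous_intros]: "continuous_on S hat"
  unfolding hat_def[abs_def] by (intro continuous_intros)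

lemma integral_hat_pos: "0 < (\<integral>v. hat v \<partial>(lborel :: 'a::euclidean_space measure))"
proof -
  have int: "integrable lborel (hat :: 'a \<Rightarrow> real)"
    by (rule integrable_compact_support[of "cball 0 1"]) (auto intro: continuous_on_hat hat_eq_0)
  have "0 < 3/4 * measure lborel (ball (0 :: 'a) (1/2))"
    using content_ball_pos[of "1/2" "0 :: 'a"] by simp
  also have "\<dots> = (\<integral>v. 3/4 * indicator (ball (0 :: 'a) (1/2)) v \<partial>lborel)"
    by simp
  also have "\<dots> \<le> (\<integral>v. hat v \<partial>(lborel :: 'a measure))"
  proof (rule integral_mono)
    show "integrable lborel (\<lambda>v :: 'a. 3/4 * indicator (ball 0 (1/2)) v :: real)"
      using emeasure_lborel_ball_finite[of "0 :: 'a" "1/2"]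
      by (intro integrable_mult_right integrable_real_indicator) auto
    fix v :: 'a
    show "3/4 * indicator (ball 0 (1/2)) v \<le> hat v"
    proof (cases "v \<in> ball 0 (1/2)")
      case True
      then have "(norm v)\<^sup>2 \<le> (1/2)\<^sup>2"
        by (intro power_mono) auto
      then show ?thesis
        using True by (simp add: hat_def power2_eq_square)
    qed (simp add: hat_nonneg)
  qed (rule int)
  finally show ?thesis .
qed

text \<open>
  The derivative of \<open>\<integral>v. hat v * g (z + s *\<^sub>R v)\<close> in \<open>s\<close> is \<open>s\<close> times the integral of the Laplacian against
  \<open>(hat v)\<^sup>2 / 4\<close>, because \<open>hat v * v\<close> is minus the gradient of the latter function.
\<close>

lemma hat_mean_mono:
  fixes g :: "'a::euclidean_space \<Rightarrow> real"
  assumes r: "0 < r" "r < R"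
    and der: "\<And>x. x \<in> ball z R \<Longrightarrow> (g has_derivative (\<lambda>h. \<Sum>e\<in>Basis. (h \<bullet> e) * g1 e x)) (at x)"
    and C2: "dir_C2_on (ball z R) g g1 g2"
    and lap: "\<And>x. x \<in> ball z R \<Longrightarrow> 0 \<le> (\<Sum>e\<in>Basis. g2 e x)"
  shows "g z * (\<integral>v. hat v \<partial>(lborel :: 'a measure)) \<le> (\<integral>v. hat v * g (z + r *\<^sub>R v) \<partial>lborel)"
proof -
  note C2' = dir_C2_onD[OF C2]
  \<comment> \<open>Room between \<open>r\<close> and \<open>R\<close>: the parameter
    \<open>s\<close> then ranges over an open interval containing \<open>0\<close> and
    \<open>r\<close>, and \<open>v\<close> over a neighbourhood \<open>S\<close> of the closed unit
    ball.\<close>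
  obtain r' where r': "r < r'" "r' < R" using dense[OF r(2)] by auto
  define S where "S = ball (0::'a) (R / r')"
  define U where "U = {- r'<..<r'}"
  have U: "open U" "convex U" and S: "open S" by (auto simp: U_def S_def)
  have "1 < R / r'"
    using r r' by simp
  then have KS: "cball 0 1 \<subseteq> S"
    by (auto simp: S_def)
  have in_ball: "z + s *\<^sub>R v \<in> ball z R" if "s \<in> U" "v \<in> S" for s v
  proof -
    have "\<bar>s\<bar> * norm v \<le> r' * norm v"
      using that r r' by (intro mult_right_mono) (auto simp: U_def)
    also have "\<dots> < R"
      using that r r' by (auto simp: S_def field_simps)
    finally show ?thesis by (simp add: dist_norm)
  qed
  have cont_comp: "continuous_on (U \<times> S) (\<lambda>p. G (z + fst p *\<^sub>R snd p))" if "continuous_on (ball z R) G" for G :: "'a \<Rightarrow> real"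
    by (rule continuous_on_compose2[OF that]) (use in_ball in \<open>auto intro!: continuous_intros\<close>)
  have cont_comp': "continuous_on S (\<lambda>v. G (z + s *\<^sub>R v))" if "continuous_on (ball z R) G" "s \<in> U" for G :: "'a \<Rightarrow> real" and s
    by (rule continuous_on_compose2[OF that(1)]) (use in_ball that in \<open>auto intro!: continuous_intros\<close>)
  have ext: "continuous_on UNIV F" "integrable lborel F"
    if "continuous_on S F" "\<And>v. v \<notin> cball 0 1 \<Longrightarrow> F v = 0" for F :: "'a \<Rightarrow> real"
  proof -
    have F: "(\<lambda>x. if x \<in> S then F x else 0) = F"
      using that(2) KS by (intro HOL.ext) (metis subsetD)
    have "continuous_on UNIV (\<lambda>x. if x \<in> S then F x else 0)"
      by (rule continuous_on_extend_0[OF S closed_cball KS that(1)]) (rule that(2))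
    then show "continuous_on UNIV F"
      unfolding F .
    show "integrable lborel F"
      using that KS by (intro integrable_compact_support[of "cball 0 1"]) (auto intro: continuous_on_subset)
  qed
  \<comment> \<open>The Leibniz rule is applied to integrals over a box. Any box around the unit
    ball will do, since the integrands vanish off \<open>cball 0 1\<close>.\<close>
  obtain a where a: "cball 0 1 \<subseteq> cbox (- a) (a :: 'a)"
    using bounded_subset_cbox_symmetric[of "cball 0 1"] by auto
  have cbox_lborel: "integral (cbox (- a) a) F = integral\<^sup>L lborel F"
    if "continuous_on S F" "\<And>v. v \<notin> cball 0 1 \<Longrightarrow> F v = 0" for F :: "'a \<Rightarrow> real"
  proof -
    have "(\<lambda>x. if x \<in> cbox (- a) a then F x else 0) = F"
      using that(2) a by (intro HOL.ext) (metis subsetD)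
    then have "integral (cbox (- a) a) F = integral UNIV F"
      using integral_restrict_UNIV[of "cbox (- a) a" F] by simp
    then show ?thesis
      using integral_lborel[OF ext(2)[OF that]] by simp
  qed
  define f where "f s v = hat v * g (z + s *\<^sub>R v)" for s v
  define fx where "fx s v = hat v * (\<Sum>e\<in>Basis. (v \<bullet> e) * g1 e (z + s *\<^sub>R v))" for s v
  have f: "continuous_on S (f s)" "f s v = 0" if "s \<in> U" "v \<notin> cball 0 1" for s v
    using that C2' by (auto simp: f_def[abs_def] hat_eq_0 intro!: continuous_intros cont_comp')
  have fcont: "continuous_on S (f s)" if "s \<in> U" for s
    unfolding f_def[abs_def] by (intro continuous_intros cont_comp' C2' that)
  have fxcont: "continuous_on S (fx s)" if "s \<in> U" for s
    unfolding fx_def[abs_def] by (intro continuous_intros cont_comp' C2' that)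
  have f0: "f s v = 0" "fx s v = 0" if "v \<notin> cball 0 1" for s v
    using hat_eq_0[OF that] by (auto simp: f_def fx_def)
  have deriv: "((\<lambda>s. integral (cbox (- a) a) (f s)) has_real_derivative integral (cbox (- a) a) (fx s)) (at s)" if s: "s \<in> U" for s
  proof -
    have "((\<lambda>s. integral (cbox (- a) a) (f s)) has_real_derivative integral (cbox (- a) a) (fx s)) (at s within U)"
    proof (rule leibniz_rule_field_derivative)
      fix s v assume s: "s \<in> U"
      show "((\<lambda>s. f s v) has_real_derivative fx s v) (at s within U)"
      proof (cases "v \<in> S")
        case True
        have "((\<lambda>s. z + s *\<^sub>R v) has_derivative (\<lambda>t. t *\<^sub>R v)) (at s)"
          by (auto intro!: derivative_eq_intros)
        from has_derivative_compose[OF this der[OF in_ball[OF s True]]]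
        have "((\<lambda>s. g (z + s *\<^sub>R v)) has_derivative (\<lambda>t. \<Sum>e\<in>Basis. (t *\<^sub>R v \<bullet> e) * g1 e (z + s *\<^sub>R v))) (at s)" .
        moreover have "(\<lambda>t. \<Sum>e\<in>Basis. (t *\<^sub>R v \<bullet> e) * g1 e (z + s *\<^sub>R v)) = (*) (\<Sum>e\<in>Basis. (v \<bullet> e) * g1 e (z + s *\<^sub>R v))"
          by (auto simp: sum_distrib_left mult_ac fun_eq_iff)
        ultimately have "((\<lambda>s. g (z + s *\<^sub>R v)) has_real_derivative (\<Sum>e\<in>Basis. (v \<bullet> e) * g1 e (z + s *\<^sub>R v))) (at s)"
          by (simp add: has_field_derivative_def)
        from DERIV_cmult[OF this, of "hat v"] show ?thesis
          unfolding f_def fx_def by (rule has_field_derivative_at_within)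
      next
        case False
        then have "v \<notin> cball 0 1" using KS by auto
        then show ?thesis by (simp add: f0)
      qed
    next
      fix s assume s: "s \<in> U"
      show "f s integrable_on cbox (- a) a"
        using ext(1)[OF fcont[OF s] f0(1)] by (intro integrable_continuous) (auto intro: continuous_on_subset)
    next
      have "continuous_on (U \<times> S \<union> U \<times> (- cball 0 1)) (\<lambda>(s, v). fx s v)"
      proof (rule continuous_on_open_Un)
        show "continuous_on (U \<times> S) (\<lambda>(s, v). fx s v)"
          unfolding fx_def split_beta
          by (intro continuous_intros cont_comp C2' continuous_on_compose2[OF continuous_on_hat[of UNIV]]) auto
        have "continuous_on (U \<times> (- cball 0 1 :: 'a set)) (\<lambda>_. 0 :: real)" by simp
        then show "continuous_on (U \<times> (- cball 0 1)) (\<lambda>(s, v). fx s v)"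
          by (rule continuous_on_eq) (auto simp: f0)
      qed (use U S in \<open>auto intro!: open_Times\<close>)
      moreover have "U \<times> cbox (- a) a \<subseteq> U \<times> S \<union> U \<times> (- cball 0 1)"
        using KS by auto
      ultimately show "continuous_on (U \<times> cbox (- a) a) (\<lambda>(s, v). fx s v)"
        by (rule continuous_on_subset)
    qed (fact s, fact U(2))
    then show ?thesis
      unfolding at_within_open[OF s U(1)] .
  qed
  have nonneg: "0 \<le> integral (cbox (- a) a) (fx s)" if s: "s \<in> U" "0 \<le> s" for s
  proof -
    have int: "integrable lborel (\<lambda>v. hat v * ((v \<bullet> e) * g1 e (z + s *\<^sub>R v)))"
      "integrable lborel (\<lambda>v. (hat v)\<^sup>2 / 4 * g2 e (z + s *\<^sub>R v))" if e: "e \<in> Basis" for e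
      by (rule ext(2); (intro continuous_intros cont_comp' C2' e s; simp)?; simp add: hat_eq_0)+
    have eq: "(\<integral>v. hat v * ((v \<bullet> e) * g1 e (z + s *\<^sub>R v)) \<partial>lborel) = s * (\<integral>v. (hat v)\<^sup>2 / 4 * g2 e (z + s *\<^sub>R v) \<partial>lborel)"
      (is "?l = s * ?r") if e: "e \<in> Basis" for e
    proof -
      \<comment> \<open>Integration by parts in the direction \<open>e\<close>: the derivative of
        \<open>(hat v)\<^sup>2 / 4\<close> is \<open>- hat v * (v \<bullet> e)\<close>, and the
        chain rule through \<open>z + s *\<^sub>R v\<close> gives the factor
        \<open>s\<close>.\<close>
      define F where "F v = (hat v)\<^sup>2 / 4 * g1 e (z + s *\<^sub>R v)" for v
      define D where "D v = s * ((hat v)\<^sup>2 / 4 * g2 e (z + s *\<^sub>R v)) - hat v * ((v \<bullet> e) * g1 e (z + s *\<^sub>R v))" for v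
      have FD0: "F v = 0" "D v = 0" if "v \<notin> cball 0 1" for v
        using hat_eq_0[OF that] by (auto simp: F_def D_def)
      have cont: "continuous_on S F" "continuous_on S D"
        unfolding F_def[abs_def] D_def[abs_def] by (intro continuous_intros cont_comp' C2' e s; simp)+
      have derS: "((\<lambda>t. F (v + t *\<^sub>R e)) has_real_derivative D v) (at 0)" if v: "v \<in> S" for v
      proof -
        have "((\<lambda>t. 1 - (norm (v + t *\<^sub>R e - 0))\<^sup>2) has_real_derivative 0 - 2 * ((v - 0) \<bullet> e)) (at 0)"
          by (intro DERIV_diff DERIV_const has_real_derivative_norm_square)
        then have "((\<lambda>t. 1 - (norm (v + t *\<^sub>R e))\<^sup>2) has_real_derivative - 2 * (v \<bullet> e)) (at 0)"
          by simp
        from DERIV_chain2[OF has_real_derivative_max_0_power[of 0] this]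
        have h: "((\<lambda>t. (hat (v + t *\<^sub>R e))\<^sup>2) has_real_derivative 2 * hat v * (- 2 * (v \<bullet> e))) (at 0)"
          by (simp add: hat_def numeral_2_eq_2)
        have "((\<lambda>t. s * t) has_real_derivative s) (at 0)"
          by (auto intro!: derivative_eq_intros)
        from DERIV_chain2[OF _ this, of "\<lambda>t. g1 e ((z + s *\<^sub>R v) + t *\<^sub>R e)" "g2 e (z + s *\<^sub>R v)"]
        have "((\<lambda>t. g1 e (z + s *\<^sub>R (v + t *\<^sub>R e))) has_real_derivative g2 e (z + s *\<^sub>R v) * s) (at 0)"
          using C2'(5)[OF e in_ball[OF s(1) v]] by (simp add: algebra_simps)
        from DERIV_mult[OF DERIV_cdivide[OF h, of 4] this] show ?thesis
          by (simp add: F_def D_def algebra_simps)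
      qed
      have der: "((\<lambda>t. F (v + t *\<^sub>R e)) has_real_derivative D v) (at 0)" for v
      proof -
        have F': "(\<lambda>v. if v \<in> S then F v else 0) = F" "(\<lambda>v. if v \<in> S then D v else 0) = D"
          using FD0 KS by (intro HOL.ext; metis subsetD)+
        show ?thesis
          using has_derivative_extend_0[OF S closed_cball KS _ derS, of v] FD0
          by (simp add: fun_cong[OF F'(1)] fun_cong[OF F'(2)])
      qed
      have "integral\<^sup>L lborel D = 0"
        by (rule integral_directional_derivative_eq_0[OF compact_cball FD0(1) FD0(2) ext(1)[OF cont(1) FD0(1)] ext(1)[OF cont(2) FD0(2)] der])
      moreover have "integral\<^sup>L lborel D = s * ?r - ?l"
        unfolding D_def[abs_def]
        by (subst Bochner_Integration.integral_diff) (use int[OF e] in \<open>auto simp del: times_divide_eq_left\<close>)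
      ultimately show ?thesis by linarith
    qed
    have "integral (cbox (- a) a) (fx s) = integral\<^sup>L lborel (fx s)"
      using cbox_lborel[OF fxcont[OF s(1)] f0(2)] .
    also have "\<dots> = (\<Sum>e\<in>Basis. \<integral>v. hat v * ((v \<bullet> e) * g1 e (z + s *\<^sub>R v)) \<partial>lborel)"
      unfolding fx_def sum_distrib_left by (rule Bochner_Integration.integral_sum) (rule int)
    also have "\<dots> = (\<Sum>e\<in>Basis. s * (\<integral>v. (hat v)\<^sup>2 / 4 * g2 e (z + s *\<^sub>R v) \<partial>lborel))"
      by (intro sum.cong refl eq)
    also have "\<dots> = s * (\<integral>v. (\<Sum>e\<in>Basis. (hat v)\<^sup>2 / 4 * g2 e (z + s *\<^sub>R v)) \<partial>lborel)"
      by (subst Bochner_Integration.integral_sum, erule int(2), simp only: sum_distrib_left)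
    also have "\<dots> \<ge> 0"
    proof (intro mult_nonneg_nonneg s(2) integral_nonneg_AE AE_I2)
      fix v
      show "0 \<le> (\<Sum>e\<in>Basis. (hat v)\<^sup>2 / 4 * g2 e (z + s *\<^sub>R v))"
      proof (cases "v \<in> cball 0 1")
        case True
        then show ?thesis
          unfolding sum_distrib_left[symmetric]
          using lap[OF in_ball[OF s(1)]] KS by (intro mult_nonneg_nonneg) auto
      qed (simp add: hat_eq_0)
    qed
    finally show ?thesis .
  qed
  have "integral (cbox (- a) a) (f 0) \<le> integral (cbox (- a) a) (f r)"
  proof (rule DERIV_nonneg_imp_nondecreasing[of 0 r "\<lambda>s. integral (cbox (- a) a) (f s)"])
    fix s assume "0 \<le> s" "s \<le> r"
    then show "\<exists>y. ((\<lambda>s. integral (cbox (- a) a) (f s)) has_real_derivative y) (at s) \<and> 0 \<le> y"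
      using deriv[of s] nonneg[of s] r r' by (auto simp: U_def)
  qed (use r in auto)
  moreover have "0 \<in> U" "r \<in> U" using r r' by (auto simp: U_def)
  ultimately have "integral\<^sup>L lborel (f 0) \<le> integral\<^sup>L lborel (f r)"
    using cbox_lborel[OF fcont f0(1), of 0] cbox_lborel[OF fcont f0(1), of r] by simp
  then show ?thesis
    by (simp add: f_def[abs_def] mult.commute)
qed

text \<open>Trades the sharp constant for an unweighted integral: \<open>hat\<close> is at most 1
  and vanishes off the unit ball, and \<open>g\<close> is nonnegative. The power of \<open>r\<close>
  is the Jacobian of \<open>x = z + r *\<^sub>R v\<close>.\<close>

lemma subharmonic_mean_value:
  fixes g :: "'a::euclidean_space \<Rightarrow> real"
  assumes r: "0 < r" "r < R"
    and der: "\<And>x. x \<in> ball z R \<Longrightarrow> (g has_derivative (\<lambda>h. \<Sum>e\<in>Basis. (h \<bullet> e) * g1 e x)) (at x)"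
    and C2: "dir_C2_on (ball z R) g g1 g2"
    and lap: "\<And>x. x \<in> ball z R \<Longrightarrow> 0 \<le> (\<Sum>e\<in>Basis. g2 e x)"
    and g0: "\<And>x. 0 \<le> g x"
  shows "ennreal (r ^ DIM('a) * (g z * (\<integral>v. hat v \<partial>(lborel :: 'a measure)))) \<le> (\<integral>\<^sup>+x\<in>ball z r. ennreal (g x) \<partial>lborel)"
proof -
  define f where "f x = indicator (ball z r) x * ennreal (g x)" for x
  have [measurable]: "f \<in> borel_measurable borel"
  proof -
    have "continuous_on (ball z r) g"
      using dir_C2_onD(1)[OF C2] r by (auto intro: continuous_on_subset)
    then have "(\<lambda>x. indicator (ball z r) x *\<^sub>R g x) \<in> borel_measurable borel"
      by (intro borel_measurable_continuous_on_indicator) auto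
    then have "(\<lambda>x. ennreal (indicator (ball z r) x *\<^sub>R g x)) \<in> borel_measurable borel"
      by measurable
    moreover have "(\<lambda>x. ennreal (indicator (ball z r) x *\<^sub>R g x)) = f"
      by (auto simp: f_def indicator_def)
    ultimately show ?thesis by simp
  qed
  have "(\<integral>\<^sup>+x. f x \<partial>lborel) = ennreal (r ^ DIM('a)) * (\<integral>\<^sup>+v. f (z + r *\<^sub>R v) \<partial>lborel)"
    using r by (subst lborel_affine[of r z]) (auto simp: nn_integral_density nn_integral_distr nn_integral_cmult)
  moreover have "ennreal (g z * (\<integral>v. hat v \<partial>(lborel :: 'a measure))) \<le> (\<integral>\<^sup>+v. f (z + r *\<^sub>R v) \<partial>lborel)"
  proof -
    have "ennreal (g z * (\<integral>v. hat v \<partial>(lborel :: 'a measure))) \<le> ennreal (\<integral>v. hat v * g (z + r *\<^sub>R v) \<partial>lborel)"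
      using hat_mean_mono[OF r der C2 lap] by (rule ennreal_leI)
    also have "\<dots> \<le> (\<integral>\<^sup>+v. ennreal (hat v * g (z + r *\<^sub>R v)) \<partial>lborel)"
    proof (cases "integrable lborel (\<lambda>v. hat v * g (z + r *\<^sub>R v))")
      case True
      then show ?thesis
        using g0 by (subst nn_integral_eq_integral) (auto intro!: AE_I2 mult_nonneg_nonneg hat_nonneg)
    qed (simp add: not_integrable_integral_eq)
    also have "\<dots> \<le> (\<integral>\<^sup>+v. f (z + r *\<^sub>R v) \<partial>lborel)"
    proof (rule nn_integral_mono)
      fix v
      show "ennreal (hat v * g (z + r *\<^sub>R v)) \<le> f (z + r *\<^sub>R v)"
      proof (cases "norm v < 1")
        case True
        then have "z + r *\<^sub>R v \<in> ball z r"
          using r by (simp add: dist_norm)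
        then show ?thesis
          using g0 hat_le_1[of v] hat_nonneg[of v] by (auto simp: f_def intro!: ennreal_leI mult_left_le_one_le)
      next
        case False
        then have "hat v = 0"
          by (simp add: hat_def not_less)
        then show ?thesis by simp
      qed
    qed
    finally show ?thesis .
  qed
  ultimately have "ennreal (r ^ DIM('a)) * ennreal (g z * (\<integral>v. hat v \<partial>(lborel :: 'a measure))) \<le> (\<integral>\<^sup>+x. f x \<partial>lborel)"
    by (simp add: mult_left_mono)
  then show ?thesis
    using r g0[of z] integral_hat_pos[where 'a='a] by (simp add: ennreal_mult f_def mult.commute)
qed

subsection \<open>A substitute for the Poisson kernel\<close>

text \<open>A \<open>C\<^sup>2\<close> convex cutoff vanishing on \<open>{..\<rho>}\<close> and of slope 1 on \<open>{2 * \<rho>..}\<close>: a cubic spline.\<close>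

definition cutoff :: "real \<Rightarrow> real \<Rightarrow> real"
  where "cutoff \<rho> t = 2 / (3 * \<rho>\<^sup>2) * (max 0 (t - \<rho>) ^ 3 - 2 * max 0 (t - 3/2 * \<rho>) ^ 3 + max 0 (t - 2 * \<rho>) ^ 3)"

definition cutoff1 :: "real \<Rightarrow> real \<Rightarrow> real"
  where "cutoff1 \<rho> t = 2 / \<rho>\<^sup>2 * (max 0 (t - \<rho>) ^ 2 - 2 * max 0 (t - 3/2 * \<rho>) ^ 2 + max 0 (t - 2 * \<rho>) ^ 2)"

definition cutoff2 :: "real \<Rightarrow> real \<Rightarrow> real"
  where "cutoff2 \<rho> t = 4 / \<rho>\<^sup>2 * (max 0 (t - \<rho>) - 2 * max 0 (t - 3/2 * \<rho>) + max 0 (t - 2 * \<rho>))"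

lemma DERIV_max_0_shift:
  "((\<lambda>t. max 0 (t - a) ^ 2) has_real_derivative 2 * max 0 (t - a)) (at t)"
  "((\<lambda>t. max 0 (t - a) ^ 3) has_real_derivative 3 * max 0 (t - a) ^ 2) (at t)"
proof -
  have "((\<lambda>t. t - a) has_real_derivative 1) (at t)"
    by (auto intro!: derivative_eq_intros)
  from DERIV_chain2[OF has_real_derivative_max_0_power[of 0] this]
    DERIV_chain2[OF has_real_derivative_max_0_power[of 1] this]
  show "((\<lambda>t. max 0 (t - a) ^ 2) has_real_derivative 2 * max 0 (t - a)) (at t)"
    "((\<lambda>t. max 0 (t - a) ^ 3) has_real_derivative 3 * max 0 (t - a) ^ 2) (at t)"
    by (simp_all add: numeral_2_eq_2 numeral_3_eq_3)
qed

lemma DERIV_cutoff: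
  "0 < \<rho> \<Longrightarrow> (cutoff \<rho> has_real_derivative cutoff1 \<rho> t) (at t)"
  "0 < \<rho> \<Longrightarrow> (cutoff1 \<rho> has_real_derivative cutoff2 \<rho> t) (at t)"
proof -
  assume \<rho>: "0 < \<rho>"
  have "((\<lambda>t. 2 / (3 * \<rho>\<^sup>2) * (max 0 (t - \<rho>) ^ 3 - 2 * max 0 (t - 3/2 * \<rho>) ^ 3 + max 0 (t - 2 * \<rho>) ^ 3))
    has_real_derivative 2 / (3 * \<rho>\<^sup>2) * (3 * max 0 (t - \<rho>) ^ 2 - 2 * (3 * max 0 (t - 3/2 * \<rho>) ^ 2) + 3 * max 0 (t - 2 * \<rho>) ^ 2)) (at t)"
    by (intro DERIV_cmult DERIV_add DERIV_diff DERIV_max_0_shift)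
  moreover have "2 / (3 * \<rho>\<^sup>2) * (3 * max 0 (t - \<rho>) ^ 2 - 2 * (3 * max 0 (t - 3/2 * \<rho>) ^ 2) + 3 * max 0 (t - 2 * \<rho>) ^ 2) = cutoff1 \<rho> t"
    using \<rho> by (simp add: cutoff1_def field_simps)
  ultimately show "(cutoff \<rho> has_real_derivative cutoff1 \<rho> t) (at t)"
    unfolding cutoff_def[abs_def] by simp
  have "((\<lambda>t. 2 / \<rho>\<^sup>2 * (max 0 (t - \<rho>) ^ 2 - 2 * max 0 (t - 3/2 * \<rho>) ^ 2 + max 0 (t - 2 * \<rho>) ^ 2))
    has_real_derivative 2 / \<rho>\<^sup>2 * (2 * max 0 (t - \<rho>) - 2 * (2 * max 0 (t - 3/2 * \<rho>)) + 2 * max 0 (t - 2 * \<rho>))) (at t)"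
    by (intro DERIV_cmult DERIV_add DERIV_diff DERIV_max_0_shift)
  moreover have "2 / \<rho>\<^sup>2 * (2 * max 0 (t - \<rho>) - 2 * (2 * max 0 (t - 3/2 * \<rho>)) + 2 * max 0 (t - 2 * \<rho>)) = cutoff2 \<rho> t"
    using \<rho> by (simp add: cutoff2_def field_simps)
  ultimately show "(cutoff1 \<rho> has_real_derivative cutoff2 \<rho> t) (at t)"
    unfolding cutoff1_def[abs_def] by simp
qed

lemma continuous_on_cutoffs [continuous_intros]:
  assumes "continuous_on S f"
  shows "continuous_on S (\<lambda>x. cutoff \<rho> (f x))" "continuous_on S (\<lambda>x. cutoff1 \<rho> (f x))" "continuous_on S (\<lambda>x. cutoff2 \<rho> (f x))"
  unfolding cutoff_def cutoff1_def cutoff2_def by (intro continuous_intros assms)+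

lemma cutoff_eq_0:
  assumes "0 < \<rho>" "t \<le> \<rho>"
  shows "cutoff \<rho> t = 0" "cutoff1 \<rho> t = 0" "cutoff2 \<rho> t = 0"
  using assms by (auto simp: cutoff_def cutoff1_def cutoff2_def max_def)

text \<open>The second derivative is the triangular bump on the interval from \<open>\<rho>\<close>
  to \<open>2 * \<rho>\<close>, with peak \<open>2 / \<rho>\<close> in the middle and integral 1. On
  the middle half it has at least half its peak value, which is the range in
  \<open>kshell\<close>.\<close>

lemma cutoff2_bounds:
  assumes \<rho>: "0 < \<rho>"
  shows "0 \<le> cutoff2 \<rho> t" "cutoff2 \<rho> t \<le> 2 / \<rho>" "2 * \<rho> \<le> t \<Longrightarrow> cutoff2 \<rho> t = 0"
    "5/4 * \<rho> \<le> t \<Longrightarrow> t \<le> 7/4 * \<rho> \<Longrightarrow> 1 / \<rho> \<le> cutoff2 \<rho> t"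
proof -
  define k where "k = max 0 (t - \<rho>) - 2 * max 0 (t - 3/2 * \<rho>) + max 0 (t - 2 * \<rho>)"
  have eq: "cutoff2 \<rho> t = 4 / \<rho>\<^sup>2 * k"
    by (simp add: cutoff2_def k_def)
  have k: "0 \<le> k" "k \<le> \<rho> / 2"
    using \<rho> by (auto simp: k_def max_def)
  show "0 \<le> cutoff2 \<rho> t"
    using k \<rho> by (simp add: eq)
  have "4 / \<rho>\<^sup>2 * k \<le> 4 / \<rho>\<^sup>2 * (\<rho> / 2)"
    using k \<rho> by (intro mult_left_mono) auto
  also have "\<dots> = 2 / \<rho>"
    using \<rho> by (simp add: power2_eq_square)
  finally show "cutoff2 \<rho> t \<le> 2 / \<rho>"
    by (simp add: eq)
  show "cutoff2 \<rho> t = 0" if "2 * \<rho> \<le> t"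
    using that \<rho> by (simp add: eq k_def max_def)
  show "1 / \<rho> \<le> cutoff2 \<rho> t" if "5/4 * \<rho> \<le> t" "t \<le> 7/4 * \<rho>"
  proof -
    have "1 / \<rho> = 4 / \<rho>\<^sup>2 * (\<rho> / 4)"
      using \<rho> by (simp add: power2_eq_square)
    also have "\<dots> \<le> 4 / \<rho>\<^sup>2 * k"
      using that \<rho> by (intro mult_left_mono) (auto simp: k_def max_def)
    finally show ?thesis
      by (simp add: eq)
  qed
qed

lemma cutoff1_eq_1:
  assumes "0 < \<rho>" "2 * \<rho> \<le> t"
  shows "cutoff1 \<rho> t = 1"
proof -
  have "max 0 (t - \<rho>) = t - \<rho>" "max 0 (t - 3/2 * \<rho>) = t - 3/2 * \<rho>" "max 0 (t - 2 * \<rho>) = t - 2 * \<rho>"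
    using assms by auto
  moreover have "(t - \<rho>) ^ 2 - 2 * (t - 3/2 * \<rho>) ^ 2 + (t - 2 * \<rho>) ^ 2 = \<rho>\<^sup>2 / 2"
    by (simp add: power2_eq_square algebra_simps)
  ultimately show ?thesis
    using assms by (simp add: cutoff1_def)
qed

lemma cutoff1_bounds:
  assumes \<rho>: "0 < \<rho>"
  shows "0 \<le> cutoff1 \<rho> t" "cutoff1 \<rho> t \<le> 1"
proof -
  have mono: "cutoff1 \<rho> s \<le> cutoff1 \<rho> t" if "s \<le> t" for s t
    using that by (rule DERIV_nonneg_imp_nondecreasing) (use DERIV_cutoff(2)[OF \<rho>] cutoff2_bounds(1)[OF \<rho>] in blast)
  show "0 \<le> cutoff1 \<rho> t"
    using mono[of "min t \<rho>" t] cutoff_eq_0(2)[OF \<rho>, of "min t \<rho>"] by simp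
  show "cutoff1 \<rho> t \<le> 1"
    using mono[of t "max t (2 * \<rho>)"] cutoff1_eq_1[OF \<rho>, of "max t (2 * \<rho>)"] by simp
qed

text \<open>Convexity together with the value 0 at the origin: the tangent at \<open>t\<close> meets
  the vertical axis at or below 0. In derivatives,
  \<open>t * cutoff1 \<rho> t - cutoff \<rho> t\<close> has slope
  \<open>t * cutoff2 \<rho> t\<close>.\<close>

lemma cutoff_le:
  assumes \<rho>: "0 < \<rho>" and t: "0 \<le> t"
  shows "cutoff \<rho> t \<le> t * cutoff1 \<rho> t" "0 \<le> cutoff \<rho> t"
proof -
  have "0 * cutoff1 \<rho> 0 - cutoff \<rho> 0 \<le> t * cutoff1 \<rho> t - cutoff \<rho> t"
  proof (rule DERIV_nonneg_imp_nondecreasing[OF t])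
    fix s :: real assume s: "0 \<le> s"
    have "((\<lambda>s. s * cutoff1 \<rho> s - cutoff \<rho> s) has_real_derivative s * cutoff2 \<rho> s) (at s)"
      by (auto intro!: derivative_eq_intros DERIV_cutoff[OF \<rho>])
    then show "\<exists>y. ((\<lambda>s. s * cutoff1 \<rho> s - cutoff \<rho> s) has_real_derivative y) (at s) \<and> 0 \<le> y"
      using s cutoff2_bounds(1)[OF \<rho>, of s] by (intro exI[of _ "s * cutoff2 \<rho> s"]) simp
  qed
  then show "cutoff \<rho> t \<le> t * cutoff1 \<rho> t"
    using cutoff_eq_0[OF \<rho>, of 0] \<rho> by simp
  have "cutoff \<rho> 0 \<le> cutoff \<rho> t"
    using t by (rule DERIV_nonneg_imp_nondecreasing) (use DERIV_cutoff(1)[OF \<rho>] cutoff1_bounds(1)[OF \<rho>] in blast)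
  then show "0 \<le> cutoff \<rho> t"
    using cutoff_eq_0[OF \<rho>, of 0] \<rho> by simp
qed

text \<open>
  The Laplacian of \<open>cutoff \<rho> (1 - |w|\<^sup>2) * |w - p|\<^sup>-\<^sup>2\<^sup>n\<close> is \<open>shell_density - core_density\<close>. For \<open>p\<close> just
  outside the ball this replaces the Poisson kernel: \<open>core_density\<close> is concentrated near \<open>p\<close> and
  \<open>shell_density\<close> lives near the sphere.
\<close>

definition shell_density :: "nat \<Rightarrow> 'a::euclidean_space \<Rightarrow> real \<Rightarrow> 'a \<Rightarrow> real"
  where "shell_density n p \<rho> w = 4 * (norm w)\<^sup>2 * cutoff2 \<rho> (1 - (norm w)\<^sup>2) * (1 / (norm (w - p))\<^sup>2) ^ n"

definition core_density :: "nat \<Rightarrow> 'a::euclidean_space \<Rightarrow> real \<Rightarrow> 'a \<Rightarrow> real"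
  where "core_density n p \<rho> w = 4 * real n *
    (cutoff1 \<rho> (1 - (norm w)\<^sup>2) * ((norm p)\<^sup>2 - (norm w)\<^sup>2) - cutoff \<rho> (1 - (norm w)\<^sup>2)) * (1 / (norm (w - p))\<^sup>2) ^ Suc n"

lemma DERIV_inverse_dist_power:
  fixes w p e :: "'a::euclidean_space"
  assumes "w \<noteq> p"
  shows "((\<lambda>t. (1 / (norm (w + t *\<^sub>R e - p))\<^sup>2) ^ m) has_real_derivative
    - 2 * real m * ((w - p) \<bullet> e) * (1 / (norm (w - p))\<^sup>2) ^ Suc m) (at 0)"
proof -
  define A where "A = (norm (w - p))\<^sup>2"
  have A: "A \<noteq> 0" using assms by (simp add: A_def)
  have "((\<lambda>x. (1 / x) ^ m) has_real_derivative - (real m * (1 / A) ^ Suc m)) (at A)"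
  proof (cases m)
    case (Suc k)
    have "((\<lambda>x. 1 / x) has_real_derivative - (1 / A * (1 / A))) (at A)"
      using A by (auto intro!: derivative_eq_intros simp: field_simps)
    from DERIV_power[OF this, of m] show ?thesis
      by (rule DERIV_cong) (simp add: Suc)
  qed simp
  then have "((\<lambda>x. (1 / x) ^ m) has_real_derivative - (real m * (1 / A) ^ Suc m)) (at ((norm (w + 0 *\<^sub>R e - p))\<^sup>2))"
    by (simp add: A_def)
  from DERIV_chain2[OF this has_real_derivative_norm_square[of w e p]] show ?thesis
    by (simp add: A_def mult_ac)
qed

text \<open>With \<open>1 - |w|\<^sup>2\<close> in place of its cutoff and \<open>p\<close> on the
  sphere, \<open>\<psi>\<close> would be a Poisson kernel in real dimension \<open>2 * n\<close> up
  to a factor, hence harmonic. The cutoff confines the support to the interior at the price of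
  \<open>shell_density\<close>; the pole outside keeps \<open>\<psi>\<close> regular at the price of
  \<open>core_density\<close>.\<close>

lemma test_function:
  fixes p :: "'a::euclidean_space"
  assumes n: "DIM('a) = 2 * n" and p: "1 < norm p" and \<rho>: "0 < \<rho>"
  defines "\<psi> \<equiv> \<lambda>w. cutoff \<rho> (1 - (norm w)\<^sup>2) * (1 / (norm (w - p))\<^sup>2) ^ n"
  obtains \<psi>1 \<psi>2 where "dir_C2_on (ball 0 1) \<psi> \<psi>1 \<psi>2"
    "\<And>w. w \<in> ball 0 1 \<Longrightarrow> (\<Sum>e\<in>Basis. \<psi>2 e w) = shell_density n p \<rho> w - core_density n p \<rho> w"
    "\<And>w e. 1 - (norm w)\<^sup>2 < \<rho> \<Longrightarrow> \<psi>1 e w = 0" "\<And>w e. 1 - (norm w)\<^sup>2 < \<rho> \<Longrightarrow> \<psi>2 e w = 0"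
proof -
  define T where "T w = 1 - (norm w)\<^sup>2" for w :: 'a
  define I where "I w = 1 / (norm (w - p))\<^sup>2" for w
  define \<psi>1 where "\<psi>1 e w = cutoff1 \<rho> (T w) * (- 2 * (w \<bullet> e)) * I w ^ n
      + cutoff \<rho> (T w) * (- 2 * real n * ((w - p) \<bullet> e) * I w ^ Suc n)" for e w
  define \<psi>2 where "\<psi>2 e w = cutoff2 \<rho> (T w) * (4 * (w \<bullet> e)\<^sup>2) * I w ^ n - 2 * cutoff1 \<rho> (T w) * I w ^ n
      + 8 * real n * cutoff1 \<rho> (T w) * ((w \<bullet> e) * ((w - p) \<bullet> e)) * I w ^ Suc n
      + cutoff \<rho> (T w) * (- 2 * real n * I w ^ Suc n + 4 * real n * real (Suc n) * ((w - p) \<bullet> e)\<^sup>2 * I w ^ Suc (Suc n))" for e w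
  have ne: "w \<noteq> p" if "w \<in> ball 0 1" for w
    using that p by auto
  have contI: "continuous_on (ball 0 1) I"
    unfolding I_def[abs_def] using ne by (intro continuous_intros) auto
  have contT: "continuous_on (ball 0 1) T"
    unfolding T_def[abs_def] by (intro continuous_intros)
  have \<psi>: "\<psi> w = cutoff \<rho> (T w) * I w ^ n" for w
    by (simp add: \<psi>_def T_def I_def)
  have "dir_C2_on (ball 0 1) \<psi> \<psi>1 \<psi>2"
    unfolding dir_C2_on_def
  proof (intro conjI ballI)
    show "continuous_on (ball 0 1) \<psi>"
      unfolding \<psi> by (intro continuous_intros contI contT)
    fix e :: 'a assume e: "e \<in> Basis"
    show "continuous_on (ball 0 1) (\<psi>1 e)" "continuous_on (ball 0 1) (\<psi>2 e)"
      unfolding \<psi>1_def[abs_def] \<psi>2_def[abs_def] by (intro continuous_intros contI contT)+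
    fix w :: 'a assume w: "w \<in> ball 0 1"
    have dT: "((\<lambda>t. T (w + t *\<^sub>R e)) has_real_derivative - 2 * (w \<bullet> e)) (at 0)"
      using DERIV_diff[OF DERIV_const has_real_derivative_norm_square[of w e 0], of 1] by (simp add: T_def)
    have dc: "((\<lambda>t. cutoff \<rho> (T (w + t *\<^sub>R e))) has_real_derivative cutoff1 \<rho> (T w) * (- 2 * (w \<bullet> e))) (at 0)"
      using DERIV_chain2[OF DERIV_cutoff(1)[OF \<rho>] dT] by simp
    have dc1: "((\<lambda>t. cutoff1 \<rho> (T (w + t *\<^sub>R e))) has_real_derivative cutoff2 \<rho> (T w) * (- 2 * (w \<bullet> e))) (at 0)"
      using DERIV_chain2[OF DERIV_cutoff(2)[OF \<rho>] dT] by simp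
    have dI: "((\<lambda>t. I (w + t *\<^sub>R e) ^ m) has_real_derivative - 2 * real m * ((w - p) \<bullet> e) * I w ^ Suc m) (at 0)" for m
      unfolding I_def by (rule DERIV_inverse_dist_power[OF ne[OF w]])
    have ee: "e \<bullet> e = 1"
      using e by simp
    have dl: "((\<lambda>t. (w + t *\<^sub>R e - q) \<bullet> e) has_real_derivative 1) (at 0)" for q
      by (auto intro!: derivative_eq_intros simp: inner_add_left inner_diff_left ee)
    have dl0: "((\<lambda>t. (w + t *\<^sub>R e) \<bullet> e) has_real_derivative 1) (at 0)"
      using dl[of 0] by simp
    show "((\<lambda>t. \<psi> (w + t *\<^sub>R e)) has_real_derivative \<psi>1 e w) (at 0)"
      unfolding \<psi> using DERIV_mult[OF dc dI[of n]] by (simp add: \<psi>1_def algebra_simps)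
    have "((\<lambda>t. \<psi>1 e (w + t *\<^sub>R e)) has_real_derivative
        ((cutoff2 \<rho> (T w) * (- 2 * (w \<bullet> e)) * (- 2 * ((w + 0 *\<^sub>R e) \<bullet> e)) + - 2 * 1 * cutoff1 \<rho> (T (w + 0 *\<^sub>R e))) * I (w + 0 *\<^sub>R e) ^ n
          + (- 2 * real n * ((w - p) \<bullet> e) * I w ^ Suc n) * (cutoff1 \<rho> (T (w + 0 *\<^sub>R e)) * (- 2 * ((w + 0 *\<^sub>R e) \<bullet> e))))
        + (cutoff1 \<rho> (T w) * (- 2 * (w \<bullet> e)) * (- 2 * real n * ((w + 0 *\<^sub>R e - p) \<bullet> e) * I (w + 0 *\<^sub>R e) ^ Suc n)
          + (- 2 * real n * 1 * I (w + 0 *\<^sub>R e) ^ Suc n + (- 2 * real (Suc n) * ((w - p) \<bullet> e) * I w ^ Suc (Suc n)) * (- 2 * real n * ((w + 0 *\<^sub>R e - p) \<bullet> e))) * cutoff \<rho> (T (w + 0 *\<^sub>R e)))) (at 0)"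
      unfolding \<psi>1_def by (intro DERIV_add DERIV_mult DERIV_cmult dc dc1 dI dl dl0)
    then show "((\<lambda>t. \<psi>1 e (w + t *\<^sub>R e)) has_real_derivative \<psi>2 e w) (at 0)"
      by (rule DERIV_cong) (simp add: \<psi>2_def power2_eq_square algebra_simps)
  qed
  moreover have "(\<Sum>e\<in>Basis. \<psi>2 e w) = shell_density n p \<rho> w - core_density n p \<rho> w" if w: "w \<in> ball 0 1" for w
  proof -
    define A where "A = (norm (w - p))\<^sup>2"
    have A: "A \<noteq> 0" using ne[OF w] by (simp add: A_def)
    have IA: "I w = 1 / A" by (simp add: I_def A_def)
    have s1: "(\<Sum>e\<in>Basis. (v \<bullet> e)\<^sup>2) = (norm v)\<^sup>2" for v :: 'a
    proof -
      have "(\<Sum>e\<in>Basis. (v \<bullet> e)\<^sup>2) = v \<bullet> v"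
        by (subst euclidean_inner[of v v]) (simp add: power2_eq_square)
      then show ?thesis
        by (simp add: power2_norm_eq_inner)
    qed
    have s2: "(\<Sum>e\<in>Basis. (w \<bullet> e) * ((w - p) \<bullet> e)) = ((norm w)\<^sup>2 + A - (norm p)\<^sup>2) / 2"
    proof -
      have "(\<Sum>e\<in>Basis. (w \<bullet> e) * ((w - p) \<bullet> e)) = w \<bullet> (w - p)"
        by (rule euclidean_inner[symmetric])
      also have "\<dots> = ((norm w)\<^sup>2 + A - (norm p)\<^sup>2) / 2"
        by (simp add: A_def power2_norm_eq_inner inner_diff_left inner_diff_right inner_commute)
      finally show ?thesis .
    qed
    have "(\<Sum>e\<in>Basis. \<psi>2 e w) = cutoff2 \<rho> (T w) * (4 * (\<Sum>e\<in>Basis. (w \<bullet> e)\<^sup>2)) * I w ^ n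
        - real (DIM('a)) * (2 * cutoff1 \<rho> (T w) * I w ^ n)
        + 8 * real n * cutoff1 \<rho> (T w) * (\<Sum>e\<in>Basis. (w \<bullet> e) * ((w - p) \<bullet> e)) * I w ^ Suc n
        + cutoff \<rho> (T w) * (real (DIM('a)) * (- 2 * real n * I w ^ Suc n)
          + 4 * real n * real (Suc n) * (\<Sum>e\<in>Basis. ((w - p) \<bullet> e)\<^sup>2) * I w ^ Suc (Suc n))"
      unfolding \<psi>2_def
      by (simp only: sum.distrib sum_subtractf sum_distrib_left sum_distrib_right sum_constant distrib_left mult.assoc)
        (simp add: sum_distrib_left sum_distrib_right mult_ac)
    also have "\<dots> = cutoff2 \<rho> (T w) * (4 * (norm w)\<^sup>2) * (1 / A) ^ n
        - 2 * real n * (2 * cutoff1 \<rho> (T w) * (1 / A) ^ n)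
        + 8 * real n * cutoff1 \<rho> (T w) * (((norm w)\<^sup>2 + A - (norm p)\<^sup>2) / 2) * (1 / A) ^ Suc n
        + cutoff \<rho> (T w) * (2 * real n * (- 2 * real n * (1 / A) ^ Suc n)
          + 4 * real n * real (Suc n) * A * (1 / A) ^ Suc (Suc n))"
      unfolding s1 s2 IA A_def[symmetric] n by simp
    \<comment> \<open>In dimension \<open>2 * n\<close> the terms
      \<open>cutoff1 * (1 / A) ^ n\<close> cancel, and in front of \<open>cutoff\<close> there
      remains \<open>- 4 * n\<^sup>2 + 4 * n * (n + 1) = 4 * n\<close>.\<close>
    also have "\<dots> = 4 * (norm w)\<^sup>2 * cutoff2 \<rho> (T w) * (1 / A) ^ n - 4 * real n *
        (cutoff1 \<rho> (T w) * ((norm p)\<^sup>2 - (norm w)\<^sup>2) - cutoff \<rho> (T w)) * (1 / A) ^ Suc n"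
      using A by (simp add: field_simps)
    finally show ?thesis
      by (simp add: shell_density_def core_density_def T_def A_def)
  qed
  moreover have "\<psi>1 e w = 0" "\<psi>2 e w = 0" if "1 - (norm w)\<^sup>2 < \<rho>" for w e
    using cutoff_eq_0[OF \<rho>, of "T w"] that by (auto simp: \<psi>1_def \<psi>2_def T_def)
  ultimately show ?thesis
    using that by blast
qed

lemma continuous_on_densities:
  fixes p :: "'a::euclidean_space"
  assumes "1 < norm p"
  shows "continuous_on (ball 0 1) (shell_density n p \<rho>)" "continuous_on (ball 0 1) (core_density n p \<rho>)"
  unfolding shell_density_def[abs_def] core_density_def[abs_def] using assms
  by (intro continuous_intros; force)+

lemma densities_eq_0:
  assumes "0 < \<rho>" "1 - (norm w)\<^sup>2 < \<rho>"
  shows "shell_density n p \<rho> w = 0" "core_density n p \<rho> w = 0"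
  using cutoff_eq_0[of \<rho> "1 - (norm w)\<^sup>2"] assms by (auto simp: shell_density_def core_density_def)

lemma shell_density_nonneg: "0 < \<rho> \<Longrightarrow> 0 \<le> shell_density n p \<rho> w"
  by (simp add: shell_density_def cutoff2_bounds)

text \<open>The subtracted cutoff is absorbed by \<open>cutoff_le\<close>; what remains is
  \<open>(norm p)\<^sup>2 - 1\<close>, positive because the pole lies outside. This yields both the
  sign of the core and its size near the point of interest.\<close>

lemma core_density_ge:
  assumes "0 < \<rho>" "norm w < 1"
  shows "4 * real n * (cutoff1 \<rho> (1 - (norm w)\<^sup>2) * ((norm p)\<^sup>2 - 1)) * (1 / (norm (w - p))\<^sup>2) ^ Suc n \<le> core_density n p \<rho> w"
proof -
  define T where "T = 1 - (norm w)\<^sup>2"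
  have "0 \<le> T"
    using assms by (simp add: T_def abs_square_le_1)
  then have "cutoff \<rho> T \<le> T * cutoff1 \<rho> T"
    using cutoff_le assms by blast
  then have "cutoff1 \<rho> T * ((norm p)\<^sup>2 - 1) \<le> cutoff1 \<rho> T * ((norm p)\<^sup>2 - (norm w)\<^sup>2) - cutoff \<rho> T"
    by (simp add: T_def algebra_simps)
  then show ?thesis
    unfolding core_density_def T_def[symmetric] by (intro mult_right_mono mult_left_mono) auto
qed

lemma core_density_nonneg:
  assumes "0 < \<rho>" "norm w < 1" "1 < norm p"
  shows "0 \<le> core_density n p \<rho> w"
proof -
  have "0 \<le> (norm p)\<^sup>2 - 1"
    using assms(3) by simp
  then have "0 \<le> 4 * real n * (cutoff1 \<rho> (1 - (norm w)\<^sup>2) * ((norm p)\<^sup>2 - 1)) * (1 / (norm (w - p))\<^sup>2) ^ Suc n"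
    using cutoff1_bounds(1)[OF assms(1)] by (intro mult_nonneg_nonneg) auto
  then show ?thesis
    using core_density_ge[OF assms(1,2)] by (rule order_trans)
qed

lemma core_density_le:
  assumes \<rho>: "0 < \<rho>" and w: "norm w < 1" and p: "1 < norm p"
  shows "core_density n p \<rho> w \<le> 4 * real n * ((norm p)\<^sup>2 - (norm w)\<^sup>2) * (1 / (norm (w - p))\<^sup>2) ^ Suc n"
proof -
  define T where "T = 1 - (norm w)\<^sup>2"
  have T: "0 \<le> T"
    using w by (simp add: T_def abs_square_le_1)
  have "(norm w)\<^sup>2 \<le> (norm p)\<^sup>2"
    using w p by (intro power_mono) auto
  then have "cutoff1 \<rho> T * ((norm p)\<^sup>2 - (norm w)\<^sup>2) \<le> 1 * ((norm p)\<^sup>2 - (norm w)\<^sup>2)"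
    using cutoff1_bounds(2)[OF \<rho>] by (intro mult_right_mono) auto
  then have "cutoff1 \<rho> T * ((norm p)\<^sup>2 - (norm w)\<^sup>2) - cutoff \<rho> T \<le> (norm p)\<^sup>2 - (norm w)\<^sup>2"
    using cutoff_le(2)[OF \<rho> T] by (simp del: mult_le_cancel_right1 mult_le_cancel_right2 mult_left_le_one_le)
  then show ?thesis
    unfolding core_density_def T_def[symmetric] by (intro mult_right_mono mult_left_mono) auto
qed

text \<open>Green's identity with the nonnegative \<open>\<psi>\<close> of
  \<open>test_function\<close>. For subharmonic \<open>g\<close> it transfers a bound from the shell
  to the core; for harmonic \<open>g\<close> it is an equality, which with \<open>g = 1\<close> will
  give the mass of the shell from that of the core.\<close>

lemma integral_core_shell:
  fixes p :: "'a::euclidean_space"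
  assumes n: "DIM('a) = 2 * n" and p: "1 < norm p" and \<rho>: "0 < \<rho>"
    and g: "dir_C2_on (ball 0 1) g g1 g2" and g0: "\<And>x. 0 \<le> g x"
  shows "(\<And>x. x \<in> ball 0 1 \<Longrightarrow> 0 \<le> (\<Sum>e\<in>Basis. g2 e x)) \<Longrightarrow>
      (\<integral>\<^sup>+w\<in>ball 0 1. ennreal (g w * core_density n p \<rho> w) \<partial>lborel) \<le> (\<integral>\<^sup>+w\<in>ball 0 1. ennreal (g w * shell_density n p \<rho> w) \<partial>lborel)"
    and "(\<And>x. x \<in> ball 0 1 \<Longrightarrow> (\<Sum>e\<in>Basis. g2 e x) = 0) \<Longrightarrow>
      (\<integral>\<^sup>+w\<in>ball 0 1. ennreal (g w * core_density n p \<rho> w) \<partial>lborel) = (\<integral>\<^sup>+w\<in>ball 0 1. ennreal (g w * shell_density n p \<rho> w) \<partial>lborel)"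
proof -
  define B where "B = ball (0::'a) 1"
  define \<psi> where "\<psi> w = cutoff \<rho> (1 - (norm w)\<^sup>2) * (1 / (norm (w - p))\<^sup>2) ^ n" for w
  obtain \<psi>1 \<psi>2 where \<psi>: "dir_C2_on B \<psi> \<psi>1 \<psi>2"
    and lap: "\<And>w. w \<in> B \<Longrightarrow> (\<Sum>e\<in>Basis. \<psi>2 e w) = shell_density n p \<rho> w - core_density n p \<rho> w"
    and \<psi>0: "\<And>w e. 1 - (norm w)\<^sup>2 < \<rho> \<Longrightarrow> \<psi>1 e w = 0" "\<And>w e. 1 - (norm w)\<^sup>2 < \<rho> \<Longrightarrow> \<psi>2 e w = 0"
    unfolding B_def \<psi>_def[abs_def] by (rule test_function[OF n p \<rho>]) blast
  define K where "K = {w :: 'a. \<rho> \<le> 1 - (norm w)\<^sup>2}"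
  have K: "compact K" "K \<subseteq> B"
  proof -
    have "norm w < 1" if "w \<in> K" for w
    proof -
      have "(norm w)\<^sup>2 < 1\<^sup>2"
        using that \<rho> by (simp add: K_def)
      then show ?thesis
        by (rule power_less_imp_less_base) simp
    qed
    then show "K \<subseteq> B" by (auto simp: B_def)
    then have "bounded K"
      using bounded_subset[of B] by (auto simp: B_def)
    moreover have "closed K"
      unfolding K_def by (intro closed_Collect_le continuous_intros)
    ultimately show "compact K"
      by (simp add: compact_eq_bounded_closed)
  qed
  have notK: "1 - (norm w)\<^sup>2 < \<rho>" if "w \<notin> K" for w
    using that by (simp add: K_def not_le)
  have B: "open B" by (simp add: B_def)
  have int: "integrable lborel (\<lambda>x. if x \<in> B then F x else 0)"
    if "continuous_on B F" "\<And>x. x \<in> B \<Longrightarrow> x \<notin> K \<Longrightarrow> F x = 0" for F :: "'a \<Rightarrow> real"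
  proof (rule integrable_compact_support[OF K(1)])
    show "continuous_on K (\<lambda>x. if x \<in> B then F x else 0)"
      using continuous_on_extend_0[OF B compact_imp_closed[OF K(1)] K(2) that] by (rule continuous_on_subset) auto
  qed (use that(2) in auto)
  have contg: "continuous_on B g"
    using dir_C2_onD(1)[OF g] by (simp add: B_def)
  define Fs where "Fs w = g w * shell_density n p \<rho> w" for w
  define Fc where "Fc w = g w * core_density n p \<rho> w" for w
  have Fs: "integrable lborel (\<lambda>x. if x \<in> B then Fs x else 0)"
    using densities_eq_0[OF \<rho> notK]
    by (intro int) (auto simp: Fs_def[abs_def] B_def[symmetric] intro!: continuous_intros contg continuous_on_densities(1)[OF p, folded B_def])
  have Fc: "integrable lborel (\<lambda>x. if x \<in> B then Fc x else 0)"
    using densities_eq_0[OF \<rho> notK]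
    by (intro int) (auto simp: Fc_def[abs_def] B_def[symmetric] intro!: continuous_intros contg continuous_on_densities(2)[OF p, folded B_def])
  have nn: "(\<integral>\<^sup>+w\<in>B. ennreal (F w) \<partial>lborel) = ennreal (\<integral>w. (if w \<in> B then F w else 0) \<partial>lborel)"
    if "integrable lborel (\<lambda>w. if w \<in> B then F w else 0)" "\<And>w. w \<in> B \<Longrightarrow> 0 \<le> F w" for F :: "'a \<Rightarrow> real"
    using that by (subst nn_integral_eq_integral[symmetric]) (auto intro!: nn_integral_cong simp: indicator_def)
  have nnFs: "(\<integral>\<^sup>+w\<in>B. ennreal (Fs w) \<partial>lborel) = ennreal (\<integral>w. (if w \<in> B then Fs w else 0) \<partial>lborel)"
    using Fs by (intro nn) (auto simp: Fs_def g0 shell_density_nonneg \<rho>)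
  have nnFc: "(\<integral>\<^sup>+w\<in>B. ennreal (Fc w) \<partial>lborel) = ennreal (\<integral>w. (if w \<in> B then Fc w else 0) \<partial>lborel)"
    using Fc p by (intro nn) (auto simp: Fc_def B_def g0 core_density_nonneg \<rho>)
  have "(\<integral>w. (if w \<in> B then Fs w else 0) \<partial>lborel) - (\<integral>w. (if w \<in> B then Fc w else 0) \<partial>lborel)
      = (\<integral>w. (if w \<in> B then g w * (\<Sum>e\<in>Basis. \<psi>2 e w) else 0) \<partial>lborel)"
    unfolding Bochner_Integration.integral_diff[OF Fs Fc, symmetric]
    by (intro Bochner_Integration.integral_cong) (auto simp: lap Fs_def Fc_def algebra_simps)
  also have "\<dots> = (\<integral>w. (if w \<in> B then \<psi> w * (\<Sum>e\<in>Basis. g2 e w) else 0) \<partial>lborel)"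
  proof (rule green_identity[OF B K g[folded B_def] \<psi>])
    show "\<psi> x = 0" if "x \<notin> K" for x
      using cutoff_eq_0(1)[OF \<rho>] notK[OF that] by (simp add: \<psi>_def)
    show "\<psi>1 e x = 0" "\<psi>2 e x = 0" if "x \<notin> K" for x e
      using \<psi>0 notK[OF that] by auto
  qed
  finally have eq: "(\<integral>w. (if w \<in> B then Fs w else 0) \<partial>lborel) - (\<integral>w. (if w \<in> B then Fc w else 0) \<partial>lborel)
      = (\<integral>w. (if w \<in> B then \<psi> w * (\<Sum>e\<in>Basis. g2 e w) else 0) \<partial>lborel)" .
  have \<psi>_nonneg: "0 \<le> \<psi> w" if "w \<in> B" for w
    using that cutoff_le(2)[OF \<rho>, of "1 - (norm w)\<^sup>2"] by (simp add: \<psi>_def B_def abs_square_le_1)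
  show "(\<integral>\<^sup>+w\<in>ball 0 1. ennreal (g w * core_density n p \<rho> w) \<partial>lborel) \<le> (\<integral>\<^sup>+w\<in>ball 0 1. ennreal (g w * shell_density n p \<rho> w) \<partial>lborel)"
    if "\<And>x. x \<in> ball 0 1 \<Longrightarrow> 0 \<le> (\<Sum>e\<in>Basis. g2 e x)"
  proof -
    have "0 \<le> (\<integral>w. (if w \<in> B then \<psi> w * (\<Sum>e\<in>Basis. g2 e w) else 0) \<partial>lborel)"
      using that \<psi>_nonneg by (intro integral_nonneg_AE AE_I2) (auto simp: B_def)
    then show ?thesis
      using nnFs nnFc eq by (simp add: Fs_def Fc_def B_def ennreal_leI)
  qed
  show "(\<integral>\<^sup>+w\<in>ball 0 1. ennreal (g w * core_density n p \<rho> w) \<partial>lborel) = (\<integral>\<^sup>+w\<in>ball 0 1. ennreal (g w * shell_density n p \<rho> w) \<partial>lborel)"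
    if "\<And>x. x \<in> ball 0 1 \<Longrightarrow> (\<Sum>e\<in>Basis. g2 e x) = 0"
  proof -
    have "(\<integral>w. (if w \<in> B then \<psi> w * (\<Sum>e\<in>Basis. g2 e w) else 0) \<partial>lborel) = (\<integral>w. 0 \<partial>(lborel :: 'a measure))"
      using that by (intro Bochner_Integration.integral_cong) (auto simp: B_def)
    then show ?thesis
      using nnFs nnFc eq by (simp add: Fs_def Fc_def B_def)
  qed
qed

subsection \<open>Growth of harmonic functions of bounded mean oscillation\<close>

text \<open>Off the centre, tents are Koranyi balls about boundary points with radius equal to the
  height, so the volume estimates apply to them.\<close>

lemma carleson_tent_eq_kball:
  assumes "norm \<zeta> = 1" "0 < \<delta>" "\<delta> < 1"
  shows "carleson_tent ((1 - \<delta>) *\<^sub>R \<zeta>) = kball \<zeta> \<delta>"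
proof -
  have nz: "norm ((1 - \<delta>) *\<^sub>R \<zeta>) = 1 - \<delta>" and z0: "(1 - \<delta>) *\<^sub>R \<zeta> \<noteq> 0"
    using assms by auto
  have "hermitian_inner ((1 - \<delta>) *\<^sub>R \<zeta>) w / of_real (1 - \<delta>) = hermitian_inner \<zeta> w" for w
    using assms by (simp add: hermitian_inner_scaleR_left flip: of_real_diff)
  then show ?thesis
    using assms(1) z0 unfolding carleson_tent_def nz by (auto simp: kball_def hdist_def)
qed

lemma nn_integral_cmod_diff_le:
  fixes b :: "'a::euclidean_space \<Rightarrow> complex"
  assumes [measurable]: "b \<in> borel_measurable borel" "A \<in> sets borel"
  shows "(\<integral>\<^sup>+w\<in>A. ennreal (cmod (b w - c)) \<partial>lborel)
    \<le> (\<integral>\<^sup>+w\<in>A. ennreal (cmod (b w - m)) \<partial>lborel) + ennreal (cmod (m - c)) * emeasure lborel A"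
proof -
  have "(\<integral>\<^sup>+w\<in>A. ennreal (cmod (b w - c)) \<partial>lborel)
      \<le> (\<integral>\<^sup>+w. ennreal (cmod (b w - m)) * indicator A w + ennreal (cmod (m - c)) * indicator A w \<partial>lborel)"
  proof (rule nn_integral_mono)
    fix w
    have "ennreal (cmod (b w - c)) \<le> ennreal (cmod (b w - m)) + ennreal (cmod (m - c))"
      using norm_triangle_ineq[of "b w - m" "m - c"] by (simp flip: ennreal_plus)
    then show "ennreal (cmod (b w - c)) * indicator A w
        \<le> ennreal (cmod (b w - m)) * indicator A w + ennreal (cmod (m - c)) * indicator A w"
      by (simp add: indicator_def)
  qed
  also have "\<dots> = (\<integral>\<^sup>+w\<in>A. ennreal (cmod (b w - m)) \<partial>lborel) + ennreal (cmod (m - c)) * emeasure lborel A"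
    by (subst nn_integral_add) (auto simp: nn_integral_cmult_indicator)
  finally show ?thesis .
qed

text \<open>The means over the tents of heights \<open>2\<^sup>-\<^sup>k\<close> at \<open>\<zeta>\<close> change by a bounded amount in each step.\<close>

lemma nn_integral_tent_le:
  "\<exists>C>0. \<forall>(b :: complex ^ 'n \<Rightarrow> complex) c M \<zeta> r. b \<in> borel_measurable borel \<longrightarrow> 0 < M \<longrightarrow>
     (\<integral>\<^sup>+w\<in>ball 0 1. ennreal (cmod (b w - c)) \<partial>lborel) \<le> ennreal M * emeasure lborel (ball (0 :: complex ^ 'n) 1) \<longrightarrow>
     (\<forall>\<zeta> \<delta>. norm \<zeta> = 1 \<longrightarrow> 0 < \<delta> \<longrightarrow> \<delta> < 1 \<longrightarrow>
        (\<exists>m. (\<integral>\<^sup>+w\<in>kball \<zeta> \<delta>. ennreal (cmod (b w - m)) \<partial>lborel) \<le> ennreal M * emeasure lborel (kball \<zeta> \<delta>))) \<longrightarrow>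
     norm \<zeta> = 1 \<longrightarrow> 0 < r \<longrightarrow> r < 1 \<longrightarrow>
     (\<integral>\<^sup>+w\<in>kball \<zeta> r. ennreal (cmod (b w - c)) \<partial>lborel) \<le> ennreal (C * M * (r ^ (CARD('n) + 1) * (1 + ln (1 / r))))"
proof -
  define N where "N = CARD('n) + 1"
  obtain C1 where C1: "0 < C1" and C1': "\<forall>(z :: complex ^ 'n) r. norm z \<le> 1 \<longrightarrow> 0 < r \<longrightarrow>
     emeasure lborel (kball z r) \<le> ennreal (C1 * r ^ N)"
    unfolding N_def using emeasure_kball_le by blast
  obtain C2 where C2: "0 < C2" and C2': "\<forall>(w :: complex ^ 'n) \<rho>. norm w \<le> 1 \<longrightarrow> 0 < \<rho> \<longrightarrow> \<rho> \<le> 1/2 \<longrightarrow> 1 - norm w \<le> 4 * \<rho> \<longrightarrow>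
     ennreal (C2 * \<rho> ^ N) \<le> emeasure lborel (kshell w \<rho>)"
    unfolding N_def using emeasure_kshell_ge by blast
  define D where "D = C1 * 2 ^ N"
  define K where "K = 2 * D * 12 ^ N / C2"
  have pos: "0 < D" "0 < K" using C1 C2 by (auto simp: D_def K_def)
  show ?thesis
    unfolding N_def[symmetric]
  proof (intro exI[of _ "D * 2 ^ N * (1 + 2 * K)"] conjI allI impI)
    fix b :: "complex ^ 'n \<Rightarrow> complex" and c and M r :: real and \<zeta> :: "complex ^ 'n"
    assume b [measurable]: "b \<in> borel_measurable borel" and M: "0 < M"
      and H0: "(\<integral>\<^sup>+w\<in>ball 0 1. ennreal (cmod (b w - c)) \<partial>lborel) \<le> ennreal M * emeasure lborel (ball (0 :: complex ^ 'n) 1)"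
      and H: "\<forall>\<zeta> \<delta>. norm \<zeta> = 1 \<longrightarrow> 0 < \<delta> \<longrightarrow> \<delta> < 1 \<longrightarrow>
        (\<exists>m. (\<integral>\<^sup>+w\<in>kball \<zeta> \<delta>. ennreal (cmod (b w - m)) \<partial>lborel) \<le> ennreal M * emeasure lborel (kball \<zeta> \<delta>))"
      and \<zeta>: "norm \<zeta> = 1" and r: "0 < r" "r < 1"
    \<comment> \<open>The tent belonging to \<open>z = 0\<close> is the whole ball, where the mean
      is \<open>c\<close>. It starts the chain in place of \<open>kball \<zeta> 1\<close>.\<close>
    define T where "T k = (if k = 0 then ball 0 1 else kball \<zeta> ((1/2) ^ k))" for k :: nat
    have T [measurable]: "T k \<in> sets borel" for k
      by (simp add: T_def)
    have T_le: "emeasure lborel (T k) \<le> ennreal (D * ((1/2) ^ k) ^ N)" for k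
    proof (cases "k = 0")
      case True
      then show ?thesis
        using C1'[rule_format, of 0 2] by (simp add: T_def D_def kball_0_2)
    next
      case False
      have "emeasure lborel (T k) \<le> ennreal (C1 * ((1/2) ^ k) ^ N)"
        using False \<zeta> by (simp only: T_def if_False) (intro C1'[rule_format]; simp)
      also have "\<dots> \<le> ennreal (D * ((1/2) ^ k) ^ N)"
        unfolding D_def using C1 by (intro ennreal_leI mult_right_mono) auto
      finally show ?thesis .
    qed
    \<comment> \<open>\<open>kshell \<zeta> (q / 12)\<close> lies in the Koranyi ball of radius
      \<open>6 * q / 12 = q / 2\<close>, which is the next tent.\<close>
    have T_ge: "ennreal (C2 / 12 ^ N * ((1/2) ^ k) ^ N) \<le> emeasure lborel (T (Suc k))" for k
    proof -
      define q :: real where "q = (1/2) ^ k"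
      have q: "0 < q" "q \<le> 1" by (auto simp: q_def power_le_one)
      have "C2 / 12 ^ N * q ^ N = C2 * (q / 12) ^ N"
        by (simp add: power_divide)
      also have "ennreal \<dots> \<le> emeasure lborel (kshell \<zeta> (q / 12))"
        using q \<zeta> by (intro C2'[rule_format]) auto
      also have "\<dots> \<le> emeasure lborel (T (Suc k))"
        using q by (intro emeasure_mono) (auto simp: T_def kshell_def kball_iff q_def)
      finally show ?thesis by (simp add: q_def)
    qed
    have T_sub: "T (Suc k) \<subseteq> T k" for k
    proof -
      have "(1/2 :: real) ^ Suc k \<le> (1/2) ^ k"
        by (intro power_decreasing) auto
      then have "hdist \<zeta> x < (1/2) ^ k" if "hdist \<zeta> x < (1/2) ^ Suc k" for x
        using that by linarith
      then show ?thesis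
        by (auto simp: T_def kball_iff simp del: power_Suc)
    qed
    have "\<exists>m. (k = 0 \<longrightarrow> m = c) \<and> (\<integral>\<^sup>+w\<in>T k. ennreal (cmod (b w - m)) \<partial>lborel) \<le> ennreal M * emeasure lborel (T k)" for k
    proof (cases "k = 0")
      case True
      then show ?thesis using H0 by (simp add: T_def)
    next
      case False
      then have "(1/2 :: real) ^ k < 1"
        using power_strict_decreasing[of 0 k "1/2 :: real"] by simp
      then show ?thesis
        using H[rule_format, OF \<zeta>, of "(1/2) ^ k"] False by (simp add: T_def)
    qed
    then obtain m where m0: "m 0 = c"
      and m: "\<And>k. (\<integral>\<^sup>+w\<in>T k. ennreal (cmod (b w - m k)) \<partial>lborel) \<le> ennreal M * emeasure lborel (T k)"
      by metis
    have m': "(\<integral>\<^sup>+w\<in>T k. ennreal (cmod (b w - m k)) \<partial>lborel) \<le> ennreal (M * D * ((1/2) ^ k) ^ N)" for k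
    proof -
      have "ennreal M * emeasure lborel (T k) \<le> ennreal M * ennreal (D * ((1/2) ^ k) ^ N)"
        by (intro mult_left_mono T_le) simp
      also have "\<dots> = ennreal (M * D * ((1/2) ^ k) ^ N)"
        using M pos by (simp add: ennreal_mult[symmetric] mult.assoc)
      finally show ?thesis
        using m[of k] by (rule order_trans[rotated])
    qed
    \<comment> \<open>Both means are close to \<open>b\<close> on average over the smaller tent, and
      the two tents have comparable volumes.\<close>
    have step: "cmod (m k - m (Suc k)) \<le> K * M" for k
    proof -
      define q :: real where "q = ((1/2) ^ k) ^ N"
      have q: "0 < q" by (simp add: q_def)
      have "ennreal (cmod (m k - m (Suc k)) * (C2 / 12 ^ N * q)) = ennreal (cmod (m k - m (Suc k))) * ennreal (C2 / 12 ^ N * q)"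
        using C2 q by (intro ennreal_mult) auto
      also have "\<dots> \<le> ennreal (cmod (m k - m (Suc k))) * emeasure lborel (T (Suc k))"
        unfolding q_def by (intro mult_left_mono T_ge) simp
      also have "\<dots> = (\<integral>\<^sup>+w\<in>T (Suc k). ennreal (cmod (m k - m (Suc k))) \<partial>lborel)"
        by (simp add: nn_integral_cmult_indicator)
      also have "\<dots> \<le> (\<integral>\<^sup>+w. ennreal (cmod (b w - m k)) * indicator (T k) w + ennreal (cmod (b w - m (Suc k))) * indicator (T (Suc k)) w \<partial>lborel)"
      proof (rule nn_integral_mono)
        fix w
        have "ennreal (cmod (m k - m (Suc k))) \<le> ennreal (cmod (b w - m k)) + ennreal (cmod (b w - m (Suc k)))"
          using norm_triangle_ineq4[of "b w - m (Suc k)" "b w - m k"] by (simp add: add.commute flip: ennreal_plus)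
        then show "ennreal (cmod (m k - m (Suc k))) * indicator (T (Suc k)) w
            \<le> ennreal (cmod (b w - m k)) * indicator (T k) w + ennreal (cmod (b w - m (Suc k))) * indicator (T (Suc k)) w"
          using T_sub[of k] by (auto simp: indicator_def)
      qed
      also have "\<dots> = (\<integral>\<^sup>+w\<in>T k. ennreal (cmod (b w - m k)) \<partial>lborel) + (\<integral>\<^sup>+w\<in>T (Suc k). ennreal (cmod (b w - m (Suc k))) \<partial>lborel)"
        by (rule nn_integral_add) measurable
      also have "\<dots> \<le> ennreal (M * D * q) + ennreal (M * D * ((1/2) ^ Suc k) ^ N)"
        unfolding q_def by (intro add_mono m')
      also have "\<dots> \<le> ennreal (M * D * q) + ennreal (M * D * q)"
      proof -
        have "((1/2 :: real) ^ Suc k) ^ N \<le> q"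
          unfolding q_def by (intro power_mono power_decreasing) auto
        then show ?thesis
          using M pos by (intro add_left_mono ennreal_leI mult_left_mono) auto
      qed
      also have "\<dots> = ennreal (2 * (M * D * q))"
        using M pos q by (simp flip: ennreal_plus)
      finally have "cmod (m k - m (Suc k)) * (C2 / 12 ^ N * q) \<le> 2 * (M * D * q)"
        using M pos q by (subst (asm) ennreal_le_iff) auto
      then have "(cmod (m k - m (Suc k)) * (C2 / 12 ^ N)) * q \<le> (2 * (M * D)) * q"
        by (simp add: mult_ac)
      then have "cmod (m k - m (Suc k)) * (C2 / 12 ^ N) \<le> 2 * (M * D)"
        using q by (rule mult_right_le_imp_le)
      then show ?thesis
        using C2 by (simp add: K_def field_simps)
    qed
    have mk: "cmod (m k - c) \<le> real k * K * M" for k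
    proof (induction k)
      case (Suc k)
      have "cmod (m (Suc k) - c) \<le> cmod (m k - c) + cmod (m k - m (Suc k))"
        using norm_triangle_ineq4[of "m k - c" "m k - m (Suc k)"] by simp
      then show ?case
        using Suc step[of k] by (simp add: algebra_simps)
    qed (simp add: m0)
    have "1 \<le> 1 / r" using r by simp
    then obtain k where k: "2 ^ k \<le> 1 / r" "1 / r < 2 ^ Suc k"
      using exists_dyadic by blast
    define q :: real where "q = (1/2) ^ k"
    have q: "0 < q" "r \<le> q" "q \<le> 2 * r"
      using k r by (auto simp: q_def power_one_over field_simps)
    have lnr: "0 \<le> ln (1 / r)"
      using r by simp
    have kln: "real k \<le> 2 * ln (1 / r)"
    proof -
      have "real k * ln 2 = ln (2 ^ k)"
        by (simp add: ln_realpow)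
      also have "\<dots> \<le> ln (1 / r)"
        using k(1) r by (subst ln_le_cancel_iff) auto
      finally have "real k * ln 2 \<le> ln (1 / r)" .
      moreover have "real k * (1/2) \<le> real k * ln 2"
        using ln2_ge_two_thirds by (intro mult_left_mono) auto
      ultimately show ?thesis by linarith
    qed
    have "kball \<zeta> r \<subseteq> T k"
      using q by (auto simp: T_def kball_iff q_def)
    then have "(\<integral>\<^sup>+w\<in>kball \<zeta> r. ennreal (cmod (b w - c)) \<partial>lborel) \<le> (\<integral>\<^sup>+w\<in>T k. ennreal (cmod (b w - c)) \<partial>lborel)"
      by (intro nn_integral_mono) (auto simp: indicator_def)
    also have "\<dots> \<le> (\<integral>\<^sup>+w\<in>T k. ennreal (cmod (b w - m k)) \<partial>lborel) + ennreal (cmod (m k - c)) * emeasure lborel (T k)"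
      by (rule nn_integral_cmod_diff_le) measurable
    also have "\<dots> \<le> ennreal (M * D * q ^ N) + ennreal (real k * K * M) * ennreal (D * q ^ N)"
      unfolding q_def by (intro add_mono mult_mono ennreal_leI m' mk T_le) auto
    also have "\<dots> = ennreal (M * D * q ^ N + real k * K * M * (D * q ^ N))"
      using M pos q by (subst ennreal_mult[symmetric], simp, simp, subst ennreal_plus[symmetric]) auto
    also have "\<dots> \<le> ennreal (D * 2 ^ N * (1 + 2 * K) * M * (r ^ N * (1 + ln (1 / r))))"
    proof (rule ennreal_leI)
      have "M * D * q ^ N + real k * K * M * (D * q ^ N) = (M * D) * ((1 + real k * K) * q ^ N)"
        by (simp add: algebra_simps)
      also have "\<dots> \<le> (M * D) * (((1 + 2 * K) * (1 + ln (1 / r))) * (2 * r) ^ N)"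
      proof (intro mult_left_mono mult_mono power_mono)
        have "real k * K \<le> 2 * ln (1 / r) * K"
          using kln pos by (intro mult_right_mono) auto
        moreover have "0 \<le> K" using pos by simp
        ultimately show "1 + real k * K \<le> (1 + 2 * K) * (1 + ln (1 / r))"
          using lnr by (simp add: algebra_simps)
      qed (use q M pos r lnr in auto)
      finally show "M * D * q ^ N + real k * K * M * (D * q ^ N) \<le> D * 2 ^ N * (1 + 2 * K) * M * (r ^ N * (1 + ln (1 / r)))"
        by (simp add: power_mult_distrib mult_ac)
    qed
    finally show "(\<integral>\<^sup>+w\<in>kball \<zeta> r. ennreal (cmod (b w - c)) \<partial>lborel)
        \<le> ennreal (D * 2 ^ N * (1 + 2 * K) * M * (r ^ N * (1 + ln (1 / r))))" .
  qed (use pos in auto)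
qed

text \<open>With \<open>d = norm (w - p) \<ge> h\<close> the core is at most
  \<open>12 * n / d ^ (2 * n + 1)\<close>: the factor
  \<open>(norm p)\<^sup>2 - (norm w)\<^sup>2\<close> is at most \<open>3 * d\<close>, since
  \<open>norm p + norm w \<le> 3\<close>. Euclidean dyadic balls about \<open>p\<close> then
  contribute about \<open>1 / (2 ^ j * h)\<close>, and the geometric series doubles 12 to
  24.\<close>

lemma nn_integral_core_density_le:
  fixes p :: "complex ^ 'n"
  assumes h: "0 < h" "h \<le> 1" and p: "norm p = 1 + h" and \<rho>: "0 < \<rho>"
  shows "(\<integral>\<^sup>+w\<in>ball 0 1. ennreal (core_density CARD('n) p \<rho> w) \<partial>lborel)
    \<le> ennreal (24 * real CARD('n) * 4 ^ CARD('n) * unit_ball_vol (2 * real CARD('n)) / h)"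
proof -
  define n where "n = CARD('n)"
  define \<omega> where "\<omega> = unit_ball_vol (2 * real n)"
  have \<omega>: "0 \<le> \<omega>" by (simp add: \<omega>_def)
  define c where "c j = 12 * real n / (2 ^ j * h) ^ (2 * n + 1)" for j :: nat
  define a where "a j = \<omega> * (2 ^ Suc j * h) ^ (2 * n)" for j :: nat
  have ca: "c j * a j = (12 * real n * \<omega> * 4 ^ n / h) * (1/2) ^ j" for j
  proof -
    define y where "y = 2 ^ j * h"
    have y: "0 < y" using h by (simp add: y_def)
    have "c j * a j = 12 * real n * \<omega> * 2 ^ (2 * n) * (y ^ (2 * n) / y ^ (2 * n + 1))"
      unfolding c_def a_def power_Suc mult.assoc[of 2] y_def[symmetric] power_mult_distrib[of 2 y]
      by simp
    also have "y ^ (2 * n) / y ^ (2 * n + 1) = 1 / y"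
      using y by simp
    also have "(2 :: real) ^ (2 * n) = 4 ^ n"
      by (simp add: power_mult)
    finally show ?thesis
      by (simp add: y_def power_one_over field_simps)
  qed
  have sums: "(\<lambda>j. c j * a j) sums ((12 * real n * \<omega> * 4 ^ n / h) * 2)"
    unfolding ca using geometric_sums[of "1/2 :: real"] by (intro sums_mult) simp
  have "(\<integral>\<^sup>+w\<in>ball 0 1. ennreal (core_density n p \<rho> w) \<partial>lborel) \<le> ennreal (\<Sum>j. c j * a j)"
  proof (rule nn_integral_le_suminf[where A="\<lambda>j. ball p (2 ^ Suc j * h)"])
    show "emeasure lborel (ball p (2 ^ Suc j * h)) \<le> ennreal (a j)" for j
      using h by (subst emeasure_ball) (auto simp: a_def \<omega>_def n_def mult.commute)
    show "summable (\<lambda>j. c j * a j)"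
      using sums by (rule sums_summable)
  next
    fix w assume "ennreal (core_density n p \<rho> w) * indicator (ball 0 1) w \<noteq> 0"
    then have w: "norm w < 1"
      by (auto simp: indicator_def split: if_splits)
    define d where "d = norm (w - p)"
    have d: "h \<le> norm p - norm w" "norm p - norm w \<le> d"
      using w p norm_triangle_ineq2[of p w] by (auto simp: d_def norm_minus_commute)
    then have d0: "0 < d" using h by linarith
    have "1 \<le> d / h" using d h by simp
    then obtain j where j: "2 ^ j \<le> d / h" "d / h < 2 ^ Suc j"
      using exists_dyadic by blast
    have j': "2 ^ j * h \<le> d" "d < 2 ^ Suc j * h"
      using j h by (simp_all add: field_simps)
    have "core_density n p \<rho> w \<le> 4 * real n * ((norm p)\<^sup>2 - (norm w)\<^sup>2) * (1 / d\<^sup>2) ^ Suc n"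
      unfolding d_def using core_density_le[OF \<rho> w, of p n] p h by simp
    also have "\<dots> \<le> 4 * real n * (3 * d) * (1 / d\<^sup>2) ^ Suc n"
    proof (intro mult_right_mono mult_left_mono)
      have "(norm p)\<^sup>2 - (norm w)\<^sup>2 = (norm p + norm w) * (norm p - norm w)"
        by (simp add: power2_eq_square algebra_simps)
      also have "\<dots> \<le> 3 * d"
        using d h p w by (intro mult_mono) auto
      finally show "(norm p)\<^sup>2 - (norm w)\<^sup>2 \<le> 3 * d" .
    qed auto
    also have "\<dots> = 12 * real n / d ^ (2 * n + 1)"
    proof -
      have "(1 / d\<^sup>2) ^ Suc n = 1 / (d * d ^ (2 * n + 1))"
        by (simp add: power_one_over power_mult power2_eq_square power_mult_distrib)
      then show ?thesis
        using d0 by simp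
    qed
    also have "\<dots> \<le> c j"
      unfolding c_def using j'(1) h d0 by (intro divide_left_mono power_mono mult_pos_pos zero_less_power) auto
    finally have "core_density n p \<rho> w \<le> c j" .
    then show "\<exists>j. w \<in> ball p (2 ^ Suc j * h) \<and> ennreal (core_density n p \<rho> w) * indicator (ball 0 1) w \<le> ennreal (c j)"
      using w j'(2) by (intro exI[of _ j]) (auto simp: d_def dist_norm norm_minus_commute intro!: ennreal_leI)
  qed (use h \<omega> in \<open>auto simp: c_def a_def\<close>)
  also have "(\<Sum>j. c j * a j) = 24 * real n * 4 ^ n * \<omega> / h"
    using sums_unique[OF sums] by (simp add: mult_ac)
  finally show ?thesis
    by (simp add: n_def \<omega>_def)
qed

lemma dir_C2_on_subset: "dir_C2_on S g g1 g2 \<Longrightarrow> T \<subseteq> S \<Longrightarrow> dir_C2_on T g g1 g2"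
  unfolding dir_C2_on_def by (meson continuous_on_subset subsetD)

lemma inverse_le_scaled:
  fixes V W c :: real
  assumes "V \<le> c * W" "0 < V" "0 < c"
  shows "1 / W \<le> c * (1 / V)"
proof -
  have "0 < W"
    using assms by (smt (verit) mult_nonneg_nonpos)
  then show ?thesis
    using assms by (simp add: field_simps)
qed

text \<open>The point \<open>p\<close> is the reflection of \<open>z\<close> to the outside of the ball, and \<open>\<rho>\<close> is so small that
  \<open>|w - p|\<close> is almost constant on the sets \<open>kshell w \<rho>\<close>.\<close>

lemma subharmonic_growth:
  "\<exists>C>0. \<forall>(g :: complex ^ 'n \<Rightarrow> real) g1 g2 M z. 0 < M \<longrightarrow> (\<forall>x. 0 \<le> g x) \<longrightarrow>
     (\<forall>x\<in>ball 0 1. (g has_derivative (\<lambda>h. \<Sum>e\<in>Basis. (h \<bullet> e) * g1 e x)) (at x)) \<longrightarrow>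
     dir_C2_on (ball 0 1) g g1 g2 \<longrightarrow> (\<forall>x\<in>ball 0 1. 0 \<le> (\<Sum>e\<in>Basis. g2 e x)) \<longrightarrow>
     (\<forall>\<zeta> r. norm \<zeta> = 1 \<longrightarrow> 0 < r \<longrightarrow> r < 1 \<longrightarrow>
        (\<integral>\<^sup>+w\<in>kball \<zeta> r. ennreal (g w) \<partial>lborel) \<le> ennreal (M * (r ^ (CARD('n) + 1) * (1 + ln (1 / r))))) \<longrightarrow>
     norm z < 1 \<longrightarrow> g z \<le> C * M * log_weight z"
proof -
  define n where "n = CARD('n)"
  define N where "N = n + 1"
  have n: "0 < n" "DIM(complex ^ 'n) = 2 * n" by (simp_all add: n_def)
  obtain C2 where C2: "0 < C2" and C2': "\<forall>(w :: complex ^ 'n) \<rho>. norm w \<le> 1 \<longrightarrow> 0 < \<rho> \<longrightarrow> \<rho> \<le> 1/2 \<longrightarrow> 1 - norm w \<le> 4 * \<rho> \<longrightarrow>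
     ennreal (C2 * \<rho> ^ N) \<le> emeasure lborel (kshell w \<rho>)"
    unfolding N_def n_def using emeasure_kshell_ge by blast
  define \<kappa> where "\<kappa> = (\<integral>v. hat v \<partial>(lborel :: (complex ^ 'n) measure))"
  have \<kappa>: "0 < \<kappa>" unfolding \<kappa>_def by (rule integral_hat_pos)
  \<comment> \<open>\<open>K3 / h\<close> bounds the mass of the core, \<open>K4\<close> is the loss
    in averaging over the sets \<open>kshell w \<rho>\<close>, and \<open>K5 / h\<close> is the
    weight with which the core sees \<open>g z\<close>.\<close>
  define K3 where "K3 = 24 * real n * 4 ^ n * unit_ball_vol (2 * real n)"
  define K4 where "K4 = 4 * (9/4) ^ n * 12 ^ N / C2"
  define K5 where "K5 = 8 * real n * (4/25) ^ N * (1/4) ^ n * \<kappa>"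
  have pos: "0 < K3" "0 < K4" "0 < K5"
    using n C2 \<kappa> by (auto simp: K3_def K4_def K5_def unit_ball_vol_pos)
  define B where "B = ball (0 :: complex ^ 'n) 1"
  have [measurable]: "B \<in> sets borel" by (simp add: B_def)
  show ?thesis
    unfolding n_def[symmetric] N_def[symmetric] B_def[symmetric]
  proof (intro exI[of _ "3 * K3 * K4 / K5"] conjI allI impI)
    fix g :: "complex ^ 'n \<Rightarrow> real" and g1 g2 and M :: real and z :: "complex ^ 'n"
    assume M: "0 < M" and g0: "\<forall>x. 0 \<le> g x"
      and der: "\<forall>x\<in>B. (g has_derivative (\<lambda>h. \<Sum>e\<in>Basis. (h \<bullet> e) * g1 e x)) (at x)"
      and gC2: "dir_C2_on B g g1 g2" and lap: "\<forall>x\<in>B. 0 \<le> (\<Sum>e\<in>Basis. g2 e x)"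
      and H: "\<forall>\<zeta> r. norm \<zeta> = 1 \<longrightarrow> 0 < r \<longrightarrow> r < 1 \<longrightarrow>
        (\<integral>\<^sup>+w\<in>kball \<zeta> r. ennreal (g w) \<partial>lborel) \<le> ennreal (M * (r ^ N * (1 + ln (1 / r))))"
      and z: "norm z < 1"
    define h where "h = 1 - norm z"
    have h: "0 < h" "h \<le> 1" using z by (auto simp: h_def)
    \<comment> \<open>Points with \<open>hdist w v < 6 * \<rho>\<close> have
      \<open>|w - v|\<^sup>2 \<le> 12 * \<rho> = (h / 2)\<^sup>2\<close>, at most half the distance
      from the ball to \<open>p\<close>.\<close>
    define \<rho> where "\<rho> = h\<^sup>2 / 48"
    have h2: "h\<^sup>2 \<le> h" "h\<^sup>2 \<le> 1" "0 < h\<^sup>2"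
      using h mult_left_le[of h h] by (auto simp: power2_eq_square intro: mult_le_one)
    have \<rho>: "0 < \<rho>" "\<rho> \<le> h / 48" "\<rho> \<le> 1 / 48"
      using h2 by (auto simp: \<rho>_def)
    obtain \<zeta> where \<zeta>: "norm \<zeta> = 1" "z = norm z *\<^sub>R \<zeta>"
    proof (cases "z = 0")
      case True
      obtain e :: "complex ^ 'n" where "e \<in> Basis" using nonempty_Basis by blast
      then show ?thesis using that[of e] True by simp
    next
      case False
      then show ?thesis using that[of "z /\<^sub>R norm z"] by simp
    qed
    define p where "p = (1 + h) *\<^sub>R \<zeta>"
    have p: "norm p = 1 + h" "1 < norm p"
      using h \<zeta> by (auto simp: p_def)
    have zp: "norm (z - p) = 2 * h"
    proof -
      have "z - p = (norm z - (1 + h)) *\<^sub>R \<zeta>"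
        by (subst \<zeta>(2)) (simp add: p_def scaleR_diff_left)
      then have "norm (z - p) = \<bar>norm z - (1 + h)\<bar>"
        using \<zeta>(1) by simp
      then show ?thesis using h by (simp add: h_def)
    qed
    have far: "h \<le> norm (w - p)" if "w \<in> B" for w
      using that p norm_triangle_ineq2[of p w] by (auto simp: B_def norm_minus_commute)
    define P where "P w = shell_density n p \<rho> w" for w
    define Q where "Q w = core_density n p \<rho> w" for w
    have P0: "0 \<le> P w" for w
      unfolding P_def using \<rho>(1) by (rule shell_density_nonneg)
    have [measurable]: "P \<in> borel_measurable borel"
      unfolding P_def[abs_def] shell_density_def[abs_def] cutoff2_def[abs_def] by measurable
    define G where "G w = ennreal (g w) * indicator B w" for w
    have [measurable]: "G \<in> borel_measurable borel"
    proof -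
      have "(\<lambda>w. indicator B w *\<^sub>R g w) \<in> borel_measurable borel"
        using dir_C2_onD(1)[OF gC2] by (intro borel_measurable_continuous_on_indicator) auto
      then have "(\<lambda>w. ennreal (indicator B w *\<^sub>R g w)) \<in> borel_measurable borel"
        by measurable
      moreover have "(\<lambda>w. ennreal (indicator B w *\<^sub>R g w)) = G"
        by (auto simp: G_def indicator_def)
      ultimately show ?thesis by simp
    qed

    \<comment> \<open>On \<open>ball z (h / 2)\<close> the slope of the cutoff is 1 and
      \<open>norm (w - p) \<le> 5/2 * h\<close>, so the core is of order
      \<open>h / h ^ (2 * n + 2)\<close> there. The mean value inequality adds the volume factor of
      order \<open>h ^ (2 * n)\<close>.\<close>
    have core: "ennreal (K5 / h * g z) \<le> (\<integral>\<^sup>+w\<in>B. ennreal (g w * Q w) \<partial>lborel)"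
    proof -
      define k0 where "k0 = 8 * real n * h * (4 / (25 * h\<^sup>2)) ^ N"
      have k0: "0 \<le> k0" using h by (simp add: k0_def)
      have sub: "ball z h \<subseteq> B"
      proof
        fix x assume "x \<in> ball z h"
        then show "x \<in> B"
          using norm_triangle_ineq2[of x z] by (auto simp: B_def h_def dist_norm norm_minus_commute)
      qed
      have sub2: "ball z (h / 2) \<subseteq> B"
        using h by (intro subset_trans[OF subset_ball sub]) auto
      have [measurable]: "ball z (h / 2) \<in> sets borel"
        by simp
      have Q_ge: "k0 \<le> Q w" if w: "w \<in> ball z (h / 2)" for w
      proof -
        have wB: "w \<in> B" using w sub h by auto
        have nw: "norm w < 1 - h / 2"
        proof -
          have "norm (w - z) < h / 2"
            using w by (simp add: dist_norm norm_minus_commute)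
          have "norm w \<le> norm z + norm (w - z)"
            by (rule norm_triangle_sub)
          also have "\<dots> < norm z + h / 2"
            using \<open>norm (w - z) < h / 2\<close> by (rule add_strict_left_mono)
          also have "\<dots> = 1 - h / 2"
            by (simp add: h_def field_simps)
          finally show ?thesis .
        qed
        have t: "2 * \<rho> \<le> 1 - (norm w)\<^sup>2"
        proof -
          have "(norm w)\<^sup>2 \<le> norm w"
            using wB mult_left_le[of "norm w" "norm w"] by (simp add: B_def power2_eq_square)
          then show ?thesis
            using nw \<rho>(2) h by linarith
        qed
        have "norm (w - p) \<le> norm (w - z) + norm (z - p)"
          using norm_triangle_ineq[of "w - z" "z - p"] by simp
        then have wp: "norm (w - p) \<le> 5/2 * h"
          using w zp by (simp add: dist_norm norm_minus_commute)
        have "(norm (w - p))\<^sup>2 \<le> (5/2 * h)\<^sup>2"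
          using wp by (intro power_mono) auto
        then have "1 / h\<^sup>2 \<le> 25/4 * (1 / (norm (w - p))\<^sup>2)"
          using far[OF wB] h by (intro inverse_le_scaled zero_less_power) (auto simp: power_mult_distrib power2_eq_square)
        then have "4/25 * (1 / h\<^sup>2) \<le> 4/25 * (25/4 * (1 / (norm (w - p))\<^sup>2))"
          by (rule mult_left_mono) simp
        then have "4 / (25 * h\<^sup>2) \<le> 1 / (norm (w - p))\<^sup>2"
          by simp
        then have le: "(4 / (25 * h\<^sup>2)) ^ N \<le> (1 / (norm (w - p))\<^sup>2) ^ Suc n"
          unfolding N_def using h by (simp only: Suc_eq_plus1[symmetric]) (intro power_mono; simp)
        have "2 * h \<le> (norm p)\<^sup>2 - 1"
          unfolding p(1) by (simp add: power2_eq_square algebra_simps)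
        then have "4 * real n * (1 * (2 * h)) * (4 / (25 * h\<^sup>2)) ^ N
            \<le> 4 * real n * (cutoff1 \<rho> (1 - (norm w)\<^sup>2) * ((norm p)\<^sup>2 - 1)) * (1 / (norm (w - p))\<^sup>2) ^ Suc n"
          unfolding cutoff1_eq_1[OF \<rho>(1) t] using le h p by (intro mult_mono) auto
        also have "\<dots> \<le> Q w"
          unfolding Q_def using wB by (intro core_density_ge \<rho>) (auto simp: B_def)
        finally show ?thesis by (simp add: k0_def)
      qed
      have "ennreal ((h / 2) ^ DIM(complex ^ 'n) * (g z * \<kappa>)) \<le> (\<integral>\<^sup>+x\<in>ball z (h / 2). ennreal (g x) \<partial>lborel)"
        unfolding \<kappa>_def
      proof (rule subharmonic_mean_value[where R=h])
        show "dir_C2_on (ball z h) g g1 g2"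
          using gC2 sub by (rule dir_C2_on_subset)
      qed (use h der lap sub g0 in auto)
      then have "ennreal k0 * ennreal ((h / 2) ^ (2 * n) * (g z * \<kappa>)) \<le> ennreal k0 * (\<integral>\<^sup>+x\<in>ball z (h / 2). ennreal (g x) \<partial>lborel)"
        unfolding n(2) by (rule mult_left_mono) simp
      also have "\<dots> = ennreal k0 * (\<integral>\<^sup>+x. G x * indicator (ball z (h / 2)) x \<partial>lborel)"
        using sub2 by (intro arg_cong[where f="\<lambda>x. ennreal k0 * x"] nn_integral_cong) (auto simp: G_def indicator_def)
      also have "\<dots> = (\<integral>\<^sup>+x. ennreal k0 * (G x * indicator (ball z (h / 2)) x) \<partial>lborel)"
        by (rule nn_integral_cmult[symmetric]) measurable
      also have "\<dots> \<le> (\<integral>\<^sup>+w\<in>B. ennreal (g w * Q w) \<partial>lborel)"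
      proof (rule nn_integral_mono)
        fix x
        show "ennreal k0 * (G x * indicator (ball z (h / 2)) x) \<le> ennreal (g x * Q x) * indicator B x"
        proof (cases "x \<in> ball z (h / 2)")
          case True
          then have "x \<in> B" using sub h by auto
          have "ennreal k0 * ennreal (g x) = ennreal (g x * k0)"
            using k0 g0 by (simp add: ennreal_mult[symmetric] mult.commute)
          also have "\<dots> \<le> ennreal (g x * Q x)"
            using Q_ge[OF True] g0 by (intro ennreal_leI mult_left_mono) auto
          finally show ?thesis
            using True \<open>x \<in> B\<close> by (simp add: G_def)
        qed simp
      qed
      finally have "ennreal k0 * ennreal ((h / 2) ^ (2 * n) * (g z * \<kappa>)) \<le> (\<integral>\<^sup>+w\<in>B. ennreal (g w * Q w) \<partial>lborel)" .
      moreover have "ennreal k0 * ennreal ((h / 2) ^ (2 * n) * (g z * \<kappa>)) = ennreal (K5 / h * g z)"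
      proof -
        have "k0 * ((h / 2) ^ (2 * n) * (g z * \<kappa>)) = K5 / h * g z"
        proof -
          define y where "y = h\<^sup>2"
          have y: "0 < y" "y = h * h" using h by (auto simp: y_def power2_eq_square)
          have e1: "(h / 2) ^ (2 * n) = y ^ n * (1/4) ^ n"
            by (simp add: power_mult y_def power_divide)
          have e2: "k0 = 8 * real n * h * ((4/25) ^ N / (y * y ^ n))"
            by (simp add: k0_def y_def[symmetric] N_def power_divide power_mult_distrib)
          have "k0 * ((h / 2) ^ (2 * n) * (g z * \<kappa>)) = K5 * g z * (h / y) * (y ^ n / y ^ n)"
            unfolding e1 e2 K5_def by simp
          also have "\<dots> = K5 / h * g z"
            using y h by simp
          finally show ?thesis .
        qed
        then show ?thesis
          using k0 h g0 \<kappa> by (subst ennreal_mult[symmetric]) auto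
      qed
      ultimately show ?thesis by simp
    qed

    \<comment> \<open>\<open>P w\<close> is dominated by its average over
      \<open>kshell w \<rho>\<close>. After Fubini the function \<open>g\<close> is integrated over
      all \<open>w\<close> whose shell contains a given \<open>v\<close>, and these lie in one tent,
      where the hypothesis applies; \<open>P\<close> is left without \<open>g\<close>.\<close>
    have shell: "(\<integral>\<^sup>+w\<in>B. ennreal (g w * P w) \<partial>lborel)
        \<le> ennreal (K4 * (M * (1 + ln (1 / (12 * \<rho>))))) * (\<integral>\<^sup>+w\<in>B. ennreal (P w) \<partial>lborel)"
    proof -
      define E where "E = C2 * \<rho> ^ N"
      have E: "0 < E" using C2 \<rho> by (simp add: E_def)
      define \<xi> :: "complex ^ 'n \<Rightarrow> complex ^ 'n \<Rightarrow> ennreal" where "\<xi> w v = indicator (kshell w \<rho>) v" for w v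
      have [measurable]: "(\<lambda>x. \<xi> (a x) (c x)) \<in> borel_measurable X"
        if [measurable]: "a \<in> borel_measurable X" "c \<in> borel_measurable X" for a c and X :: "'z measure"
        unfolding \<xi>_def indicator_def kshell_def kball_iff mem_Collect_eq by measurable
      \<comment> \<open>The distances of \<open>v\<close> and \<open>w\<close> to \<open>p\<close>
        differ by at most \<open>h / 2 \<le> norm (w - p) / 2\<close>, hence the factor
        \<open>(9/4) ^ n\<close>. The 4 compares \<open>|w|\<^sup>2 \<le> 1\<close> and the peak
        \<open>2 / \<rho>\<close> with \<open>|v|\<^sup>2 \<ge> 1/2\<close> and the value
        \<open>1 / \<rho>\<close> on the middle of the shell.\<close>
      have P_le: "P w \<le> 4 * (9/4) ^ n * P v" if w: "w \<in> B" "P w \<noteq> 0" and v: "v \<in> kshell w \<rho>" for w v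
      proof -
        have vB: "v \<in> B" and hv: "hdist w v < 6 * \<rho>" and tv: "5/4 * \<rho> \<le> 1 - (norm v)\<^sup>2" "1 - (norm v)\<^sup>2 \<le> 7/4 * \<rho>"
          using v by (auto simp: kshell_def kball_iff B_def)
        have tw: "\<rho> \<le> 1 - (norm w)\<^sup>2"
          using w(2) densities_eq_0(1)[OF \<rho>(1), of w n p] by (auto simp: P_def not_less[symmetric])
        have "(norm (w - v))\<^sup>2 \<le> 2 * Re (1 - hermitian_inner w v)"
          unfolding norm_diff_hdist using tw tv \<rho> by simp
        also have "\<dots> \<le> 2 * hdist w v"
          using complex_Re_le_cmod[of "1 - hermitian_inner w v"] unfolding hdist_def by linarith
        also have "\<dots> \<le> (h / 2)\<^sup>2"
          using hv by (simp add: \<rho>_def power2_eq_square)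
        finally have "norm (w - v) \<le> h / 2"
          by (rule power2_le_imp_le) (use h in simp)
        then have "norm (v - p) \<le> 3/2 * norm (w - p)"
          using norm_triangle_ineq[of "v - w" "w - p"] far[OF w(1)] by (simp add: norm_minus_commute)
        then have "(norm (v - p))\<^sup>2 \<le> (3/2 * norm (w - p))\<^sup>2"
          by (intro power_mono) auto
        then have "1 / (norm (w - p))\<^sup>2 \<le> 9/4 * (1 / (norm (v - p))\<^sup>2)"
          using far[OF vB] h
          by (intro inverse_le_scaled zero_less_power) (auto simp: power_mult_distrib power2_eq_square)
        then have pow: "(1 / (norm (w - p))\<^sup>2) ^ n \<le> (9/4) ^ n * (1 / (norm (v - p))\<^sup>2) ^ n"
          by (subst power_mult_distrib[symmetric]) (intro power_mono; simp)
        have "P w \<le> 4 * 1 * (2 / \<rho>) * (1 / (norm (w - p))\<^sup>2) ^ n"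
          unfolding P_def shell_density_def using cutoff2_bounds[OF \<rho>(1)] w(1)
          by (intro mult_right_mono mult_mono) (auto simp: B_def abs_square_le_1)
        also have "\<dots> \<le> 4 * 1 * (2 / \<rho>) * ((9/4) ^ n * (1 / (norm (v - p))\<^sup>2) ^ n)"
          using pow \<rho> by (intro mult_left_mono) auto
        also have "\<dots> = 4 * (9/4) ^ n * (4 * (1/2) * (1 / \<rho>) * (1 / (norm (v - p))\<^sup>2) ^ n)"
          by simp
        also have "\<dots> \<le> 4 * (9/4) ^ n * P v"
        proof (intro mult_left_mono)
          have "1/2 \<le> (norm v)\<^sup>2"
            using tv \<rho> by linarith
          moreover have "1 / \<rho> \<le> cutoff2 \<rho> (1 - (norm v)\<^sup>2)"
            using tv by (intro cutoff2_bounds(4) \<rho>) auto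
          ultimately show "4 * (1/2) * (1 / \<rho>) * (1 / (norm (v - p))\<^sup>2) ^ n \<le> P v"
            unfolding P_def shell_density_def using \<rho> by (intro mult_right_mono mult_mono) auto
        qed auto
        finally show ?thesis .
      qed
      have pw: "ennreal (P w) \<le> ennreal (4 * (9/4) ^ n / E) * (\<integral>\<^sup>+v. \<xi> w v * ennreal (P v) \<partial>lborel)" if w: "w \<in> B" for w
      proof (cases "P w = 0")
        case False
        have "1 - (norm w)\<^sup>2 \<le> 2 * \<rho>"
          using False cutoff2_bounds(3)[OF \<rho>(1), of "1 - (norm w)\<^sup>2"] by (force simp: P_def shell_density_def)
        moreover have "(norm w)\<^sup>2 \<le> norm w"
          using w mult_left_le[of "norm w" "norm w"] by (simp add: B_def power2_eq_square)
        ultimately have "1 - norm w \<le> 4 * \<rho>"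
          using \<rho> by linarith
        then have "ennreal E \<le> emeasure lborel (kshell w \<rho>)"
          unfolding E_def using w \<rho> by (intro C2'[rule_format]) (auto simp: B_def)
        then have "ennreal (P w) * ennreal E \<le> ennreal (P w) * emeasure lborel (kshell w \<rho>)"
          by (rule mult_left_mono) simp
        also have "\<dots> = (\<integral>\<^sup>+v. ennreal (P w) * \<xi> w v \<partial>lborel)"
          unfolding \<xi>_def by (simp add: nn_integral_cmult_indicator)
        also have "\<dots> \<le> (\<integral>\<^sup>+v. ennreal (4 * (9/4) ^ n) * (\<xi> w v * ennreal (P v)) \<partial>lborel)"
        proof (rule nn_integral_mono)
          fix v
          show "ennreal (P w) * \<xi> w v \<le> ennreal (4 * (9/4) ^ n) * (\<xi> w v * ennreal (P v))"
          proof (cases "v \<in> kshell w \<rho>")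
            case True
            have "ennreal (P w) \<le> ennreal (4 * (9/4) ^ n) * ennreal (P v)"
              using P_le[OF w False True] P0 by (subst ennreal_mult[symmetric]) (auto intro: ennreal_leI)
            then show ?thesis using True by (simp add: \<xi>_def)
          qed (simp add: \<xi>_def)
        qed
        also have "\<dots> = ennreal (4 * (9/4) ^ n) * (\<integral>\<^sup>+v. \<xi> w v * ennreal (P v) \<partial>lborel)"
          by (rule nn_integral_cmult) measurable
        finally have le: "ennreal (P w) * ennreal E \<le> ennreal (4 * (9/4) ^ n) * (\<integral>\<^sup>+v. \<xi> w v * ennreal (P v) \<partial>lborel)" .
        have "ennreal (P w) = ennreal (1 / E) * (ennreal (P w) * ennreal E)"
          using E P0 by (simp add: ennreal_mult[symmetric])
        also have "\<dots> \<le> ennreal (1 / E) * (ennreal (4 * (9/4) ^ n) * (\<integral>\<^sup>+v. \<xi> w v * ennreal (P v) \<partial>lborel))"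
          using le by (rule mult_left_mono) simp
        also have "\<dots> = ennreal (4 * (9/4) ^ n / E) * (\<integral>\<^sup>+v. \<xi> w v * ennreal (P v) \<partial>lborel)"
          using E by (simp add: mult.assoc[symmetric] ennreal_mult[symmetric])
        finally show ?thesis .
      qed simp
      \<comment> \<open>The tent is centred at the radial projection of \<open>v\<close> to the
        sphere, which moves \<open>hdist\<close> by at most
        \<open>1 - norm v \<le> 7/4 * \<rho>\<close>; so
        \<open>6 * \<rho> + 7/4 * \<rho> < 12 * \<rho>\<close> suffices.\<close>
      have inner: "(\<integral>\<^sup>+w. G w * \<xi> w v \<partial>lborel) \<le> ennreal (M * ((12 * \<rho>) ^ N * (1 + ln (1 / (12 * \<rho>))))) * indicator B v" for v
      proof (cases "\<exists>w. v \<in> kshell w \<rho>")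
        case False
        then have "(\<integral>\<^sup>+w. G w * \<xi> w v \<partial>lborel) = (\<integral>\<^sup>+w. 0 \<partial>(lborel :: (complex ^ 'n) measure))"
          by (intro nn_integral_cong) (auto simp: \<xi>_def indicator_def)
        then show ?thesis by simp
      next
        case True
        then have v: "norm v < 1" "1 - (norm v)\<^sup>2 \<le> 7/4 * \<rho>"
          by (auto simp: kshell_def kball_iff)
        then have v0: "v \<noteq> 0" using \<rho> by auto
        define \<eta> where "\<eta> = v /\<^sub>R norm v"
        have \<eta>: "norm \<eta> = 1" "v = norm v *\<^sub>R \<eta>" using v0 by (auto simp: \<eta>_def)
        have "(norm v)\<^sup>2 \<le> norm v"
          using v(1) mult_left_le[of "norm v" "norm v"] by (simp add: power2_eq_square)
        then have nv: "1 - norm v \<le> 7/4 * \<rho>" using v(2) by linarith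
        have sub: "w \<in> kball \<eta> (12 * \<rho>)" if w: "v \<in> kshell w \<rho>" "w \<in> B" for w
        proof -
          have "hdist w v < 6 * \<rho>" using w by (auto simp: kshell_def kball_iff)
          moreover have "hdist \<eta> w \<le> hdist v w + (1 - norm v)"
          proof -
            have "hermitian_inner v w = of_real (norm v) * hermitian_inner \<eta> w"
              by (metis \<eta>(2) hermitian_inner_scaleR_left)
            then have eq: "1 - hermitian_inner \<eta> w = (1 - hermitian_inner v w) - of_real (1 - norm v) * hermitian_inner \<eta> w"
              by (simp add: algebra_simps)
            have "cmod (hermitian_inner \<eta> w) \<le> 1"
              using cmod_hermitian_inner_le[of \<eta> w] \<eta>(1) w(2) by (simp add: B_def)
            then have "cmod (of_real (1 - norm v) * hermitian_inner \<eta> w) \<le> 1 - norm v"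
              unfolding norm_mult norm_of_real using v(1) by (metis abs_of_nonneg diff_ge_0_iff_ge less_imp_le mult_left_le)
            then show ?thesis
              unfolding hdist_def eq
              using norm_triangle_ineq4[of "1 - hermitian_inner v w" "of_real (1 - norm v) * hermitian_inner \<eta> w"]
              by linarith
          qed
          ultimately have "hdist \<eta> w < 12 * \<rho>"
            using nv hdist_commute[of v w] \<rho> by linarith
          then show ?thesis using w(2) by (simp add: kball_iff B_def)
        qed
        have "(\<integral>\<^sup>+w. G w * \<xi> w v \<partial>lborel) \<le> (\<integral>\<^sup>+w\<in>kball \<eta> (12 * \<rho>). ennreal (g w) \<partial>lborel)"
          using sub by (intro nn_integral_mono) (auto simp: G_def \<xi>_def indicator_def)
        also have "\<dots> \<le> ennreal (M * ((12 * \<rho>) ^ N * (1 + ln (1 / (12 * \<rho>)))))"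
          using \<rho> by (intro H[rule_format] \<eta>(1)) auto
        finally show ?thesis
          using v by (simp add: B_def)
      qed
      define Y where "Y = M * ((12 * \<rho>) ^ N * (1 + ln (1 / (12 * \<rho>))))"
      have ln0: "0 \<le> ln (1 / (12 * \<rho>))"
        using \<rho> by (intro ln_ge_zero) (auto simp: field_simps)
      have Y: "0 \<le> Y" unfolding Y_def using M \<rho> ln0 by (intro mult_nonneg_nonneg) auto
      have "(\<integral>\<^sup>+w\<in>B. ennreal (g w * P w) \<partial>lborel)
          \<le> (\<integral>\<^sup>+w. (\<integral>\<^sup>+v. ennreal (4 * (9/4) ^ n / E) * (G w * \<xi> w v * ennreal (P v)) \<partial>lborel) \<partial>lborel)"
      proof (rule nn_integral_mono)
        fix w
        show "ennreal (g w * P w) * indicator B w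
            \<le> (\<integral>\<^sup>+v. ennreal (4 * (9/4) ^ n / E) * (G w * \<xi> w v * ennreal (P v)) \<partial>lborel)"
        proof (cases "w \<in> B")
          case True
          have "ennreal (g w * P w) = ennreal (g w) * ennreal (P w)"
            using g0 P0 by (intro ennreal_mult) auto
          also have "\<dots> \<le> ennreal (g w) * (ennreal (4 * (9/4) ^ n / E) * (\<integral>\<^sup>+v. \<xi> w v * ennreal (P v) \<partial>lborel))"
            by (intro mult_left_mono pw True) simp
          also have "\<dots> = (ennreal (g w) * ennreal (4 * (9/4) ^ n / E)) * (\<integral>\<^sup>+v. \<xi> w v * ennreal (P v) \<partial>lborel)"
            by (simp only: mult.assoc)
          also have "\<dots> = (\<integral>\<^sup>+v. (ennreal (g w) * ennreal (4 * (9/4) ^ n / E)) * (\<xi> w v * ennreal (P v)) \<partial>lborel)"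
            by (rule nn_integral_cmult[symmetric]) measurable
          also have "\<dots> = (\<integral>\<^sup>+v. ennreal (4 * (9/4) ^ n / E) * (G w * \<xi> w v * ennreal (P v)) \<partial>lborel)"
            using True by (intro nn_integral_cong) (simp add: G_def mult_ac)
          finally show ?thesis using True by simp
        qed simp
      qed
      also have "\<dots> = (\<integral>\<^sup>+v. (\<integral>\<^sup>+w. ennreal (4 * (9/4) ^ n / E) * (G w * \<xi> w v * ennreal (P v)) \<partial>lborel) \<partial>lborel)"
        by (rule lborel_pair.Fubini') measurable
      also have "\<dots> = (\<integral>\<^sup>+v. ennreal (4 * (9/4) ^ n / E) * ennreal (P v) * (\<integral>\<^sup>+w. G w * \<xi> w v \<partial>lborel) \<partial>lborel)"
      proof (rule nn_integral_cong)
        fix v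
        have "(\<integral>\<^sup>+w. ennreal (4 * (9/4) ^ n / E) * (G w * \<xi> w v * ennreal (P v)) \<partial>lborel)
            = (\<integral>\<^sup>+w. ennreal (4 * (9/4) ^ n / E) * ennreal (P v) * (G w * \<xi> w v) \<partial>lborel)"
          by (intro nn_integral_cong) (simp add: mult_ac)
        also have "\<dots> = ennreal (4 * (9/4) ^ n / E) * ennreal (P v) * (\<integral>\<^sup>+w. G w * \<xi> w v \<partial>lborel)"
          by (rule nn_integral_cmult) measurable
        finally show "(\<integral>\<^sup>+w. ennreal (4 * (9/4) ^ n / E) * (G w * \<xi> w v * ennreal (P v)) \<partial>lborel)
            = ennreal (4 * (9/4) ^ n / E) * ennreal (P v) * (\<integral>\<^sup>+w. G w * \<xi> w v \<partial>lborel)" .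
      qed
      also have "\<dots> \<le> (\<integral>\<^sup>+v. ennreal (4 * (9/4) ^ n / E) * ennreal (P v) * (ennreal Y * indicator B v) \<partial>lborel)"
        unfolding Y_def by (intro nn_integral_mono mult_left_mono inner) auto
      also have "\<dots> = (\<integral>\<^sup>+v. ennreal (4 * (9/4) ^ n / E * Y) * (ennreal (P v) * indicator B v) \<partial>lborel)"
      proof (rule nn_integral_cong)
        fix v
        have "ennreal (4 * (9/4) ^ n / E * Y) = ennreal (4 * (9/4) ^ n / E) * ennreal Y"
          using E Y by (intro ennreal_mult) auto
        then show "ennreal (4 * (9/4) ^ n / E) * ennreal (P v) * (ennreal Y * indicator B v)
            = ennreal (4 * (9/4) ^ n / E * Y) * (ennreal (P v) * indicator B v)"
          by (simp only: mult_ac)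
      qed
      also have "\<dots> = ennreal (4 * (9/4) ^ n / E * Y) * (\<integral>\<^sup>+v\<in>B. ennreal (P v) \<partial>lborel)"
        by (rule nn_integral_cmult) measurable
      also have "4 * (9/4) ^ n / E * Y = K4 * (M * (1 + ln (1 / (12 * \<rho>))))"
        using \<rho> C2 by (simp add: E_def Y_def K4_def power_mult_distrib)
      finally show ?thesis .
    qed

    \<comment> \<open>The constant function 1 is harmonic, so shell and core have the same
      mass.\<close>
    have PQ: "(\<integral>\<^sup>+w\<in>B. ennreal (P w) \<partial>lborel) \<le> ennreal (K3 / h)"
    proof -
      have const: "dir_C2_on (ball 0 1) (\<lambda>_ :: complex ^ 'n. 1) (\<lambda>_ _. 0) (\<lambda>_ _. 0)"
        by (simp add: dir_C2_on_def)
      have "(\<integral>\<^sup>+w\<in>B. ennreal (P w) \<partial>lborel) = (\<integral>\<^sup>+w\<in>B. ennreal (Q w) \<partial>lborel)"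
        using integral_core_shell(2)[OF n(2) p(2) \<rho>(1) const] by (simp add: B_def P_def Q_def)
      also have "\<dots> \<le> ennreal (K3 / h)"
        unfolding B_def Q_def K3_def n_def by (rule nn_integral_core_density_le) (fact h p(1) \<rho>(1))+
      finally show ?thesis .
    qed
    have "ennreal (K5 / h * g z) \<le> (\<integral>\<^sup>+w\<in>B. ennreal (g w * Q w) \<partial>lborel)"
      by (rule core)
    also have "\<dots> \<le> (\<integral>\<^sup>+w\<in>B. ennreal (g w * P w) \<partial>lborel)"
      unfolding B_def P_def Q_def
      by (rule integral_core_shell(1)[OF n(2) p(2) \<rho>(1) gC2[unfolded B_def]]) (use g0 lap in \<open>auto simp: B_def\<close>)
    also have "\<dots> \<le> ennreal (K4 * (M * (1 + ln (1 / (12 * \<rho>))))) * (\<integral>\<^sup>+w\<in>B. ennreal (P w) \<partial>lborel)"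
      by (rule shell)
    also have "\<dots> \<le> ennreal (K4 * (M * (1 + ln (1 / (12 * \<rho>))))) * ennreal (K3 / h)"
      by (rule mult_left_mono[OF PQ]) simp
    also have "\<dots> \<le> ennreal (K4 * (M * (3 * log_weight z))) * ennreal (K3 / h)"
    proof (intro mult_right_mono ennreal_leI mult_left_mono)
      \<comment> \<open>This is where the tent of height of order \<open>h\<^sup>2\<close> costs
        only a factor 2 in the logarithm.\<close>
      have "1 / (12 * \<rho>) = (2 / h)\<^sup>2"
        using h by (simp add: \<rho>_def power2_eq_square)
      then have "ln (1 / (12 * \<rho>)) = 2 * (ln 2 - ln h)"
        using h by (simp add: ln_realpow ln_div)
      moreover have "ln 2 \<le> (1 :: real)"
        using ln_le_minus_one[of "2 :: real"] by simp
      moreover have "ln h \<le> 0"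
        using h by simp
      ultimately show "1 + ln (1 / (12 * \<rho>)) \<le> 3 * log_weight z"
        by (simp add: log_weight_def h_def)
    qed (use M pos in auto)
    also have "\<dots> = ennreal (K4 * (M * (3 * log_weight z)) * (K3 / h))"
      using pos M h log_weight_ge_1[OF z] by (intro ennreal_mult[symmetric]) auto
    finally have "K5 / h * g z \<le> K4 * (M * (3 * log_weight z)) * (K3 / h)"
      using pos M h log_weight_ge_1[OF z] by (subst (asm) ennreal_le_iff) auto
    then show "g z \<le> 3 * K3 * K4 / K5 * M * log_weight z"
      using h pos by (simp add: field_simps)
  qed (use pos in auto)
qed

text \<open>\<open>sqrt (M\<^sup>2 + u\<^sup>2)\<close> is a smooth subharmonic substitute for \<open>|u|\<close>.\<close>

lemma harmonic_smooth_abs: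
  fixes b :: "'a::euclidean_space \<Rightarrow> complex" and c \<theta> :: complex
  assumes harm: "harmonic_on S b" and M: "0 < M"
  defines "g \<equiv> \<lambda>x. sqrt (M\<^sup>2 + (Re (\<theta> * (b x - c)))\<^sup>2)"
  obtains g1 g2 where
    "\<And>x. x \<in> S \<Longrightarrow> (g has_derivative (\<lambda>h. \<Sum>e\<in>Basis. (h \<bullet> e) * g1 e x)) (at x)"
    "dir_C2_on S g g1 g2" "\<And>x. x \<in> S \<Longrightarrow> 0 \<le> (\<Sum>e\<in>Basis. g2 e x)"
proof -
  obtain b' :: "'a \<Rightarrow> 'a \<Rightarrow>\<^sub>L complex" and b'' :: "'a \<Rightarrow> 'a \<Rightarrow>\<^sub>L 'a \<Rightarrow>\<^sub>L complex" where
    b': "\<And>x. x \<in> S \<Longrightarrow> (b has_derivative blinfun_apply (b' x)) (at x)" and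
    b'': "\<And>x. x \<in> S \<Longrightarrow> (b' has_derivative blinfun_apply (b'' x)) (at x)" and
    cont: "continuous_on S b''" and
    lap: "\<And>x. x \<in> S \<Longrightarrow> (\<Sum>e\<in>Basis. blinfun_apply (blinfun_apply (b'' x) e) e) = 0"
    using harm unfolding harmonic_on_def by blast
  define u where "u x = Re (\<theta> * (b x - c))" for x
  define u1 where "u1 e x = Re (\<theta> * blinfun_apply (b' x) e)" for e x
  define u2 where "u2 e x = Re (\<theta> * blinfun_apply (blinfun_apply (b'' x) e) e)" for e x
  have g: "g x = sqrt (M\<^sup>2 + (u x)\<^sup>2)" for x by (simp add: g_def u_def)
  have rad: "0 < M\<^sup>2 + (u x)\<^sup>2" for x
    using M by (intro add_pos_nonneg) auto
  have gpos: "0 < g x" for x using rad by (simp add: g)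
  have gsq: "(g x)\<^sup>2 = M\<^sup>2 + (u x)\<^sup>2" for x using rad[of x] by (simp add: g)
  define g1 where "g1 e x = u x * u1 e x / g x" for e x
  define g2 where "g2 e x = ((u1 e x)\<^sup>2 + u x * u2 e x) / g x - u x * u1 e x * (u x * u1 e x / g x) / (g x)\<^sup>2" for e x
  have contb: "continuous_on S b"
    using b' has_derivative_continuous by (intro continuous_at_imp_continuous_on) blast
  have contb': "continuous_on S b'"
    using b'' has_derivative_continuous by (intro continuous_at_imp_continuous_on) blast
  have contu: "continuous_on S u"
    unfolding u_def[abs_def] by (intro continuous_intros contb)
  have contu1: "continuous_on S (u1 e)" for e
    unfolding u1_def[abs_def] by (intro continuous_intros contb')
  have contu2: "continuous_on S (u2 e)" for e
    unfolding u2_def[abs_def] by (intro continuous_intros cont)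
  have contg: "continuous_on S g"
    unfolding g by (intro continuous_intros contu)
  have u1_rep: "Re (\<theta> * blinfun_apply (b' x) h) = (\<Sum>e\<in>Basis. (h \<bullet> e) * u1 e x)" for x h
  proof -
    have "blinfun_apply (b' x) h = blinfun_apply (b' x) (\<Sum>e\<in>Basis. (h \<bullet> e) *\<^sub>R e)"
      by (simp add: euclidean_representation)
    also have "\<dots> = (\<Sum>e\<in>Basis. (h \<bullet> e) *\<^sub>R blinfun_apply (b' x) e)"
      by (simp add: blinfun.sum_right blinfun.scaleR_right)
    finally show ?thesis
      by (simp add: u1_def sum_distrib_left)
  qed
  have du: "(u has_derivative (\<lambda>h. \<Sum>e\<in>Basis. (h \<bullet> e) * u1 e x)) (at x)" if "x \<in> S" for x
  proof -
    have "(u has_derivative (\<lambda>h. Re (\<theta> * (blinfun_apply (b' x) h - 0)))) (at x)"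
      unfolding u_def[abs_def] by (intro derivative_intros b' that)
    then show ?thesis by (simp only: diff_0_right u1_rep)
  qed
  have dg: "(g has_derivative (\<lambda>h. \<Sum>e\<in>Basis. (h \<bullet> e) * g1 e x)) (at x)" if x: "x \<in> S" for x
  proof -
    have d1: "(sqrt has_real_derivative inverse (sqrt (M\<^sup>2 + (u x)\<^sup>2)) / 2) (at (M\<^sup>2 + (u x)\<^sup>2))"
      by (rule DERIV_real_sqrt[OF rad])
    have d2: "((\<lambda>s. M\<^sup>2 + s\<^sup>2) has_real_derivative 2 * u x) (at (u x))"
      using DERIV_add[OF DERIV_const DERIV_pow[of 2 "u x"], of "M\<^sup>2"] by simp
    have "((\<lambda>s. sqrt (M\<^sup>2 + s\<^sup>2)) has_real_derivative inverse (sqrt (M\<^sup>2 + (u x)\<^sup>2)) / 2 * (2 * u x)) (at (u x))"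
      using DERIV_chain2[where f=sqrt and g="\<lambda>s. M\<^sup>2 + s\<^sup>2", OF d1 d2] .
    moreover have "inverse (sqrt (M\<^sup>2 + (u x)\<^sup>2)) / 2 * (2 * u x) = u x / g x"
      unfolding g by (simp add: inverse_eq_divide)
    ultimately have "((\<lambda>s. sqrt (M\<^sup>2 + s\<^sup>2)) has_derivative (*) (u x / g x)) (at (u x))"
      by (simp only: has_field_derivative_def)
    from has_derivative_compose[OF du[OF x] this]
    have "(g has_derivative (\<lambda>h. u x / g x * (\<Sum>e\<in>Basis. (h \<bullet> e) * u1 e x))) (at x)"
      unfolding g[symmetric] .
    moreover have "u x / g x * (\<Sum>e\<in>Basis. (h \<bullet> e) * u1 e x) = (\<Sum>e\<in>Basis. (h \<bullet> e) * g1 e x)" for h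
      unfolding sum_distrib_left g1_def by (intro sum.cong) auto
    ultimately show ?thesis
      by (simp only:)
  qed
  have line: "((\<lambda>t. x + t *\<^sub>R e) has_derivative (\<lambda>t. t *\<^sub>R e)) (at 0)" for x e :: 'a
    by (auto intro!: derivative_eq_intros)
  have du_e: "((\<lambda>t. u (x + t *\<^sub>R e)) has_real_derivative u1 e x) (at 0)" if "x \<in> S" for x e
  proof -
    have "(b has_derivative blinfun_apply (b' x)) (at (x + 0 *\<^sub>R e))"
      using b'[OF that] by simp
    from has_derivative_compose[OF line this]
    have "((\<lambda>t. b (x + t *\<^sub>R e)) has_derivative (\<lambda>t. t *\<^sub>R blinfun_apply (b' x) e)) (at 0)"
      by (simp add: blinfun.scaleR_right)
    then have "((\<lambda>t. u (x + t *\<^sub>R e)) has_derivative (\<lambda>t. Re (\<theta> * (t *\<^sub>R blinfun_apply (b' x) e - 0)))) (at 0)"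
      unfolding u_def by (intro derivative_intros)
    moreover have "(\<lambda>t. Re (\<theta> * (t *\<^sub>R blinfun_apply (b' x) e - 0))) = (*) (u1 e x)"
      by (rule HOL.ext) (simp add: u1_def algebra_simps)
    ultimately show ?thesis
      by (simp only: has_field_derivative_def)
  qed
  have du1_e: "((\<lambda>t. u1 e (x + t *\<^sub>R e)) has_real_derivative u2 e x) (at 0)" if "x \<in> S" for x e
  proof -
    have "(b' has_derivative blinfun_apply (b'' x)) (at (x + 0 *\<^sub>R e))"
      using b''[OF that] by simp
    from has_derivative_compose[OF line this]
    have "((\<lambda>t. b' (x + t *\<^sub>R e)) has_derivative (\<lambda>t. t *\<^sub>R blinfun_apply (b'' x) e)) (at 0)"
      by (simp add: blinfun.scaleR_right)
    from bounded_linear.has_derivative[OF blinfun.bounded_linear_left this, of e]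
    have "((\<lambda>t. blinfun_apply (b' (x + t *\<^sub>R e)) e) has_derivative (\<lambda>t. t *\<^sub>R blinfun_apply (blinfun_apply (b'' x) e) e)) (at 0)"
      by (simp add: blinfun.scaleR_left)
    then have "((\<lambda>t. u1 e (x + t *\<^sub>R e)) has_derivative (\<lambda>t. Re (\<theta> * (t *\<^sub>R blinfun_apply (blinfun_apply (b'' x) e) e)))) (at 0)"
      unfolding u1_def by (intro derivative_intros)
    moreover have "(\<lambda>t. Re (\<theta> * (t *\<^sub>R blinfun_apply (blinfun_apply (b'' x) e) e))) = (*) (u2 e x)"
      by (rule HOL.ext) (simp add: u2_def algebra_simps)
    ultimately show ?thesis
      by (simp only: has_field_derivative_def)
  qed
  have dg_e: "((\<lambda>t. g (x + t *\<^sub>R e)) has_real_derivative g1 e x) (at 0)" if x: "x \<in> S" and e: "e \<in> Basis" for x e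
  proof -
    have "(g has_derivative (\<lambda>h. \<Sum>e\<in>Basis. (h \<bullet> e) * g1 e x)) (at (x + 0 *\<^sub>R e))"
      using dg[OF x] by simp
    from has_derivative_compose[OF line this]
    have "((\<lambda>t. g (x + t *\<^sub>R e)) has_derivative (\<lambda>t. \<Sum>e'\<in>Basis. (t *\<^sub>R e \<bullet> e') * g1 e' x)) (at 0)" .
    moreover have "(\<lambda>t. \<Sum>e'\<in>Basis. (t *\<^sub>R e \<bullet> e') * g1 e' x) = (*) (g1 e x)"
    proof (rule HOL.ext)
      fix t
      have "(\<Sum>e'\<in>Basis. (t *\<^sub>R e \<bullet> e') * g1 e' x) = (\<Sum>e'\<in>Basis. if e' = e then t * g1 e x else 0)"
        using e by (intro sum.cong) (auto simp: inner_Basis)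
      then show "(\<Sum>e'\<in>Basis. (t *\<^sub>R e \<bullet> e') * g1 e' x) = g1 e x * t"
        using e by simp
    qed
    ultimately show ?thesis
      by (simp only: has_field_derivative_def)
  qed
  have "dir_C2_on S g g1 g2"
    unfolding dir_C2_on_def
  proof (intro conjI ballI)
    show "continuous_on S g" by (rule contg)
    fix e :: 'a assume e: "e \<in> Basis"
    show "continuous_on S (g1 e)" "continuous_on S (g2 e)"
      unfolding g1_def[abs_def] g2_def[abs_def]
      by (intro continuous_intros contu contu1 contu2 contg; use gpos in \<open>simp add: less_imp_neq[symmetric]\<close>)+
    fix x assume x: "x \<in> S"
    show "((\<lambda>t. g (x + t *\<^sub>R e)) has_real_derivative g1 e x) (at 0)"
      by (rule dg_e[OF x e])
    have "g (x + 0 *\<^sub>R e) \<noteq> 0"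
      using gpos[of x] by simp
    from DERIV_divide[OF DERIV_mult[OF du_e[OF x, of e] du1_e[OF x, of e]] dg_e[OF x e] this]
    have "((\<lambda>t. g1 e (x + t *\<^sub>R e)) has_real_derivative
        ((u1 e x * u1 e x + u2 e x * u x) * g x - u x * u1 e x * g1 e x) / (g x * g x)) (at 0)"
      by (simp add: g1_def)
    then show "((\<lambda>t. g1 e (x + t *\<^sub>R e)) has_real_derivative g2 e x) (at 0)"
      by (rule DERIV_cong) (use gpos[of x] in \<open>simp add: g2_def g1_def field_simps power2_eq_square\<close>)
  qed
  moreover have "0 \<le> (\<Sum>e\<in>Basis. g2 e x)" if x: "x \<in> S" for x
  proof -
    \<comment> \<open>The quotient rule simplifies through
      \<open>(g x)\<^sup>2 - (u x)\<^sup>2 = M\<^sup>2\<close>. The first term is a square, and the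
      second vanishes after summation because \<open>u\<close> is harmonic.\<close>
    have "g2 e x = (u1 e x)\<^sup>2 * M\<^sup>2 / (g x) ^ 3 + u x / g x * u2 e x" for e
    proof -
      have "g2 e x = (u1 e x)\<^sup>2 * ((g x)\<^sup>2 - (u x)\<^sup>2) / (g x) ^ 3 + u x / g x * u2 e x"
        using gpos[of x] by (simp add: g2_def field_simps power2_eq_square power3_eq_cube)
      then show ?thesis
        by (simp add: gsq)
    qed
    then have "(\<Sum>e\<in>Basis. g2 e x) = (\<Sum>e\<in>Basis. (u1 e x)\<^sup>2 * M\<^sup>2 / (g x) ^ 3) + u x / g x * (\<Sum>e\<in>Basis. u2 e x)"
      by (simp add: sum.distrib sum_distrib_left)
    moreover have "(\<Sum>e\<in>Basis. u2 e x) = 0"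
    proof -
      have "(\<Sum>e\<in>Basis. u2 e x) = Re (\<theta> * (\<Sum>e\<in>Basis. blinfun_apply (blinfun_apply (b'' x) e) e))"
        by (simp add: u2_def sum_distrib_left)
      then show ?thesis
        by (simp add: lap[OF x])
    qed
    ultimately show ?thesis
      using gpos[of x] by (auto intro!: sum_nonneg)
  qed
  ultimately show ?thesis
    using that dg by blast
qed

lemma harmonic_on_imp_continuous_on: "harmonic_on S b \<Longrightarrow> continuous_on S b"
  unfolding harmonic_on_def by (meson continuous_at_imp_continuous_on has_derivative_continuous)

lemma emeasure_kball_pos:
  fixes \<zeta> :: "complex ^ 'n"
  assumes "norm \<zeta> = 1" "0 < \<delta>" "\<delta> \<le> 1"
  shows "emeasure lborel (kball \<zeta> \<delta>) \<noteq> 0"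
proof -
  obtain C where C: "0 < C" and C': "\<forall>(w :: complex ^ 'n) \<rho>. norm w \<le> 1 \<longrightarrow> 0 < \<rho> \<longrightarrow> \<rho> \<le> 1/2 \<longrightarrow> 1 - norm w \<le> 4 * \<rho> \<longrightarrow>
     ennreal (C * \<rho> ^ (CARD('n) + 1)) \<le> emeasure lborel (kshell w \<rho>)"
    using emeasure_kshell_ge by blast
  have "ennreal (C * (\<delta> / 6) ^ (CARD('n) + 1)) \<le> emeasure lborel (kshell \<zeta> (\<delta> / 6))"
    using assms by (intro C'[rule_format]) auto
  also have "\<dots> \<le> emeasure lborel (kball \<zeta> \<delta>)"
    by (intro emeasure_mono) (auto simp: kshell_def)
  finally have "ennreal (C * (\<delta> / 6) ^ (CARD('n) + 1)) \<le> emeasure lborel (kball \<zeta> \<delta>)" .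
  moreover have "0 < C * (\<delta> / 6) ^ (CARD('n) + 1)"
    using C assms by simp
  ultimately show ?thesis
    by (metis ennreal_eq_0_iff le_zero_eq linorder_not_le)
qed

text \<open>Passes from the completed, restricted measure of the definitions to Borel functions on
  \<open>lborel\<close>, where Fubini is used.\<close>

lemma nn_integral_lebesgue_on_eq:
  fixes f :: "'a::euclidean_space \<Rightarrow> ennreal"
  assumes [measurable]: "f0 \<in> borel_measurable borel" "A \<in> sets borel"
    and eq: "\<And>w. w \<in> A \<Longrightarrow> f w = f0 w"
  shows "(\<integral>\<^sup>+w. f w \<partial>lebesgue_on A) = (\<integral>\<^sup>+w\<in>A. f0 w \<partial>lborel)"
proof -
  have "(\<integral>\<^sup>+w. f w \<partial>lebesgue_on A) = (\<integral>\<^sup>+w. f w * indicator A w \<partial>lebesgue)"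
    by (rule nn_integral_restrict_space) simp
  also have "\<dots> = (\<integral>\<^sup>+w. f0 w * indicator A w \<partial>lebesgue)"
    using eq by (intro nn_integral_cong) (auto simp: indicator_def)
  also have "\<dots> = (\<integral>\<^sup>+w. f0 w * indicator A w \<partial>lborel)"
    by (rule nn_integral_completion)
  finally show ?thesis .
qed

text \<open>The tent has finite nonzero measure, which allows clearing the denominator in
  \<open>ennreal\<close>.\<close>

lemma bmo_norm_tent_le:
  fixes b b0 :: "complex ^ 'n \<Rightarrow> complex"
  assumes [measurable]: "b0 \<in> borel_measurable borel" and b0: "\<And>w. w \<in> ball 0 1 \<Longrightarrow> b w = b0 w"
    and M: "bmo_norm b \<le> ennreal M" and z: "z \<in> ball 0 1"
    and T: "carleson_tent z = T" "T \<in> sets borel" "T \<subseteq> ball 0 1" "emeasure lborel T \<noteq> 0"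
  shows "(\<integral>\<^sup>+w\<in>T. ennreal (cmod (b0 w - mean_on T b)) \<partial>lborel) \<le> ennreal M * emeasure lborel T"
proof -
  define X where "X = (\<integral>\<^sup>+w\<in>T. ennreal (cmod (b0 w - mean_on T b)) \<partial>lborel)"
  define a where "a = emeasure lborel T"
  have "X = (\<integral>\<^sup>+w. ennreal (cmod (b w - mean_on T b)) \<partial>lebesgue_on T)"
    unfolding X_def using T(2,3) b0 by (intro nn_integral_lebesgue_on_eq[symmetric]) auto
  then have "X / a = (\<integral>\<^sup>+w. ennreal (cmod (b w - mean_on (carleson_tent z) b)) \<partial>lebesgue_on (carleson_tent z)) / emeasure lebesgue (carleson_tent z)"
    using T(2) by (simp add: T(1) a_def)
  also have "\<dots> \<le> bmo_norm b"
    unfolding bmo_norm_def using z by (rule SUP_upper)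
  finally have "X / a \<le> ennreal M"
    using M by (rule order_trans)
  then have "X / a * a \<le> ennreal M * a"
    by (rule mult_right_mono) simp
  moreover have "a \<noteq> top"
    using emeasure_mono[OF T(3), of lborel] emeasure_lborel_ball_finite[of "0 :: complex ^ 'n" 1]
    by (auto simp: a_def top_unique)
  then have "X / a * a = X"
    using T(4) ennreal_divide_self[of a] by (simp add: a_def ennreal_divide_times less_top)
  ultimately show ?thesis
    by (simp add: X_def a_def)
qed

text \<open>The phase is chosen for the one point \<open>z\<close>, so that
  \<open>|b z - c| \<le> g z\<close>, while everywhere \<open>g \<le> M + |b - c|\<close>. Tent
  integrals of \<open>|b - c|\<close> are known, and the extra \<open>M\<close> has the size of the
  oscillation itself. The constants do not involve the phase, so the choice is free at each
  point.\<close>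

lemma harmonic_bmo_growth:
  "\<exists>C>0. \<forall>(b :: complex ^ 'n \<Rightarrow> complex) M z. harmonic_on (ball 0 1) b \<longrightarrow> 0 < M \<longrightarrow> bmo_norm b \<le> ennreal M \<longrightarrow> norm z < 1 \<longrightarrow>
     cmod (b z - mean_on (ball 0 1) b) \<le> C * M * log_weight z"
proof -
  define N where "N = CARD('n) + 1"
  obtain C1 where C1: "0 < C1" and C1': "\<forall>(z :: complex ^ 'n) r. norm z \<le> 1 \<longrightarrow> 0 < r \<longrightarrow>
     emeasure lborel (kball z r) \<le> ennreal (C1 * r ^ N)"
    unfolding N_def using emeasure_kball_le by blast
  obtain Ct where Ct: "0 < Ct" and Ct': "\<forall>(b :: complex ^ 'n \<Rightarrow> complex) c M \<zeta> r. b \<in> borel_measurable borel \<longrightarrow> 0 < M \<longrightarrow>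
     (\<integral>\<^sup>+w\<in>ball 0 1. ennreal (cmod (b w - c)) \<partial>lborel) \<le> ennreal M * emeasure lborel (ball (0 :: complex ^ 'n) 1) \<longrightarrow>
     (\<forall>\<zeta> \<delta>. norm \<zeta> = 1 \<longrightarrow> 0 < \<delta> \<longrightarrow> \<delta> < 1 \<longrightarrow>
        (\<exists>m. (\<integral>\<^sup>+w\<in>kball \<zeta> \<delta>. ennreal (cmod (b w - m)) \<partial>lborel) \<le> ennreal M * emeasure lborel (kball \<zeta> \<delta>))) \<longrightarrow>
     norm \<zeta> = 1 \<longrightarrow> 0 < r \<longrightarrow> r < 1 \<longrightarrow>
     (\<integral>\<^sup>+w\<in>kball \<zeta> r. ennreal (cmod (b w - c)) \<partial>lborel) \<le> ennreal (Ct * M * (r ^ N * (1 + ln (1 / r))))"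
    unfolding N_def using nn_integral_tent_le by blast
  obtain Cg where Cg: "0 < Cg" and Cg': "\<forall>(g :: complex ^ 'n \<Rightarrow> real) g1 g2 M z. 0 < M \<longrightarrow> (\<forall>x. 0 \<le> g x) \<longrightarrow>
     (\<forall>x\<in>ball 0 1. (g has_derivative (\<lambda>h. \<Sum>e\<in>Basis. (h \<bullet> e) * g1 e x)) (at x)) \<longrightarrow>
     dir_C2_on (ball 0 1) g g1 g2 \<longrightarrow> (\<forall>x\<in>ball 0 1. 0 \<le> (\<Sum>e\<in>Basis. g2 e x)) \<longrightarrow>
     (\<forall>\<zeta> r. norm \<zeta> = 1 \<longrightarrow> 0 < r \<longrightarrow> r < 1 \<longrightarrow>
        (\<integral>\<^sup>+w\<in>kball \<zeta> r. ennreal (g w) \<partial>lborel) \<le> ennreal (M * (r ^ N * (1 + ln (1 / r))))) \<longrightarrow>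
     norm z < 1 \<longrightarrow> g z \<le> Cg * M * log_weight z"
    unfolding N_def using subharmonic_growth by blast
  show ?thesis
  proof (intro exI[of _ "Cg * (C1 + Ct)"] conjI allI impI)
    fix b :: "complex ^ 'n \<Rightarrow> complex" and M :: real and z :: "complex ^ 'n"
    assume harm: "harmonic_on (ball 0 1) b" and M: "0 < M" and bmo: "bmo_norm b \<le> ennreal M" and z: "norm z < 1"
    \<comment> \<open>Cut off to 0 outside the ball, where the values of \<open>b\<close> are
      arbitrary; continuity on the ball then makes \<open>b0\<close> Borel.\<close>
    define b0 where "b0 w = indicator (ball 0 1) w *\<^sub>R b w" for w
    have b0: "b w = b0 w" if "w \<in> ball 0 1" for w
      using that by (simp add: b0_def)
    have [measurable]: "b0 \<in> borel_measurable borel"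
      unfolding b0_def[abs_def] using harmonic_on_imp_continuous_on[OF harm]
      by (intro borel_measurable_continuous_on_indicator) auto
    define c where "c = mean_on (ball 0 1) b"
    have H0: "(\<integral>\<^sup>+w\<in>ball 0 1. ennreal (cmod (b0 w - c)) \<partial>lborel) \<le> ennreal M * emeasure lborel (ball (0 :: complex ^ 'n) 1)"
      unfolding c_def
    proof (rule bmo_norm_tent_le[OF _ b0 bmo, of 0])
      show "emeasure lborel (ball (0 :: complex ^ 'n) 1) \<noteq> 0"
        using content_ball_pos[of 1 "0 :: complex ^ 'n"] by (auto simp: measure_def)
    qed (auto simp: carleson_tent_def)
    have H: "\<exists>m. (\<integral>\<^sup>+w\<in>kball \<zeta> \<delta>. ennreal (cmod (b0 w - m)) \<partial>lborel) \<le> ennreal M * emeasure lborel (kball \<zeta> \<delta>)"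
      if "norm \<zeta> = 1" "0 < \<delta>" "\<delta> < 1" for \<zeta> \<delta>
    proof (intro exI[of _ "mean_on (kball \<zeta> \<delta>) b"] bmo_norm_tent_le[OF _ b0 bmo, of "(1 - \<delta>) *\<^sub>R \<zeta>"])
      show "carleson_tent ((1 - \<delta>) *\<^sub>R \<zeta>) = kball \<zeta> \<delta>"
        using that by (rule carleson_tent_eq_kball)
      show "emeasure lborel (kball \<zeta> \<delta>) \<noteq> 0"
        using that by (intro emeasure_kball_pos) auto
    qed (use that in \<open>auto simp: kball_iff\<close>)
    obtain \<theta> where \<theta>: "cmod \<theta> = 1" "\<theta> * (b z - c) = of_real (cmod (b z - c))"
      by (rule unimodular_rotation)
    define g where "g x = sqrt (M\<^sup>2 + (Re (\<theta> * (b x - c)))\<^sup>2)" for x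
    obtain g1 g2 where g: "\<And>x. x \<in> ball 0 1 \<Longrightarrow> (g has_derivative (\<lambda>h. \<Sum>e\<in>Basis. (h \<bullet> e) * g1 e x)) (at x)"
      "dir_C2_on (ball 0 1) g g1 g2" "\<And>x. x \<in> ball 0 1 \<Longrightarrow> 0 \<le> (\<Sum>e\<in>Basis. g2 e x)"
      unfolding g_def[abs_def] by (rule harmonic_smooth_abs[OF harm M]) blast
    have g_le: "g x \<le> M + cmod (b x - c)" for x
    proof -
      have "g x \<le> sqrt (M\<^sup>2) + sqrt ((Re (\<theta> * (b x - c)))\<^sup>2)"
        unfolding g_def by (rule sqrt_add_le_add_sqrt) auto
      also have "\<dots> \<le> M + cmod (b x - c)"
        using abs_Re_le_cmod[of "\<theta> * (b x - c)"] M by (simp add: norm_mult \<theta>(1))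
      finally show ?thesis .
    qed
    have gint: "(\<integral>\<^sup>+w\<in>kball \<zeta> r. ennreal (g w) \<partial>lborel) \<le> ennreal ((C1 + Ct) * M * (r ^ N * (1 + ln (1 / r))))"
      if \<zeta>: "norm \<zeta> = 1" and r: "0 < r" "r < 1" for \<zeta> r
    proof -
      have ln0: "0 \<le> ln (1 / r)" using r by simp
      have "(\<integral>\<^sup>+w\<in>kball \<zeta> r. ennreal (g w) \<partial>lborel)
          \<le> (\<integral>\<^sup>+w. ennreal M * indicator (kball \<zeta> r) w + ennreal (cmod (b0 w - c)) * indicator (kball \<zeta> r) w \<partial>lborel)"
      proof (rule nn_integral_mono)
        fix w
        show "ennreal (g w) * indicator (kball \<zeta> r) w
            \<le> ennreal M * indicator (kball \<zeta> r) w + ennreal (cmod (b0 w - c)) * indicator (kball \<zeta> r) w"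
        proof (cases "w \<in> kball \<zeta> r")
          case True
          then have "b w = b0 w" by (intro b0) (simp add: kball_iff)
          then show ?thesis
            using True g_le[of w] M by (simp add: ennreal_leI flip: ennreal_plus)
        qed simp
      qed
      also have "\<dots> = ennreal M * emeasure lborel (kball \<zeta> r) + (\<integral>\<^sup>+w\<in>kball \<zeta> r. ennreal (cmod (b0 w - c)) \<partial>lborel)"
        by (subst nn_integral_add) (auto simp: nn_integral_cmult_indicator)
      also have "\<dots> \<le> ennreal M * ennreal (C1 * r ^ N) + ennreal (Ct * M * (r ^ N * (1 + ln (1 / r))))"
        using \<zeta> r H by (intro add_mono mult_left_mono C1'[rule_format] Ct'[rule_format, OF _ M H0]) auto
      also have "\<dots> = ennreal (M * (C1 * r ^ N) + Ct * M * (r ^ N * (1 + ln (1 / r))))"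
        using M C1 Ct r ln0 by (subst ennreal_mult[symmetric], simp, simp, subst ennreal_plus[symmetric]) auto
      also have "\<dots> \<le> ennreal ((C1 + Ct) * M * (r ^ N * (1 + ln (1 / r))))"
      proof (rule ennreal_leI)
        have "M * (C1 * r ^ N) * 1 \<le> M * (C1 * r ^ N) * (1 + ln (1 / r))"
          using M C1 r ln0 by (intro mult_left_mono) auto
        then show "M * (C1 * r ^ N) + Ct * M * (r ^ N * (1 + ln (1 / r))) \<le> (C1 + Ct) * M * (r ^ N * (1 + ln (1 / r)))"
          by (simp add: algebra_simps)
      qed
      finally show ?thesis .
    qed
    have "g z \<le> Cg * ((C1 + Ct) * M) * log_weight z"
    proof (rule Cg'[rule_format])
      show "0 < (C1 + Ct) * M" using C1 Ct M by simp
      show "0 \<le> g x" for x by (simp add: g_def)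
    qed (use g gint z in auto)
    moreover have "cmod (b z - c) \<le> g z"
    proof -
      have "Re (\<theta> * (b z - c)) = cmod (b z - c)" by (simp add: \<theta>(2))
      then show ?thesis
        unfolding g_def by (intro real_le_rsqrt) simp
    qed
    ultimately show "cmod (b z - mean_on (ball 0 1) b) \<le> Cg * (C1 + Ct) * M * log_weight z"
      by (simp add: c_def mult.assoc)
  qed (use Cg C1 Ct in auto)
qed

subsection \<open>The commutator\<close>

lemma hermitian_inner_ne_1: "norm z < 1 \<Longrightarrow> norm w \<le> 1 \<Longrightarrow> hermitian_inner z w \<noteq> 1"
  using hdist_pos[of z w] by (auto simp: hdist_def)

lemma cmod_bergman_kernel:
  fixes z w :: "complex ^ 'n"
  shows "cmod (bergman_kernel z w) = fact CARD('n) / pi ^ CARD('n) * (1 / hdist z w ^ (CARD('n) + 1))"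
  by (simp add: bergman_kernel_def hdist_def norm_divide norm_power norm_mult)

text \<open>The commutator does not change when a constant \<open>m\<close> is subtracted from \<open>b\<close>.\<close>

lemma commutator_bound:
  fixes b f :: "complex ^ 'n \<Rightarrow> complex" and F :: "complex ^ 'n \<Rightarrow> real"
  assumes b [measurable]: "b \<in> borel_measurable (lebesgue_on (ball 0 1))"
    and f [measurable]: "f \<in> borel_measurable (lebesgue_on (ball 0 1))"
    and F [measurable]: "F \<in> borel_measurable borel" and F0: "\<And>w. 0 \<le> F w"
    and fF: "AE w in lborel. w \<in> ball 0 1 \<longrightarrow> cmod (f w) = N * F w" and N: "0 \<le> N"
    and bL: "\<And>w. norm w < 1 \<Longrightarrow> cmod (b w - m) \<le> K * log_weight w" and K: "0 \<le> K"
    and fin: "(\<integral>\<^sup>+w\<in>ball 0 1. ennreal (log_weight w * F w) \<partial>lborel) < \<infinity>"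
  shows "bergman_defined f" "bergman_defined (\<lambda>w. cnj (b w) * f w)"
    "\<And>z. norm z < 1 \<Longrightarrow> ennreal (cmod (bergman_commutator (\<lambda>w. cnj (b w)) f z))
      \<le> ennreal (fact CARD('n) / pi ^ CARD('n) * K * N) *
        (ennreal (log_weight z) * bergman_pos (\<lambda>w. ennreal (F w)) z + bergman_pos (\<lambda>w. ennreal (log_weight w * F w)) z)"
proof -
  define B where "B = ball (0 :: complex ^ 'n) 1"
  have [measurable]: "B \<in> sets borel" by (simp add: B_def)
  define M where "M = lebesgue_on B"
  have spM: "space M = B" by (simp add: M_def)
  have bf [measurable]: "b \<in> borel_measurable M" "f \<in> borel_measurable M"
    using b f by (simp_all add: M_def B_def)
  define c where "c = (fact CARD('n) / pi ^ CARD('n) :: real)"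
  have c: "0 < c" by (simp add: c_def)
  \<comment> \<open>\<open>f\<close> is only Lebesgue measurable. Its modulus agrees almost
    everywhere with the Borel function \<open>N * F\<close>, and all integrals are moved
    there.\<close>
  have nn: "(\<integral>\<^sup>+w. \<phi> w * ennreal (cmod (f w)) \<partial>M) = (\<integral>\<^sup>+w\<in>B. \<phi> w * ennreal (N * F w) \<partial>lborel)" for \<phi> :: "complex ^ 'n \<Rightarrow> ennreal"
  proof -
    have "(\<integral>\<^sup>+w. \<phi> w * ennreal (cmod (f w)) \<partial>M) = (\<integral>\<^sup>+w. \<phi> w * ennreal (cmod (f w)) * indicator B w \<partial>lebesgue)"
      unfolding M_def by (rule nn_integral_restrict_space) simp
    also have "\<dots> = (\<integral>\<^sup>+w. \<phi> w * ennreal (cmod (f w)) * indicator B w \<partial>lborel)"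
      by (rule nn_integral_completion)
    also have "\<dots> = (\<integral>\<^sup>+w\<in>B. \<phi> w * ennreal (N * F w) \<partial>lborel)"
      using fF by (intro nn_integral_cong_AE) (auto simp: B_def indicator_def)
    finally show ?thesis .
  qed
  have finf: "(\<integral>\<^sup>+w. ennreal (log_weight w) * ennreal (cmod (f w)) \<partial>M) < \<infinity>"
  proof -
    have "(\<integral>\<^sup>+w. ennreal (log_weight w) * ennreal (cmod (f w)) \<partial>M)
        = (\<integral>\<^sup>+w. ennreal N * (ennreal (log_weight w * F w) * indicator B w) \<partial>lborel)"
      unfolding nn
    proof (rule nn_integral_cong)
      fix w
      show "ennreal (log_weight w) * ennreal (N * F w) * indicator B w = ennreal N * (ennreal (log_weight w * F w) * indicator B w)"
      proof (cases "w \<in> B")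
        case True
        then have "0 \<le> log_weight w" using log_weight_ge_1[of w] by (simp add: B_def)
        then show ?thesis
          using True N F0[of w] by (simp add: ennreal_mult mult_ac)
      qed simp
    qed
    also have "\<dots> = ennreal N * (\<integral>\<^sup>+w\<in>B. ennreal (log_weight w * F w) \<partial>lborel)"
      by (rule nn_integral_cmult) measurable
    also have "\<dots> < \<infinity>"
      using fin by (simp add: B_def ennreal_mult_less_top)
    finally show ?thesis .
  qed
  have kern [measurable]: "bergman_kernel z \<in> borel_measurable M" if "norm z < 1" for z
  proof -
    have "continuous_on B (bergman_kernel z)"
      unfolding bergman_kernel_def[abs_def] using hermitian_inner_ne_1[OF that]
      by (intro continuous_intros) (auto simp: B_def)
    then show ?thesis
      unfolding M_def by (intro continuous_imp_measurable_on_sets_lebesgue) auto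
  qed
  \<comment> \<open>For fixed \<open>z\<close> the kernel is bounded by a multiple of
    \<open>1 / (1 - norm z) ^ (n + 1)\<close>, so integrability of \<open>log_weight * |f|\<close>
    is enough. It is used for the factors \<open>1\<close> and \<open>cnj b\<close>, both of at most
    logarithmic growth.\<close>
  have int: "integrable M (\<lambda>w. bergman_kernel z w * (a w * f w))"
    if z: "norm z < 1" and a [measurable]: "a \<in> borel_measurable M" and D: "0 \<le> D" "\<And>w. w \<in> B \<Longrightarrow> cmod (a w) \<le> D * log_weight w" for z a D
  proof (rule integrableI_bounded)
    note kern[OF z, measurable]
    show "(\<lambda>w. bergman_kernel z w * (a w * f w)) \<in> borel_measurable M"
      by measurable
    define E where "E = c * (1 / (1 - norm z) ^ (CARD('n) + 1)) * D"
    have E: "0 \<le> E" using c z D by (simp add: E_def)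
    have "(\<integral>\<^sup>+w. ennreal (norm (bergman_kernel z w * (a w * f w))) \<partial>M)
        \<le> (\<integral>\<^sup>+w. ennreal E * (ennreal (log_weight w) * ennreal (cmod (f w))) \<partial>M)"
    proof (rule nn_integral_mono)
      fix w assume "w \<in> space M"
      then have w: "w \<in> B" by (simp add: spM)
      have L: "0 \<le> log_weight w" using w log_weight_ge_1[of w] by (simp add: B_def)
      have "cmod (bergman_kernel z w) \<le> c * (1 / (1 - norm z) ^ (CARD('n) + 1))"
      proof -
        have "1 - norm z \<le> hdist z w" using w by (intro hdist_ge) (simp add: B_def)
        then have "1 / hdist z w ^ (CARD('n) + 1) \<le> 1 / (1 - norm z) ^ (CARD('n) + 1)"
          using z by (intro divide_left_mono power_mono mult_pos_pos zero_less_power) auto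
        then show ?thesis
          unfolding cmod_bergman_kernel c_def[symmetric] using c by (intro mult_left_mono) auto
      qed
      then have "cmod (bergman_kernel z w) * (cmod (a w) * cmod (f w)) \<le> c * (1 / (1 - norm z) ^ (CARD('n) + 1)) * ((D * log_weight w) * cmod (f w))"
        using D(2)[OF w] z c by (intro mult_mono mult_right_mono) auto
      then have "norm (bergman_kernel z w * (a w * f w)) \<le> E * (log_weight w * cmod (f w))"
        by (simp add: E_def norm_mult mult_ac)
      then have "ennreal (norm (bergman_kernel z w * (a w * f w))) \<le> ennreal (E * (log_weight w * cmod (f w)))"
        by (rule ennreal_leI)
      also have "\<dots> = ennreal E * (ennreal (log_weight w) * ennreal (cmod (f w)))"
        using E L by (simp add: ennreal_mult)
      finally show "ennreal (norm (bergman_kernel z w * (a w * f w))) \<le> ennreal E * (ennreal (log_weight w) * ennreal (cmod (f w)))" .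
    qed
    also have "\<dots> = ennreal E * (\<integral>\<^sup>+w. ennreal (log_weight w) * ennreal (cmod (f w)) \<partial>M)"
    proof (rule nn_integral_cmult)
      have "log_weight \<in> borel_measurable M"
        unfolding M_def by (intro measurable_restrict_space1 measurable_completion) simp
      then show "(\<lambda>w. ennreal (log_weight w) * ennreal (cmod (f w))) \<in> borel_measurable M"
        by measurable
    qed
    also have "\<dots> < \<infinity>"
      using finf by (simp add: ennreal_mult_less_top)
    finally show "(\<integral>\<^sup>+w. ennreal (norm (bergman_kernel z w * (a w * f w))) \<partial>M) < \<infinity>" .
  qed
  have int1: "integrable M (\<lambda>w. bergman_kernel z w * f w)" if z: "norm z < 1" for z
  proof -
    have "integrable M (\<lambda>w. bergman_kernel z w * (1 * f w))"
      by (rule int[OF z, where D=1]) (auto simp: B_def log_weight_ge_1)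
    then show ?thesis by simp
  qed
  have int2: "integrable M (\<lambda>w. bergman_kernel z w * (cnj (b w) * f w))" if z: "norm z < 1" for z
  proof (rule int[OF z, of "\<lambda>w. cnj (b w)" "K + cmod m"])
    show "(\<lambda>w. cnj (b w)) \<in> borel_measurable M"
      using borel_measurable_continuous_on[OF continuous_on_cnj[OF continuous_on_id] bf(1)] by simp
    fix w assume w: "w \<in> B"
    have "cmod (b w) \<le> cmod (b w - m) + cmod m * 1"
      using norm_triangle_sub[of "b w" m] by simp
    also have "\<dots> \<le> K * log_weight w + cmod m * log_weight w"
      using bL[of w] w log_weight_ge_1[of w] by (intro add_mono mult_left_mono) (auto simp: B_def)
    finally show "cmod (cnj (b w)) \<le> (K + cmod m) * log_weight w"
      by (simp add: distrib_right)
  qed (use K in auto)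
  show "bergman_defined f" "bergman_defined (\<lambda>w. cnj (b w) * f w)"
    using int1 int2 by (auto simp: bergman_defined_def M_def B_def)
  fix z :: "complex ^ 'n" assume z: "norm z < 1"
  have Lz: "1 \<le> log_weight z" by (rule log_weight_ge_1[OF z])
  define k where "k w = 1 / hdist z w ^ (CARD('n) + 1)" for w
  have k0: "0 \<le> k w" for w by (simp add: k_def)
  have [measurable]: "k \<in> borel_measurable borel" unfolding k_def[abs_def] by measurable
  have eq: "bergman_commutator (\<lambda>w. cnj (b w)) f z
      = (\<integral>w. cnj (b z) * (bergman_kernel z w * f w) - bergman_kernel z w * (cnj (b w) * f w) \<partial>M)"
    unfolding bergman_commutator_def bergman_projection_def B_def[symmetric] M_def[symmetric]
    by (subst Bochner_Integration.integral_diff) (use int1[OF z] int2[OF z] in auto)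
  have "ennreal (cmod (bergman_commutator (\<lambda>w. cnj (b w)) f z))
      \<le> (\<integral>\<^sup>+w. ennreal (norm (cnj (b z) * (bergman_kernel z w * f w) - bergman_kernel z w * (cnj (b w) * f w))) \<partial>M)"
    unfolding eq using int1[OF z] int2[OF z] by (intro integral_norm_bound_ennreal) auto
  also have "\<dots> \<le> (\<integral>\<^sup>+w. ennreal (c * K * k w * (log_weight z + log_weight w)) * ennreal (cmod (f w)) \<partial>M)"
  proof (rule nn_integral_mono)
    fix w assume "w \<in> space M"
    then have w: "norm w < 1" by (simp add: spM B_def)
    have "norm (cnj (b z) * (bergman_kernel z w * f w) - bergman_kernel z w * (cnj (b w) * f w))
        = cmod (cnj ((b z - m) - (b w - m)) * (bergman_kernel z w * f w))"
      by (simp add: algebra_simps)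
    also have "\<dots> = cmod ((b z - m) - (b w - m)) * (c * k w * cmod (f w))"
      unfolding norm_mult complex_mod_cnj cmod_bergman_kernel c_def[symmetric] k_def[symmetric] by (simp add: mult.assoc)
    also have "\<dots> \<le> (K * log_weight z + K * log_weight w) * (c * k w * cmod (f w))"
      using norm_triangle_ineq4[of "b z - m" "b w - m"] bL[OF z] bL[OF w] c k0[of w]
      by (intro mult_right_mono) auto
    also have "\<dots> = (c * K * k w * (log_weight z + log_weight w)) * cmod (f w)"
      by (simp add: algebra_simps)
    finally have "ennreal (norm (cnj (b z) * (bergman_kernel z w * f w) - bergman_kernel z w * (cnj (b w) * f w)))
        \<le> ennreal ((c * K * k w * (log_weight z + log_weight w)) * cmod (f w))"
      by (rule ennreal_leI)
    then show "ennreal (norm (cnj (b z) * (bergman_kernel z w * f w) - bergman_kernel z w * (cnj (b w) * f w)))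
        \<le> ennreal (c * K * k w * (log_weight z + log_weight w)) * ennreal (cmod (f w))"
      using c K k0[of w] Lz log_weight_ge_1[OF w] by (subst ennreal_mult[symmetric]) auto
  qed
  also have "\<dots> = (\<integral>\<^sup>+w\<in>B. ennreal (c * K * k w * (log_weight z + log_weight w)) * ennreal (N * F w) \<partial>lborel)"
    by (rule nn)
  also have "\<dots> = (\<integral>\<^sup>+w. ennreal (c * K * N) * (ennreal (log_weight z) * (ennreal (F w) * ennreal (k w) * indicator B w)
      + ennreal (log_weight w * F w) * ennreal (k w) * indicator B w) \<partial>lborel)"
  proof (rule nn_integral_cong)
    fix w
    show "ennreal (c * K * k w * (log_weight z + log_weight w)) * ennreal (N * F w) * indicator B w
        = ennreal (c * K * N) * (ennreal (log_weight z) * (ennreal (F w) * ennreal (k w) * indicator B w)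
          + ennreal (log_weight w * F w) * ennreal (k w) * indicator B w)"
    proof (cases "w \<in> B")
      case True
      then have Lw: "1 \<le> log_weight w" by (intro log_weight_ge_1) (simp add: B_def)
      have "ennreal (c * K * k w * (log_weight z + log_weight w)) * ennreal (N * F w)
          = ennreal ((c * K * k w * (log_weight z + log_weight w)) * (N * F w))"
        using c K N k0[of w] Lz Lw F0[of w] by (intro ennreal_mult[symmetric]) auto
      also have "(c * K * k w * (log_weight z + log_weight w)) * (N * F w)
          = (c * K * N) * (log_weight z * (F w * k w) + log_weight w * F w * k w)"
        by (simp add: algebra_simps)
      also have "ennreal \<dots> = ennreal (c * K * N) * (ennreal (log_weight z) * (ennreal (F w) * ennreal (k w)) + ennreal (log_weight w * F w) * ennreal (k w))"
        using c K N k0[of w] Lz Lw F0[of w] by (simp add: ennreal_mult[symmetric] ennreal_plus[symmetric] del: ennreal_plus)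
      finally show ?thesis
        using True by simp
    qed simp
  qed
  also have "\<dots> = ennreal (c * K * N) * (ennreal (log_weight z) * (\<integral>\<^sup>+w\<in>B. ennreal (F w) * ennreal (k w) \<partial>lborel)
      + (\<integral>\<^sup>+w\<in>B. ennreal (log_weight w * F w) * ennreal (k w) \<partial>lborel))"
    by (subst nn_integral_cmult, measurable, subst nn_integral_add, measurable, subst nn_integral_cmult, measurable)
  finally show "ennreal (cmod (bergman_commutator (\<lambda>w. cnj (b w)) f z))
      \<le> ennreal (fact CARD('n) / pi ^ CARD('n) * K * N) *
        (ennreal (log_weight z) * bergman_pos (\<lambda>w. ennreal (F w)) z + bergman_pos (\<lambda>w. ennreal (log_weight w * F w)) z)"
    by (simp add: bergman_pos_def B_def k_def c_def)
qed

text \<open>The preceding estimates ask for positive bounds and an admissible constant in the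
  Luxemburg condition. Either norm may be 0 and an infimum is only approached, so both are enlarged
  by \<open>\<epsilon>\<close>, which then tends to 0.\<close>

lemma le_ennreal_mult_limit:
  fixes C \<beta> l :: real
  assumes "\<And>\<epsilon>. 0 < \<epsilon> \<Longrightarrow> X \<le> ennreal (C * (\<beta> + \<epsilon>) * (l + \<epsilon>))"
  shows "X \<le> ennreal (C * \<beta> * l)"
proof (rule tendsto_lowerbound)
  have "((\<lambda>\<epsilon>. C * (\<beta> + \<epsilon>) * (l + \<epsilon>)) \<longlongrightarrow> C * (\<beta> + 0) * (l + 0)) (at_right 0)"
    by (intro tendsto_intros)
  then show "((\<lambda>\<epsilon>. ennreal (C * (\<beta> + \<epsilon>) * (l + \<epsilon>))) \<longlongrightarrow> ennreal (C * \<beta> * l)) (at_right 0)"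
    by (simp add: tendsto_ennrealI)
  show "\<forall>\<^sub>F \<epsilon> in at_right 0. X \<le> ennreal (C * (\<beta> + \<epsilon>) * (l + \<epsilon>))"
    using assms by (auto simp: eventually_at_right_field intro: exI[of _ 1])
qed simp

theorem theorem6:
  "\<exists>C::real. C > 0 \<and>
     (\<forall>(b :: complex ^ 'n \<Rightarrow> complex) (f :: complex ^ 'n \<Rightarrow> complex).
        harmonic_on (ball 0 1) b \<and> b \<in> bmo \<and> f \<in> LlogL \<longrightarrow>
          bergman_defined f \<and> bergman_defined (\<lambda>w. cnj (b w) * f w) \<and>
          weak_L1_norm (bergman_commutator (\<lambda>w. cnj (b w)) f)
            \<le> ennreal C * bmo_norm b * LlogL_norm f)"
proof -
  define B where "B = ball (0 :: complex ^ 'n) 1"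
  have [measurable]: "B \<in> sets borel" by (simp add: B_def)
  obtain C1 where C1: "0 < C1" and C1': "\<forall>(b :: complex ^ 'n \<Rightarrow> complex) M z. harmonic_on B b \<longrightarrow> 0 < M \<longrightarrow> bmo_norm b \<le> ennreal M \<longrightarrow> norm z < 1 \<longrightarrow>
     cmod (b z - mean_on B b) \<le> C1 * M * log_weight z"
    unfolding B_def using harmonic_bmo_growth by blast
  obtain C2 where C2: "0 < C2" and C2': "\<forall>F :: complex ^ 'n \<Rightarrow> real. F \<in> borel_measurable borel \<longrightarrow> (\<forall>w. 0 \<le> F w) \<longrightarrow>
     (\<integral>\<^sup>+w\<in>B. ennreal (F w * log_plus (F w)) \<partial>lborel) \<le> 1 \<longrightarrow>
     (\<integral>\<^sup>+w\<in>B. ennreal (log_weight w * F w) \<partial>lborel) \<le> ennreal C2"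
    unfolding B_def using nn_integral_log_weight_le by blast
  obtain C3 where C3: "0 < C3" and C3': "\<forall>(F :: complex ^ 'n \<Rightarrow> real) t. F \<in> borel_measurable borel \<longrightarrow> (\<forall>w. 0 \<le> F w) \<longrightarrow>
     (\<integral>\<^sup>+w\<in>B. ennreal (F w * log_plus (F w)) \<partial>lborel) \<le> 1 \<longrightarrow> 0 < t \<longrightarrow>
     emeasure lborel {z \<in> B. ennreal t < ennreal (log_weight z) * bergman_pos (\<lambda>w. ennreal (F w)) z
        + bergman_pos (\<lambda>w. ennreal (log_weight w * F w)) z} \<le> ennreal (C3 / t)"
    unfolding B_def using log_weight_commutator_LlogL by blast
  define c where "c = (fact CARD('n) / pi ^ CARD('n) :: real)"
  have c: "0 < c" by (simp add: c_def)
  \<comment> \<open>The estimate in terms of any positive bound \<open>M\<close> for the BMO norm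
    and any admissible \<open>N\<close> in the Luxemburg condition, before passing to the
    infimum.\<close>
  have bound: "bergman_defined f \<and> bergman_defined (\<lambda>w. cnj (b w) * f w) \<and>
      weak_L1_norm (bergman_commutator (\<lambda>w. cnj (b w)) f) \<le> ennreal (C3 * c * C1 * M * N)"
    if harm: "harmonic_on B b" and M: "0 < M" "bmo_norm b \<le> ennreal M"
      and f: "f \<in> borel_measurable (lebesgue_on B)" and N: "0 < N"
      and fN: "(\<integral>\<^sup>+w. ennreal (cmod (f w) / N * log_plus (cmod (f w) / N)) \<partial>lebesgue_on B) \<le> 1"
    for b f :: "complex ^ 'n \<Rightarrow> complex" and M N :: real
  proof -
    \<comment> \<open>A Borel function equal to \<open>|f|\<close> almost everywhere in the ball;
      its absolute value, divided by \<open>N\<close>, is the normalised \<open>F\<close>.\<close>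
    have "(\<lambda>w. indicator B w *\<^sub>R cmod (f w)) \<in> borel_measurable lebesgue"
      using f by (subst borel_measurable_restrict_space_iff[symmetric]) auto
    then obtain f0 where f0 [measurable]: "f0 \<in> borel_measurable lborel"
      and "AE w in lborel. indicator B w *\<^sub>R cmod (f w) = f0 w"
      using completion_ex_borel_measurable_real by blast
    then have AE_f: "AE w in lborel. w \<in> B \<longrightarrow> cmod (f w) = f0 w"
      by (auto elim: eventually_mono)
    define F where "F w = \<bar>f0 w\<bar> / N" for w
    have F [measurable]: "F \<in> borel_measurable borel"
      using f0 unfolding F_def[abs_def] by measurable
    have F0: "0 \<le> F w" for w using N by (simp add: F_def)
    have fF: "AE w in lborel. w \<in> B \<longrightarrow> cmod (f w) = N * F w"
      using AE_f
    proof (rule eventually_mono)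
      fix w assume "w \<in> B \<longrightarrow> cmod (f w) = f0 w"
      then have "f0 w = cmod (f w)" if "w \<in> B"
        using that by simp
      then have "\<bar>f0 w\<bar> = cmod (f w)" if "w \<in> B"
        using that by simp
      then show "w \<in> B \<longrightarrow> cmod (f w) = N * F w"
        using N by (simp add: F_def)
    qed
    have F1: "(\<integral>\<^sup>+w\<in>B. ennreal (F w * log_plus (F w)) \<partial>lborel) \<le> 1"
    proof -
      have "(\<integral>\<^sup>+w\<in>B. ennreal (F w * log_plus (F w)) \<partial>lborel)
          = (\<integral>\<^sup>+w\<in>B. ennreal (cmod (f w) / N * log_plus (cmod (f w) / N)) \<partial>lborel)"
        using fF N by (intro nn_integral_cong_AE) (auto simp: indicator_def elim!: eventually_mono)
      also have "\<dots> = (\<integral>\<^sup>+w\<in>B. ennreal (cmod (f w) / N * log_plus (cmod (f w) / N)) \<partial>lebesgue)"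
        by (rule nn_integral_completion[symmetric])
      also have "\<dots> = (\<integral>\<^sup>+w. ennreal (cmod (f w) / N * log_plus (cmod (f w) / N)) \<partial>lebesgue_on B)"
        by (rule nn_integral_restrict_space[symmetric]) simp
      finally show ?thesis using fN by simp
    qed
    have fin: "(\<integral>\<^sup>+w\<in>B. ennreal (log_weight w * F w) \<partial>lborel) < \<infinity>"
      using C2'[rule_format, OF F F0 F1] by (rule le_less_trans) simp
    have bm: "b \<in> borel_measurable (lebesgue_on B)"
      using harmonic_on_imp_continuous_on[OF harm] by (intro continuous_imp_measurable_on_sets_lebesgue) auto
    have bL: "cmod (b w - mean_on B b) \<le> C1 * M * log_weight w" if "norm w < 1" for w
      by (intro C1'[rule_format] harm M that)
    define H where "H z = ennreal (log_weight z) * bergman_pos (\<lambda>w. ennreal (F w)) z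
        + bergman_pos (\<lambda>w. ennreal (log_weight w * F w)) z" for z
    have [measurable]: "H \<in> borel_measurable borel"
      unfolding H_def[abs_def] by measurable
    have K: "0 \<le> C1 * M" using C1 M by simp
    note cb = commutator_bound[OF bm[unfolded B_def] f[unfolded B_def] F F0 fF[unfolded B_def] less_imp_le[OF N] bL K fin[unfolded B_def], folded c_def H_def]
    define \<kappa> where "\<kappa> = c * (C1 * M) * N"
    have \<kappa>: "0 < \<kappa>" using c C1 M N by (simp add: \<kappa>_def)
    have "weak_L1_norm (bergman_commutator (\<lambda>w. cnj (b w)) f) \<le> ennreal (C3 * c * C1 * M * N)"
      unfolding weak_L1_norm_def
    proof (rule SUP_least)
      fix t :: real assume "t \<in> {0<..}"
      then have t: "0 < t" by simp
      have sub: "{z \<in> ball 0 1. t < cmod (bergman_commutator (\<lambda>w. cnj (b w)) f z)} \<subseteq> {z \<in> B. ennreal (t / \<kappa>) < H z}"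
      proof safe
        fix z assume z: "z \<in> ball 0 1" "t < cmod (bergman_commutator (\<lambda>w. cnj (b w)) f z)"
        then show "z \<in> B" by (simp add: B_def)
        show "ennreal (t / \<kappa>) < H z"
        proof (rule ccontr)
          assume "\<not> ennreal (t / \<kappa>) < H z"
          then have "ennreal \<kappa> * H z \<le> ennreal \<kappa> * ennreal (t / \<kappa>)"
            by (intro mult_left_mono) auto
          also have "\<dots> = ennreal t"
            using \<kappa> t by (subst ennreal_mult[symmetric]) auto
          finally have "ennreal (cmod (bergman_commutator (\<lambda>w. cnj (b w)) f z)) \<le> ennreal t"
            using cb(3)[of z] z(1) by (auto simp: \<kappa>_def intro: order_trans)
          then show False
            using z(2) t by (simp add: ennreal_le_iff)
        qed
      qed
      have "emeasure lebesgue {z \<in> ball 0 1. t < cmod (bergman_commutator (\<lambda>w. cnj (b w)) f z)}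
          \<le> emeasure lebesgue {z \<in> B. ennreal (t / \<kappa>) < H z}"
        using sub by (rule emeasure_mono) (intro sets_completionI_sets, measurable)
      also have "\<dots> = emeasure lborel {z \<in> B. ennreal (t / \<kappa>) < H z}"
      proof -
        have "{z \<in> B. ennreal (t / \<kappa>) < H z} \<in> sets lborel"
          by measurable
        then show ?thesis by simp
      qed
      also have "\<dots> \<le> ennreal (C3 / (t / \<kappa>))"
        unfolding H_def using t \<kappa> by (intro C3'[rule_format] F F0 F1) auto
      finally have "ennreal t * emeasure lebesgue {z \<in> ball 0 1. t < cmod (bergman_commutator (\<lambda>w. cnj (b w)) f z)}
          \<le> ennreal t * ennreal (C3 / (t / \<kappa>))"
        by (rule mult_left_mono) simp
      also have "\<dots> = ennreal (t * (C3 / (t / \<kappa>)))"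
        using t \<kappa> C3 by (intro ennreal_mult[symmetric]) auto
      also have "t * (C3 / (t / \<kappa>)) = C3 * c * C1 * M * N"
      proof -
        have "t * (C3 / (t / \<kappa>)) = C3 * \<kappa>"
          using t \<kappa> by simp
        then show ?thesis
          by (simp only: \<kappa>_def mult.assoc)
      qed
      finally show "ennreal t * emeasure lebesgue {z \<in> ball 0 1. t < cmod (bergman_commutator (\<lambda>w. cnj (b w)) f z)}
          \<le> ennreal (C3 * c * C1 * M * N)" .
    qed
    with cb(1,2) show ?thesis by blast
  qed
  show ?thesis
  proof (intro exI[of _ "C3 * c * C1"] conjI allI impI)
    show "0 < C3 * c * C1" using C1 C3 c by simp
    fix b f :: "complex ^ 'n \<Rightarrow> complex"
    assume asm: "harmonic_on (ball 0 1) b \<and> b \<in> bmo \<and> f \<in> LlogL"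
    have harm: "harmonic_on B b" and fm: "f \<in> borel_measurable (lebesgue_on B)"
      using asm by (auto simp: B_def LlogL_def)
    have "bmo_norm b < top" "LlogL_norm f < top"
      using asm by (auto simp: bmo_def LlogL_def)
    then obtain \<beta> l where \<beta>: "bmo_norm b = ennreal \<beta>" "0 \<le> \<beta>" and l: "LlogL_norm f = ennreal l" "0 \<le> l"
      unfolding less_top_ennreal by blast
    have eps: "bergman_defined f \<and> bergman_defined (\<lambda>w. cnj (b w) * f w) \<and>
        weak_L1_norm (bergman_commutator (\<lambda>w. cnj (b w)) f) \<le> ennreal (C3 * c * C1 * (\<beta> + \<epsilon>) * (l + \<epsilon>))"
      if \<epsilon>: "0 < \<epsilon>" for \<epsilon>
    proof -
      \<comment> \<open>The strict inequality yields an admissible \<open>N\<close> below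
        \<open>l + \<epsilon>\<close>.\<close>
      have "LlogL_norm f < ennreal (l + \<epsilon>)"
        unfolding l(1) using l(2) \<epsilon> by (simp add: ennreal_lessI)
      then obtain N where N: "0 < N" "(\<integral>\<^sup>+w. ennreal (cmod (f w) / N * log_plus (cmod (f w) / N)) \<partial>lebesgue_on B) \<le> 1"
        "ennreal N < ennreal (l + \<epsilon>)"
        unfolding LlogL_norm_def INF_less_iff B_def by auto
      have "N < l + \<epsilon>"
        using N(1,3) ennreal_less_iff[of N "l + \<epsilon>"] by simp
      have bN: "bergman_defined f \<and> bergman_defined (\<lambda>w. cnj (b w) * f w) \<and>
          weak_L1_norm (bergman_commutator (\<lambda>w. cnj (b w)) f) \<le> ennreal (C3 * c * C1 * (\<beta> + \<epsilon>) * N)"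
        using \<beta> \<epsilon> by (intro bound harm fm N) (auto intro: ennreal_leI)
      moreover have "ennreal (C3 * c * C1 * (\<beta> + \<epsilon>) * N) \<le> ennreal (C3 * c * C1 * (\<beta> + \<epsilon>) * (l + \<epsilon>))"
        using \<open>N < l + \<epsilon>\<close> \<beta>(2) \<epsilon> C1 C3 c by (intro ennreal_leI mult_left_mono) auto
      ultimately show ?thesis
        by (meson order_trans)
    qed
    show "bergman_defined f" "bergman_defined (\<lambda>w. cnj (b w) * f w)"
      using eps[of 1] by auto
    have "weak_L1_norm (bergman_commutator (\<lambda>w. cnj (b w)) f) \<le> ennreal (C3 * c * C1 * \<beta> * l)"
      using eps by (rule le_ennreal_mult_limit[OF conjunct2[OF conjunct2]])
    also have "\<dots> = ennreal (C3 * c * C1) * bmo_norm b * LlogL_norm f"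
      unfolding \<beta>(1) l(1) using \<beta>(2) l(2) C1 C3 c by (simp add: ennreal_mult)
    finally show "weak_L1_norm (bergman_commutator (\<lambda>w. cnj (b w)) f)
        \<le> ennreal (C3 * c * C1) * bmo_norm b * LlogL_norm f" .
  qed
qed

end
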